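(* Let $p>1$. For any bounded hyperbolic component $\Omega_p$ or $\Omega_p'$ of the family $f_\lambda(z)=\lambda\tan z$, $\lambda\in\mathbb{C}\setminus\{0\}$, the virtual center $\lambda^*$ is finite and $f_{\lambda^*}^{\circ(p-1)}(\lambda^* i)=\infty$; that is, $\lambda^* i$ is a prepole of order $p-1$ of $f_{\lambda^*}$.
   Context: For $\lambda\in\mathbb{C}\setminus\{0\}$ let $f_\lambda(z)=\lambda\tan z$; its asymptotic values are $\pm\lambda i$ and its poles are $s_n=(n+\tfrac12)\pi$, $n\in\mathbb{Z}$. A prepole of order $k\ge1$ of $f_\lambda$ is a point $z$ such that $f_\lambda^{\circ(k-1)}(z)$ is a pole, i.e. $f_\lambda^{\circ k}(z)=\infty$. Let $\mathcal{H}$ be the set of $\lambda\in\mathbb{C}\setminus\{0\}$ such that $f_\lambda$ has an attracting periodic cycle; its connected components are the hyperbolic components, and $\Delta^*=\{0<|\lambda|<1\}$ is one of them. For any other hyperbolic component there is an integer $p\ge1$ such that either (a) for every $\lambda$ in it, $f_\lambda$ has exactly two distinct attracting cycles, both of period $p$, symmetric to each other under $z\mapsto -z$ (and having equal multipliers), in which case it is denoted $\Omega_p$; or (b) for every $\lambda$ in it, $f_\lambda$ has exactly one attracting cycle, of period $2p$, attracting both asymptotic values, in which case it is denoted $\Omega_p'$. For a hyperbolic component $\Omega\ne\Delta^*$, the eigenvalue map $m:\Omega\to\Delta^*$, sending $\lambda$ to the multiplier of an attracting cycle of $f_\lambda$, is an infinite degree regular covering that lifts (via a branch of the logarithm) to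 a conformal isomorphism $\tilde m$ of $\Omega$ onto the upper half plane, where $\mathrm{Im}\,\tilde m$ is a positive constant times $-\log|m|$. The internal rays of $\Omega$ are the preimages under $\tilde m$ of vertical half-lines, i.e. curves on which $m=re^{2\pi i\alpha}$ with $\alpha$ constant and $0<r<1$. As $r\to0$ they all end at a common boundary point of $\Omega$ (in $\hat{\mathbb{C}}$), corresponding to $\infty$ under $\tilde m$; this point is called the virtual center of $\Omega$. *)

theory Defs
  imports "HOL-Complex_Analysis.Complex_Analysis"
begin

section \<open>The tangent family and its orbits\<close>

definition tan_map :: "complex \<Rightarrow> complex \<Rightarrow> complex" where
  "tan_map lam z = lam * tan z"

text \<open>
  The library function tan takes the value 0 at its poles, so an iterate (tan_map lam ^^ n) z is
  the true value of the n-th iterate of the meromorphic map only if none of the first n points of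
  the orbit is a pole. All notions below require this explicitly.
\<close>

lemma is_pole_tan_map_iff:
  assumes "lam \<noteq> 0"
  shows "is_pole (tan_map lam) z \<longleftrightarrow> (\<exists>n::int. z = complex_of_real ((of_int n + 1/2) * pi))"
proof -
  have "is_pole (tan_map lam) z \<longleftrightarrow> cos z = 0"
  proof
    assume "cos z = 0"
    then have s: "lam * sin z \<noteq> 0"
      using assms sin_cos_squared_add[of z] by auto
    have "cos holomorphic_on (UNIV :: complex set)"
      by (intro holomorphic_on_cos)
    moreover have "cos (0::complex) \<noteq> cos z"
      using \<open>cos z = 0\<close> by simp
    ultimately obtain r where "r > 0" "\<And>w. w \<in> ball z r - {z} \<Longrightarrow> cos w \<noteq> 0"
      using isolated_zeros[of cos UNIV z 0] \<open>cos z = 0\<close> by auto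
    then have "eventually (\<lambda>w. cos w \<noteq> 0) (at z)"
      unfolding eventually_at by (intro exI[of _ r]) (auto simp: dist_commute)
    moreover have "cos \<midarrow>z\<rightarrow> (0::complex)"
      using \<open>cos z = 0\<close> by (metis isCont_cos isCont_def continuous_ident)
    ultimately have "filterlim cos (at 0) (at z)"
      by (simp add: filterlim_at)
    moreover have "(\<lambda>w. lam * sin w) \<midarrow>z\<rightarrow> lam * sin z"
      by (intro tendsto_intros)
    ultimately have "filterlim (\<lambda>w. lam * sin w / cos w) at_infinity (at z)"
      using s by (intro filterlim_divide_at_infinity)
    then show "is_pole (tan_map lam) z"
      by (simp add: is_pole_def tan_map_def[abs_def] tan_def)
  next
    assume p: "is_pole (tan_map lam) z"
    show "cos z = 0"
    proof (rule ccontr)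
      assume "cos z \<noteq> 0"
      then have "(tan_map lam \<longlongrightarrow> tan_map lam z) (at z)"
        unfolding tan_map_def[abs_def] by (intro tendsto_intros)
      then show False
        using p not_tendsto_and_filterlim_at_infinity[of "at z"] by (auto simp: is_pole_def)
    qed
  qed
  also have "\<dots> \<longleftrightarrow> (\<exists>n::int. z = complex_of_real ((of_int n + 1/2) * pi))"
    by (simp add: cos_eq_0 algebra_simps)
  finally show ?thesis .
qed

text \<open>The point z is a prepole of order k: the k-th iterate at z is defined and equals infinity.\<close>

definition prepole :: "complex \<Rightarrow> nat \<Rightarrow> complex \<Rightarrow> bool" where
  "prepole lam k z \<longleftrightarrow> k \<ge> 1 \<and>
     (\<forall>j<k - 1. \<not> is_pole (tan_map lam) ((tan_map lam ^^ j) z)) \<and>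
     is_pole (tan_map lam) ((tan_map lam ^^ (k - 1)) z)"


section \<open>Attracting cycles\<close>

definition periodic_cycle :: "complex \<Rightarrow> nat \<Rightarrow> complex set \<Rightarrow> bool" where
  "periodic_cycle lam n C \<longleftrightarrow> n \<ge> 1 \<and>
     (\<exists>z. (tan_map lam ^^ n) z = z \<and>
          (\<forall>j. 0 < j \<and> j < n \<longrightarrow> (tan_map lam ^^ j) z \<noteq> z) \<and>
          (\<forall>j<n. \<not> is_pole (tan_map lam) ((tan_map lam ^^ j) z)) \<and>
          C = (\<lambda>j. (tan_map lam ^^ j) z) ` {..<n})"

text \<open>
  The period of a cycle C is card C. By the chain rule the derivative below is the same at every
  point of the cycle.
\<close>

definition cycle_multiplier :: "complex \<Rightarrow> complex set \<Rightarrow> complex" where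
  "cycle_multiplier lam C = deriv (tan_map lam ^^ card C) (SOME z. z \<in> C)"

definition attracting_cycle :: "complex \<Rightarrow> nat \<Rightarrow> complex set \<Rightarrow> bool" where
  "attracting_cycle lam n C \<longleftrightarrow> periodic_cycle lam n C \<and> norm (cycle_multiplier lam C) < 1"

definition attracting_cycles :: "complex \<Rightarrow> complex set set" where
  "attracting_cycles lam = {C. \<exists>n. attracting_cycle lam n C}"

definition attracted_to :: "complex \<Rightarrow> complex \<Rightarrow> complex set \<Rightarrow> bool" where
  "attracted_to lam v C \<longleftrightarrow>
     (\<forall>n. \<not> is_pole (tan_map lam) ((tan_map lam ^^ n) v)) \<and>
     (\<lambda>n. infdist ((tan_map lam ^^ n) v) C) \<longlonglongrightarrow> 0"


section \<open>Hyperbolic components\<close>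

definition hyperbolic_set :: "complex set" where
  "hyperbolic_set = {lam. lam \<noteq> 0 \<and> attracting_cycles lam \<noteq> {}}"

definition punctured_disk :: "complex set" where
  "punctured_disk = {w. 0 < norm w \<and> norm w < 1}"

definition Omega_component :: "nat \<Rightarrow> complex set \<Rightarrow> bool" where
  "Omega_component p \<Omega> \<longleftrightarrow>
     \<Omega> \<in> components hyperbolic_set \<and> \<Omega> \<noteq> punctured_disk \<and>
     (\<forall>lam\<in>\<Omega>. \<exists>C. attracting_cycles lam = {C, uminus ` C} \<and> C \<noteq> uminus ` C \<and>
        attracting_cycle lam p C \<and> attracting_cycle lam p (uminus ` C) \<and>
        cycle_multiplier lam C = cycle_multiplier lam (uminus ` C))"

definition Omega'_component :: "nat \<Rightarrow> complex set \<Rightarrow> bool" where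
  "Omega'_component p \<Omega> \<longleftrightarrow>
     \<Omega> \<in> components hyperbolic_set \<and> \<Omega> \<noteq> punctured_disk \<and>
     (\<forall>lam\<in>\<Omega>. \<exists>C. attracting_cycles lam = {C} \<and> attracting_cycle lam (2 * p) C \<and>
        attracted_to lam (lam * \<i>) C \<and> attracted_to lam (- (lam * \<i>)) C)"


section \<open>Internal rays and the virtual center\<close>

text \<open>Well defined since in each hyperbolic component all attracting cycles have one multiplier.\<close>

definition eigenvalue_map :: "complex \<Rightarrow> complex" where
  "eigenvalue_map lam =
     (THE m. \<exists>C\<in>attracting_cycles lam. m = cycle_multiplier lam C)"

text \<open>
  A lift of the eigenvalue map to a conformal isomorphism onto the upper half plane, normalised so
  that the imaginary part of the lift M is - log |m| / (2 pi) and its real part is the angle alpha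
  in m = r exp(2 pi i alpha).
\<close>

definition eigenvalue_lift :: "complex set \<Rightarrow> (complex \<Rightarrow> complex) \<Rightarrow> bool" where
  "eigenvalue_lift \<Omega> M \<longleftrightarrow>
     M holomorphic_on \<Omega> \<and> bij_betw M \<Omega> {w. Im w > 0} \<and>
     (\<forall>lam\<in>\<Omega>. exp (2 * of_real pi * \<i> * M lam) = eigenvalue_map lam)"

text \<open>
  The point with parameter t > 0 on the internal ray over the vertical half-line Re w = alpha; there
  m = r exp(2 pi i alpha) with r = exp(- 2 pi t), so that r tends to 0 as t tends to infinity.
\<close>

definition internal_ray :: "complex set \<Rightarrow> (complex \<Rightarrow> complex) \<Rightarrow> real \<Rightarrow> real \<Rightarrow> complex" where
  "internal_ray \<Omega> M \<alpha> t = inv_into \<Omega> M (Complex \<alpha> t)"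

text \<open>The Riemann sphere; None is the point at infinity.\<close>

definition riemann_sphere :: "complex option topology" where
  "riemann_sphere = Alexandroff_compactification euclidean"

text \<open>
  Two lifts of the eigenvalue map of a component differ by an integer translation, so the choice
  of M is immaterial; the sphere being Hausdorff, a component has at most one virtual center.
\<close>

definition is_virtual_center :: "complex set \<Rightarrow> complex option \<Rightarrow> bool" where
  "is_virtual_center \<Omega> v \<longleftrightarrow>
     v \<in> riemann_sphere frontier_of (Some ` \<Omega>) \<and>
     (\<exists>M. eigenvalue_lift \<Omega> M \<and>
        (\<forall>\<alpha>. limitin riemann_sphere (\<lambda>t. Some (internal_ray \<Omega> M \<alpha> t)) v at_top))"

end

theory Submission
  imports Defs
begin

text \<open>
  Let \<open>lam t\<close> be the parameter at height \<open>t\<close> on the internal ray over \<open>Re w = 0\<close>, so that the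
  multiplier there has modulus \<open>exp (- 2 pi t)\<close>. The parameters converge to the virtual center, which
  is finite because the component is bounded, and nonzero because \<open>0\<close> is an attracting fixed point
  for \<open>0 < |lam| < 1\<close>, while the attracting cycles in question have period greater than one.
  The attracting periodic points form a finite covering of the component
  (\<open>covering_attracting_bundle\<close>), so one of them can be followed continuously along the ray, and with it
  its whole orbit \<open>z 0 t, z 1 t, \<dots>\<close>.

  The derivative \<open>lam (1 + tan^2)\<close> never vanishes, so the multiplier can tend
  to zero only if some orbit point leaves every compact set. A finite cluster
  point of an orbit point is therefore carried onto a pole by the limit map. Such points form a
  countable set, and a path whose cluster points lie in a countable set converges in the sphere
  (\<open>countable_cluster_dichotomy\<close>). After a point tending to infinity the next one must tend to
  an asymptotic value (\<open>after_infinity\<close>): otherwise \<open>exp (2 i z)\<close> would have a finite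
  nonzero limit, and by continuity \<open>z\<close> itself would converge. Hence the orbit of the asymptotic value
  under the limit map hits a pole, after \<open>q\<close> steps say, and the cycle visits infinity exactly once every
  \<open>q + 1\<close> steps.

  To identify the order, it has to be shown that the cycle closes, up to sign, after one
  such excursion. Let \<open>y i\<close> be the successive points tending to infinity, with signs chosen to put them in
  the upper half plane, and \<open>e i = exp (2 i (y i))\<close>. Then
  \<open>1 / y (i + 1) = \<plusminus> (1 / A + \<beta> e i + O((e i)^2))\<close>, where \<open>A\<close> depends on the parameter only and tends
  to infinity. Since the inverse of the lift of the multiplier is univalent on the half plane and omits
  the virtual center, Bloch's theorem shows that the parameter cannot converge faster than a power
  of \<open>1 / t\<close> (\<open>univalent_omitted_value_growth\<close>). So the multiplier is smaller than any power of
  \<open>1 / |A|\<close>, and some \<open>y i\<close> is far higher than \<open>log |A|\<close>; the next one is very close to \<open>A\<close>. If \<open>A\<close> is ever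
  far enough above the curve \<open>Im A = log |A|\<close>, the return map contracts a disc about \<open>A\<close>, and a
  periodic chain in it is constant (\<open>contraction_return\<close>). If not, then \<open>|Re A|\<close> tends to
  infinity along the ray, so the phase of \<open>exp (2 i A)\<close> takes every value. At a time when the
  return map displaces \<open>A\<close> straight down, the later points stay below \<open>A\<close> and the
  chain never climbs back to the high point it came from (\<open>no_return_below\<close>), a contradiction. Both
  cases together are \<open>constant_orbit\<close>.

  A closing up to sign after \<open>q + 1\<close> steps gives \<open>q + 1 = p\<close> by divisibility: for two cycles exchanged
  by \<open>z \<mapsto> - z\<close> a point never reaches its own negative, and for one symmetric cycle of period \<open>2 p\<close>
  it does so after exactly \<open>p\<close> steps.
\<close>

text \<open>
  A coordinate on the cylinder of points modulo \<open>pi\<close>, on which \<open>tan\<close> is defined; it vanishes at the upper end.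
\<close>

abbreviation nome :: "complex \<Rightarrow> complex" where
  "nome w \<equiv> exp (2 * \<i> * w)"

section \<open>Constancy of logarithm branches along paths\<close>

text \<open>
  The difference is an integer multiple of \<open>pi\<close> depending continuously on \<open>t\<close>. This rigidity is used
  throughout: a point known only through its nome is known up to one translation for all times.
\<close>

lemma log_branch_constant:
  fixes u g :: "real \<Rightarrow> complex"
  assumes "continuous_on {T..} u" "continuous_on {T..} g"
    and eq: "\<And>t. t \<ge> T \<Longrightarrow> nome (u t) = nome (g t)"
  obtains N :: int where "\<And>t. t \<ge> T \<Longrightarrow> u t = g t + of_real (pi * of_int N)"
proof -
  define h where "h t = (u t - g t) / of_real pi" for t
  have int: "h t \<in> \<int>" if "t \<ge> T" for t
  proof -
    from eq[OF that] obtain n where "2 * \<i> * u t = 2 * \<i> * g t + complex_of_real (2 * of_int n * pi) * \<i>"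
      by (auto simp: exp_eq)
    then have "2 * \<i> * (u t - g t) = 2 * \<i> * (of_int n * of_real pi)"
      by (simp add: algebra_simps)
    then have "u t - g t = of_int n * of_real pi"
      using mult_left_cancel[of "2 * \<i>"] by simp
    then have "h t = of_int n" by (simp add: h_def)
    then show ?thesis by simp
  qed
  have "continuous_on {T..} h"
    unfolding h_def by (intro continuous_intros assms) auto
  then have "h constant_on {T..}"
  proof (rule continuous_discrete_range_constant[OF connected_Ici])
    fix t assume t: "t \<in> {T..}"
    have "1 \<le> norm (h s - h t)" if "s \<in> {T..}" "h s \<noteq> h t" for s
    proof -
      have "h s \<in> \<int>" "h t \<in> \<int>" using int t that by auto
      then obtain a b where "h s = of_int a" "h t = of_int b"
        by (elim Ints_cases)
      moreover from this have "norm (h s - h t) = of_int \<bar>a - b\<bar>"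
        by (metis norm_of_int of_int_diff of_int_abs)
      ultimately show ?thesis using that by (metis eq_iff_diff_eq_0 of_int_1_le_iff zero_less_abs_iff int_one_le_iff_zero_less)
    qed
    then show "\<exists>e>0. \<forall>s. s \<in> {T..} \<and> h s \<noteq> h t \<longrightarrow> e \<le> norm (h s - h t)"
      by (intro exI[of _ 1]) auto
  qed
  then obtain c where c: "\<And>t. t \<ge> T \<Longrightarrow> h t = c" by (auto simp: constant_on_def)
  have "c \<in> \<int>" using c[of T] int[of T] by simp
  then obtain N where "c = of_int N" by (elim Ints_cases)
  then have "u t = g t + of_real (pi * of_int N)" if "t \<ge> T" for t
    using c[OF that] by (simp add: h_def field_simps)
  then show ?thesis by (rule that)
qed

lemma attains_value_modulo:
  fixes \<phi> :: "real \<Rightarrow> real"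
  assumes cont: "continuous_on {T..} \<phi>" and lim: "filterlim (\<lambda>t. \<bar>\<phi> t\<bar>) at_top at_top"
  obtains t and N :: int where "t \<ge> T" "\<phi> t = c + 2 * pi * of_int N"
proof -
  have "eventually (\<lambda>t. \<bar>\<phi> t\<bar> \<ge> \<bar>\<phi> T\<bar> + 2 * pi) at_top"
    using lim by (simp add: filterlim_at_top)
  then obtain s where s: "s \<ge> T" "\<bar>\<phi> s\<bar> \<ge> \<bar>\<phi> T\<bar> + 2 * pi"
    unfolding eventually_at_top_linorder by (metis max.cobounded1 max.cobounded2)
  define lo where "lo = min (\<phi> s) (\<phi> T)"
  define N where "N = \<lceil>(lo - c) / (2 * pi)\<rceil>"
  have "(lo - c) / (2 * pi) \<le> of_int N" "of_int N < (lo - c) / (2 * pi) + 1"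
    unfolding N_def by linarith+
  then have N: "lo \<le> c + 2 * pi * of_int N" "c + 2 * pi * of_int N < lo + 2 * pi"
    using pi_gt_zero by (auto simp: field_simps)
  have "lo + 2 * pi \<le> max (\<phi> s) (\<phi> T)" using s(2) pi_gt_zero by (auto simp: lo_def)
  then have mem: "c + 2 * pi * of_int N \<in> {min (\<phi> s) (\<phi> T)..max (\<phi> s) (\<phi> T)}"
    using N by (auto simp: lo_def)
  have "connected (\<phi> ` {T..s})"
    by (intro connected_continuous_image continuous_on_subset[OF cont]) auto
  moreover have "min (\<phi> s) (\<phi> T) \<in> \<phi> ` {T..s}" "max (\<phi> s) (\<phi> T) \<in> \<phi> ` {T..s}"
    using s by (auto simp: min_def max_def)
  ultimately have "{min (\<phi> s) (\<phi> T)..max (\<phi> s) (\<phi> T)} \<subseteq> \<phi> ` {T..s}"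
    by (rule connected_contains_Icc)
  with mem have "c + 2 * pi * of_int N \<in> \<phi> ` {T..s}" by blast
  then obtain x where "x \<ge> T" "\<phi> x = c + 2 * pi * of_int N" by auto
  then show ?thesis by (rule that)
qed

section \<open>Displacement by the return map near infinity\<close>

text \<open>
  The return map has the form \<open>1 / (1 / A + r)\<close>, and \<open>- A^2 r\<close> is the first-order displacement from \<open>A\<close>.
\<close>

lemma reciprocal_perturbation:
  fixes A y' r \<tau> :: complex
  assumes A: "A \<noteq> 0" and \<tau>: "\<tau> = 1 \<or> \<tau> = -1" and y': "1 / y' = \<tau> * (1 / A + r)"
    and small: "norm A * norm r \<le> 1 / 2"
  shows "norm (\<tau> * y' - A) \<le> 2 * (norm A)\<^sup>2 * norm r"
proof -
  have Ar: "norm (A * r) \<le> 1 / 2" using small by (simp add: norm_mult)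
  then have half: "norm (1 + A * r) \<ge> 1 / 2"
    using norm_triangle_ineq4[of "1 + A * r" "A * r"] by simp
  then have nz: "1 + A * r \<noteq> 0" by auto
  have "1 / A + r = (1 + A * r) / A" using A by (simp add: field_simps)
  then have "1 / y' \<noteq> 0" using y' nz A \<tau> by auto
  then have "y' \<noteq> 0" by auto
  have "\<tau> * \<tau> = 1" using \<tau> by auto
  have "\<tau> * y' * (1 + A * r) = A"
  proof -
    have "1 / y' = \<tau> * ((1 + A * r) / A)" using y' A by (simp add: field_simps)
    then have "A = \<tau> * (1 + A * r) * y'" using \<open>y' \<noteq> 0\<close> A by (simp add: field_simps)
    then show ?thesis by (simp add: algebra_simps)
  qed
  then have "(\<tau> * y' - A) * (1 + A * r) = - (A * A * r)" by (simp add: algebra_simps)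
  then have "norm (\<tau> * y' - A) * norm (1 + A * r) = (norm A)\<^sup>2 * norm r"
    by (metis norm_minus_cancel norm_mult power2_eq_square)
  moreover have "norm (\<tau> * y' - A) * (1 / 2) \<le> norm (\<tau> * y' - A) * norm (1 + A * r)"
    by (intro mult_left_mono half) auto
  ultimately show ?thesis by simp
qed

lemma norm_cis_mult_minus_one_le:
  fixes \<sigma> :: complex
  assumes "\<bar>x\<bar> \<le> \<eta>" "norm \<sigma> \<le> s"
  shows "norm (cis (2 * x) * (1 + \<sigma>) - 1) \<le> 2 * \<eta> + s"
proof -
  have "(norm (cis (2 * x) - 1))\<^sup>2 = (2 * sin x)\<^sup>2"
  proof -
    have "(norm (cis (2 * x) - 1))\<^sup>2 = (cos (2 * x) - 1)\<^sup>2 + (sin (2 * x))\<^sup>2"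
      by (simp add: cmod_power2)
    also have "\<dots> = 2 - 2 * cos (2 * x)"
      using sin_cos_squared_add[of "2 * x"] by (simp add: power2_eq_square algebra_simps)
    also have "\<dots> = (2 * sin x)\<^sup>2" by (simp add: cos_double_sin power_mult_distrib)
    finally show ?thesis .
  qed
  then have "norm (cis (2 * x) - 1) = \<bar>2 * sin x\<bar>"
    by (metis abs_norm_cancel real_sqrt_abs)
  also have "\<dots> \<le> \<bar>2 * x\<bar>" using abs_sin_x_le_abs_x[of x] by simp
  finally have "norm (cis (2 * x) - 1) \<le> \<bar>2 * x\<bar>" .
  moreover have "cis (2 * x) * (1 + \<sigma>) - 1 = (cis (2 * x) - 1) + cis (2 * x) * \<sigma>"
    by (simp add: algebra_simps)
  then have "norm (cis (2 * x) * (1 + \<sigma>) - 1) \<le> norm (cis (2 * x) - 1) + norm \<sigma>"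
    by (metis norm_triangle_ineq norm_mult norm_cis mult_1)
  ultimately show ?thesis using assms by simp
qed

text \<open>
  Put \<open>D = A^2 r\<close>; the image is \<open>A^2 / (A + D)\<close>, about \<open>A - D\<close>. By the condition on \<open>c\<close> the vector \<open>D\<close> points
  straight up for \<open>y = A\<close>, and it turns only by the small angle \<open>2 Re (y - A)\<close> for other \<open>y\<close>. The
  image is required to stay in the upper half plane, which bounds \<open>|D|\<close> by a multiple of \<open>Im A\<close>; hence,
  up to a small error, the image lies below \<open>A\<close> with the same real part, and the step can be repeated.
\<close>

lemma downward_step:
  fixes A y y' \<beta> r :: complex and c K \<eta> :: real
  assumes c: "c > 0" "A\<^sup>2 * \<beta> * nome A = \<i> * of_real c"
    and \<beta>: "\<beta> \<noteq> 0" and K: "K \<ge> 0"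
    and y: "\<bar>Re (y - A)\<bar> \<le> \<eta>" and \<eta>: "\<eta> \<le> 1 / 10"
    and r: "norm (r - \<beta> * nome y) \<le> K * (norm (nome y))\<^sup>2"
    and e: "K * norm (nome y) \<le> norm \<beta> / 10"
    and y': "1 / y' = 1 / A + r" "Im y' > 0"
    and L: "Im A \<ge> 1" "12 * Im A \<le> norm A"
    and a: "32 * K \<le> (norm \<beta>)\<^sup>2 * norm A"
  shows "\<bar>Re (y' - A)\<bar> \<le> 8 * Im A * \<eta> + 73 * (Im A)\<^sup>2 / norm A"
    and "Im (y' - A) \<le> 8 * Im A * \<eta> + 73 * (Im A)\<^sup>2 / norm A"
proof -
  define L where "L = Im A"
  define a where "a = norm A"
  define e where "e = nome y"
  define \<sigma> where "\<sigma> = (r - \<beta> * e) / (\<beta> * e)"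
  define d where "d = c * exp (- 2 * Im (y - A))"
  define u where "u = cis (2 * Re (y - A)) * (1 + \<sigma>)"
  define D where "D = A\<^sup>2 * r"
  have La: "L \<ge> 1" "12 * L \<le> a" "a > 0" using L by (auto simp: L_def a_def)
  have e0: "e \<noteq> 0" by (simp add: e_def)
  have A0: "A \<noteq> 0" using La by (auto simp: a_def)
  have d0: "d > 0" using c by (simp add: d_def)
  have re: "r = \<beta> * e * (1 + \<sigma>)" using \<beta> e0 by (simp add: \<sigma>_def field_simps)
  have \<sigma>: "norm \<sigma> \<le> K * norm e / norm \<beta>"
  proof -
    have "norm \<sigma> \<le> K * (norm e)\<^sup>2 / (norm \<beta> * norm e)"
      unfolding \<sigma>_def norm_divide norm_mult using r by (intro divide_right_mono) (auto simp: e_def)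
    also have "\<dots> = K * norm e / norm \<beta>" using e0 by (simp add: power2_eq_square)
    finally show ?thesis .
  qed
  also have "\<dots> \<le> 1 / 10" using e \<beta> by (simp add: field_simps e_def)
  finally have \<sigma>1: "norm \<sigma> \<le> 1 / 10" .
  have Ae: "A\<^sup>2 * \<beta> * e = \<i> * of_real d * cis (2 * Re (y - A))"
  proof -
    have "e = nome A * nome (y - A)"
      by (simp add: e_def exp_add[symmetric] algebra_simps)
    moreover have "nome (y - A) = of_real (exp (- 2 * Im (y - A))) * cis (2 * Re (y - A))"
      by (simp add: exp_eq_polar)
    ultimately have "A\<^sup>2 * \<beta> * e = (A\<^sup>2 * \<beta> * nome A) * (of_real (exp (- 2 * Im (y - A))) * cis (2 * Re (y - A)))"
      by (simp add: mult_ac)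
    also have "\<dots> = \<i> * of_real d * cis (2 * Re (y - A))"
      unfolding c(2) by (simp add: d_def mult_ac)
    finally show ?thesis .
  qed
  have Du: "D = \<i> * of_real d * u"
  proof -
    have "D = (A\<^sup>2 * \<beta> * e) * (1 + \<sigma>)" by (simp add: D_def re mult_ac)
    then show ?thesis unfolding Ae u_def by (simp add: mult_ac)
  qed
  have u1: "norm (u - 1) \<le> 2 * \<eta> + norm \<sigma>"
    unfolding u_def by (rule norm_cis_mult_minus_one_le) (use y in auto)
  then have u2: "norm (u - 1) \<le> 1 / 2" using \<eta> \<sigma>1 by simp
  have Reu: "Re u \<ge> 1 / 2" using abs_Re_le_cmod[of "u - 1"] u2 by (auto simp: abs_le_iff)
  have nu: "norm u \<le> 3 / 2" using u2 norm_triangle_ineq[of "u - 1" 1] by simp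
  have nD: "norm D \<le> 3 / 2 * d" using nu d0 by (simp add: Du norm_mult)
  have ImD: "Im D \<ge> d / 2" using Reu d0 by (simp add: Du)
  have y'0: "y' \<noteq> 0" using y' by auto
  have yAD: "y' * (A + D) = A\<^sup>2"
  proof -
    have "A = y' * (1 + A * r)" using y'(1) A0 y'0 by (simp add: field_simps)
    moreover have "y' * (A + D) = y' * (1 + A * r) * A"
      by (simp add: D_def algebra_simps power2_eq_square)
    ultimately show ?thesis by (metis power2_eq_square)
  qed
  then have AD0: "A + D \<noteq> 0" using A0 by auto
  \<comment> \<open>An upward displacement by more than about \<open>Im A\<close> would push the image below the real axis.\<close>
  have d4: "d \<le> 4 * L"
  proof -
    have "y' = A\<^sup>2 * cnj (A + D) / of_real ((norm (A + D))\<^sup>2)"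
    proof -
      have "y' * ((A + D) * cnj (A + D)) = A\<^sup>2 * cnj (A + D)" using yAD by (simp add: mult.assoc)
      then show ?thesis using AD0 unfolding complex_norm_square[symmetric]
        by (simp add: field_simps)
    qed
    then have "Im y' = Im (A\<^sup>2 * cnj (A + D)) / (norm (A + D))\<^sup>2"
      by (metis Im_divide_of_real)
    then have pos: "Im (A\<^sup>2 * cnj (A + D)) > 0"
      using y'(2) AD0 by (simp add: zero_less_divide_iff)
    have 1: "Im (A\<^sup>2 * cnj A) = a\<^sup>2 * L"
    proof -
      have "A\<^sup>2 * cnj A = A * (A * cnj A)" by (simp add: power2_eq_square)
      also have "\<dots> = A * of_real (a\<^sup>2)" by (simp add: a_def complex_norm_square[symmetric])
      finally show ?thesis by (simp add: L_def)
    qed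
    have 2: "Im (A\<^sup>2 * cnj D) \<le> - (a\<^sup>2 * Im D) + 2 * a * L * norm D"
    proof -
      have "A\<^sup>2 * cnj D = A * cnj A * cnj D + A * (A - cnj A) * cnj D"
        by (simp add: power2_eq_square algebra_simps)
      also have "A * cnj A * cnj D = of_real (a\<^sup>2) * cnj D"
        by (simp add: a_def complex_norm_square[symmetric])
      finally have "Im (A\<^sup>2 * cnj D) = - (a\<^sup>2 * Im D) + Im (A * (A - cnj A) * cnj D)" by simp
      also have "Im (A * (A - cnj A) * cnj D) \<le> norm (A * (A - cnj A) * cnj D)"
        using abs_Im_le_cmod abs_le_D1 by blast
      also have "\<dots> = 2 * a * L * norm D"
        using La by (simp add: norm_mult complex_diff_cnj a_def L_def)
      finally show ?thesis by simp
    qed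
    have "0 < a\<^sup>2 * L - a\<^sup>2 * Im D + 2 * a * L * norm D"
      using pos 1 2 by (simp add: algebra_simps)
    moreover have "a\<^sup>2 * Im D \<ge> a\<^sup>2 * (d / 2)" using ImD by (intro mult_left_mono) auto
    moreover have "2 * a * L * norm D \<le> 2 * a * L * (3 / 2 * d)" using nD La by (intro mult_left_mono) auto
    moreover have "2 * a * L * (3 / 2 * d) \<le> a\<^sup>2 * (d / 4)"
    proof -
      have "12 * L * (a * d) \<le> a * (a * d)" using La d0 by (intro mult_right_mono) auto
      then show ?thesis by (simp add: power2_eq_square)
    qed
    moreover have "a\<^sup>2 * (L - d / 4) = a\<^sup>2 * L - a\<^sup>2 * (d / 2) + a\<^sup>2 * (d / 4)"
      by (simp add: algebra_simps)
    ultimately have "0 < a\<^sup>2 * (L - d / 4)" by linarith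
    then show ?thesis using La by (simp add: zero_less_mult_iff)
  qed
  have nD6: "norm D \<le> 6 * L" using nD d4 by simp
  have AD: "norm (A + D) \<ge> a / 2"
    using norm_triangle_ineq4[of "A + D" D] nD6 La by (simp add: a_def)
  define q where "q = D\<^sup>2 / (A + D)"
  have "norm q \<le> (6 * L)\<^sup>2 / (a / 2)"
    unfolding q_def norm_divide norm_power using nD6 AD La by (intro frac_le power_mono) auto
  then have q: "norm q \<le> 72 * L\<^sup>2 / a" by (simp add: power2_eq_square)
  have diff: "y' - A = - D + q"
    using yAD AD0 by (simp add: q_def field_simps power2_eq_square)
  have ne: "norm e * (a\<^sup>2 * norm \<beta>) = d"
  proof -
    have "norm (A\<^sup>2 * \<beta> * e) = d" unfolding Ae using d0 by (simp add: norm_mult)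
    then show ?thesis by (simp add: norm_mult norm_power a_def mult_ac)
  qed
  have \<sigma>2: "8 * L * norm \<sigma> \<le> 2 * L\<^sup>2 / a"
  proof -
    have "norm e = d / (a\<^sup>2 * norm \<beta>)" using ne La \<beta> by (simp add: field_simps)
    then have "norm \<sigma> \<le> K * d / (a\<^sup>2 * (norm \<beta>)\<^sup>2)"
      using \<sigma> by (simp add: power2_eq_square mult_ac)
    also have "\<dots> \<le> K * (4 * L) / (a\<^sup>2 * (norm \<beta>)\<^sup>2)"
      using d4 K by (intro divide_right_mono mult_left_mono) auto
    also have "\<dots> = (32 * K) * (L / 8) / (a\<^sup>2 * (norm \<beta>)\<^sup>2)" by simp
    also have "\<dots> \<le> ((norm \<beta>)\<^sup>2 * a) * (L / 8) / (a\<^sup>2 * (norm \<beta>)\<^sup>2)"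
      using a La by (intro divide_right_mono mult_right_mono) (auto simp: a_def)
    also have "\<dots> = L / (8 * a)" using \<beta> La by (simp add: power2_eq_square field_simps)
    finally have "8 * L * norm \<sigma> \<le> 8 * L * (L / (8 * a))" using La by (intro mult_left_mono) auto
    also have "\<dots> = L\<^sup>2 / a" by (simp add: power2_eq_square)
    also have "\<dots> \<le> 2 * L\<^sup>2 / a" using La by (simp add: divide_right_mono)
    finally show ?thesis .
  qed
  have \<eta>0: "\<eta> \<ge> 0" using y by linarith
  have ReD: "\<bar>Re D\<bar> \<le> 8 * L * \<eta> + L\<^sup>2 / a"
  proof -
    have "\<bar>Re D\<bar> = d * \<bar>Im (u - 1)\<bar>" using d0 by (simp add: Du abs_mult)
    also have "\<dots> \<le> 4 * L * (2 * \<eta> + norm \<sigma>)"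
      using d4 d0 La u1 abs_Im_le_cmod[of "u - 1"] by (intro mult_mono) linarith+
    also have "\<dots> \<le> 8 * L * \<eta> + L\<^sup>2 / a" using \<sigma>2 by (simp add: algebra_simps)
    finally show ?thesis .
  qed
  have tot: "L\<^sup>2 / a + 72 * L\<^sup>2 / a = 73 * L\<^sup>2 / a" by (simp add: field_simps)
  have "\<bar>Re (y' - A)\<bar> \<le> \<bar>Re D\<bar> + norm q"
    using abs_Re_le_cmod[of q] by (simp add: diff)
  then show "\<bar>Re (y' - A)\<bar> \<le> 8 * Im A * \<eta> + 73 * (Im A)\<^sup>2 / norm A"
    using ReD q tot by (simp add: L_def a_def)
  have "Im (y' - A) \<le> - Im D + norm q"
    using abs_Im_le_cmod[of q] by (simp add: diff)
  also have "\<dots> \<le> norm q" using ImD d0 by simp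
  also have "\<dots> \<le> 8 * L * \<eta> + 73 * L\<^sup>2 / a"
    using q tot La \<eta>0 by (smt (verit) divide_nonneg_pos mult_nonneg_nonneg zero_le_power2)
  finally show "Im (y' - A) \<le> 8 * Im A * \<eta> + 73 * (Im A)\<^sup>2 / norm A"
    by (simp add: L_def a_def)
qed

text \<open>
  The factor \<open>81 Im A\<close> absorbs both terms of the error in \<open>downward_step\<close>: the old error times
  \<open>8 Im A\<close> and the new one \<open>73 (Im A)^2 / |A|\<close>.
\<close>

lemma geometric_error_growth:
  fixes L a :: real
  assumes "L \<ge> 1" "a > 0"
  shows "8 * L * ((81 * L) ^ l * (81 * L\<^sup>2 / a)) + 73 * L\<^sup>2 / a \<le> (81 * L) ^ Suc l * (81 * L\<^sup>2 / a)"
proof -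
  define P where "P = (81 * L) ^ l"
  have P: "P \<ge> 1" unfolding P_def using assms by (intro one_le_power) simp
  have "73 * L\<^sup>2 \<le> 73 * L * P * (81 * L\<^sup>2)"
  proof -
    have "1 * 1 \<le> L * P" using assms P by (intro mult_mono) auto
    then have "1 * L\<^sup>2 \<le> (L * P) * L\<^sup>2" by (intro mult_right_mono) auto
    then have "73 * L\<^sup>2 \<le> 73 * (L * P * L\<^sup>2)" by simp
    also have "\<dots> \<le> 73 * (L * P * (81 * L\<^sup>2))" using assms P by (intro mult_left_mono) auto
    finally show ?thesis by (simp add: mult.assoc)
  qed
  then have "8 * L * P * (81 * L\<^sup>2) + 73 * L\<^sup>2 \<le> 81 * L * P * (81 * L\<^sup>2)" by simp
  then have "(8 * L * P * (81 * L\<^sup>2) + 73 * L\<^sup>2) / a \<le> (81 * L * P * (81 * L\<^sup>2)) / a"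
    using assms by (intro divide_right_mono) auto
  then show ?thesis by (simp add: P_def add_divide_distrib mult_ac)
qed

text \<open>
  As long as the accumulated error is small, the sign is positive and \<open>downward_step\<close> applies to the next
  point.
\<close>

lemma no_return_below:
  fixes y :: "nat \<Rightarrow> complex" and A \<beta> :: complex and \<tau> :: "nat \<Rightarrow> complex" and c K :: real
    and R :: "complex \<Rightarrow> complex"
  assumes c: "c > 0" "A\<^sup>2 * \<beta> * nome A = \<i> * of_real c"
    and \<beta>: "\<beta> \<noteq> 0" and K: "K \<ge> 0"
    and R: "\<And>j. norm (R (nome (y j)) - \<beta> * nome (y j)) \<le> K * (norm (nome (y j)))\<^sup>2"
    and e: "\<And>j. K * norm (nome (y j)) \<le> norm \<beta> / 10"
    and rec: "\<And>j. 1 / y (Suc j) = \<tau> j * (1 / A + R (nome (y j)))"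
    and Im: "\<And>j. Im (y j) > 0"
    and L: "Im A \<ge> 1" "12 * Im A \<le> norm A"
    and a: "32 * K \<le> (norm \<beta>)\<^sup>2 * norm A"
    and \<tau>: "\<And>j. \<lbrakk>j < k; \<bar>Re (y j - A)\<bar> \<le> 1\<rbrakk> \<Longrightarrow> \<tau> j = 1"
    and small: "(81 * Im A) ^ k * (81 * (Im A)\<^sup>2 / norm A) \<le> 1 / 10"
    and start: "norm (y 0 - A) \<le> 81 * (Im A)\<^sup>2 / norm A"
    and l: "l \<le> k"
  shows "\<bar>Re (y l - A)\<bar> \<le> (81 * Im A) ^ l * (81 * (Im A)\<^sup>2 / norm A) \<and>
     Im (y l - A) \<le> (81 * Im A) ^ l * (81 * (Im A)\<^sup>2 / norm A)"
  using l
proof (induction l)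
  case 0
  then show ?case using start abs_Re_le_cmod[of "y 0 - A"] abs_Im_le_cmod[of "y 0 - A"] by auto
next
  case (Suc l)
  define \<eta> where "\<eta> = (81 * Im A) ^ l * (81 * (Im A)\<^sup>2 / norm A)"
  have A0: "norm A > 0" using L by auto
  have "\<eta> \<le> (81 * Im A) ^ k * (81 * (Im A)\<^sup>2 / norm A)"
    unfolding \<eta>_def using Suc.prems L by (intro mult_right_mono power_increasing) auto
  then have \<eta>: "\<eta> \<le> 1 / 10" using small by simp
  have IH: "\<bar>Re (y l - A)\<bar> \<le> \<eta>" using Suc by (simp add: \<eta>_def)
  have \<tau>1: "\<tau> l = 1" using \<tau>[of l] IH \<eta> Suc.prems by simp
  have rec1: "1 / y (Suc l) = 1 / A + R (nome (y l))" using rec[of l] \<tau>1 by simp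
  note step = downward_step[OF c \<beta> K IH \<eta> R e rec1 Im L a]
  have "8 * Im A * \<eta> + 73 * (Im A)\<^sup>2 / norm A \<le> (81 * Im A) ^ Suc l * (81 * (Im A)\<^sup>2 / norm A)"
    unfolding \<eta>_def by (rule geometric_error_growth) (use L A0 in auto)
  with step show ?case by linarith
qed

lemma norm_exp_2i_diff_le:
  assumes "Im x \<ge> m" "Im y \<ge> m"
  shows "norm (nome x - nome y) \<le> 2 * exp (- 2 * m) * norm (x - y)"
proof -
  have "convex {z. Im z \<ge> m}" by (rule convex_halfspace_Im_ge)
  then show ?thesis
  proof (rule field_differentiable_bound)
    fix z :: complex assume "z \<in> {z. Im z \<ge> m}"
    show "((\<lambda>z. nome z) has_field_derivative 2 * \<i> * nome z) (at z within {z. Im z \<ge> m})"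
      by (auto intro!: derivative_eq_intros)
    show "norm (2 * \<i> * nome z) \<le> 2 * exp (- 2 * m)"
      using \<open>z \<in> _\<close> by (simp add: norm_mult)
  qed (use assms in auto)
qed

lemma periodic_halving_zero:
  fixes d :: "nat \<Rightarrow> real"
  assumes k: "k \<ge> 1" and per: "\<And>i. d (i + k) = d i" and nn: "\<And>i. d i \<ge> 0"
    and half: "\<And>i. i \<ge> m \<Longrightarrow> d (Suc i) \<le> d i / 2"
  shows "d i = 0"
proof -
  have per': "d (i + j * k) = d i" for i j
  proof (induction j)
    case (Suc j)
    have "d (i + Suc j * k) = d ((i + j * k) + k)" by (simp add: algebra_simps)
    then show ?case using per Suc by simp
  qed simp
  have le: "d (i + j) \<le> d i / 2 ^ j" if "i \<ge> m" for i j
  proof (induction j)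
    case (Suc j)
    have "d (i + Suc j) \<le> d (i + j) / 2" using half[of "i + j"] that by simp
    also have "\<dots> \<le> d i / 2 ^ Suc j" using Suc by simp
    finally show ?case .
  qed simp
  define i' where "i' = i + m * k"
  have "i' \<ge> m" using k by (simp add: i'_def trans_le_add2)
  then have "d i' \<le> d i' / 2 ^ k" using le[of i' k] per[of i'] by simp
  moreover have "(2::real) ^ 1 \<le> 2 ^ k" by (rule power_increasing) (use k in auto)
  ultimately have "d i' \<le> 0" by (smt (verit) nn divide_left_mono field_sum_of_halves power_one_right zero_less_power mult_pos_pos)
  then show ?thesis using nn[of i'] per'[of i m] by (simp add: i'_def)
qed

text \<open>
  The unit disc about \<open>A\<close> is mapped into itself with Lipschitz constant \<open>1/2\<close>, because there the nome is of
  order \<open>exp (- 2 Im A)\<close> while the reciprocal expands by \<open>|A|^2\<close>. The negative sign is impossible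
  inside the disc, since it would lead to the lower half plane.
\<close>

lemma contraction_return:
  fixes y :: "nat \<Rightarrow> complex" and A \<beta> :: complex and \<tau> :: "nat \<Rightarrow> complex" and K \<delta> :: real
    and R :: "complex \<Rightarrow> complex"
  assumes \<tau>: "\<And>j. \<tau> j = 1 \<or> \<tau> j = -1"
    and K: "K \<ge> 1" and \<delta>: "\<delta> > 0"
    and R0: "\<And>e. norm e \<le> \<delta> \<Longrightarrow> norm (R e) \<le> K * norm e"
    and R: "\<And>e e'. \<lbrakk>norm e \<le> \<delta>; norm e' \<le> \<delta>\<rbrakk> \<Longrightarrow> norm (R e - R e') \<le> K * norm (e - e')"
    and rec: "\<And>j. 1 / y (Suc j) = \<tau> j * (1 / A + R (nome (y j)))"
    and Im: "\<And>j. Im (y j) > 0"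
    and L: "Im A \<ge> 2" "exp (2 - 2 * Im A) \<le> \<delta>"
    and high: "128 * K * (norm A)\<^sup>2 * exp (- 2 * Im A) \<le> 1"
    and start: "norm (y m - A) \<le> 1"
    and k: "k \<ge> 1" "\<And>i. y (i + k) = y i"
  shows "y (Suc i) = y i"
proof -
  have A0: "A \<noteq> 0" using L by auto
  have nA: "norm A \<ge> 2" using L abs_Im_le_cmod[of A] by linarith
  have e2: "exp (2::real) \<le> 8"
  proof -
    have "exp (2::real) = exp 1 * exp 1" by (simp add: exp_add[symmetric])
    also have "\<dots> \<le> 2.72 * 2.72" using e_less_272 by (intro mult_mono) auto
    finally show ?thesis by simp
  qed
  have emA: "norm (nome z) \<le> 8 * exp (- 2 * Im A)" "norm (nome z) \<le> \<delta>"
    if "norm (z - A) \<le> 1" for z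
  proof -
    have "Im z \<ge> Im A - 1" using that abs_Im_le_cmod[of "z - A"] by auto
    then have 1: "norm (nome z) \<le> exp (2 - 2 * Im A)" by simp
    also have "\<dots> = exp 2 * exp (- 2 * Im A)" by (simp add: exp_add[symmetric])
    also have "\<dots> \<le> 8 * exp (- 2 * Im A)" using e2 by (intro mult_right_mono) auto
    finally show "norm (nome z) \<le> 8 * exp (- 2 * Im A)" .
    show "norm (nome z) \<le> \<delta>" using 1 L(2) by (rule order_trans)
  qed
  have near: "norm (y (Suc j) - A) \<le> 1 / 2 \<and> \<tau> j = 1" if j: "norm (y j - A) \<le> 1" for j
  proof -
    define r where "r = R (nome (y j))"
    have "norm r \<le> K * norm (nome (y j))" unfolding r_def by (rule R0[OF emA(2)[OF j]])
    also have "\<dots> \<le> K * (8 * exp (- 2 * Im A))" using K emA(1)[OF j] by (intro mult_left_mono) auto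
    finally have r1: "norm r \<le> K * (8 * exp (- 2 * Im A))" .
    have "(norm A)\<^sup>2 * norm r \<le> (norm A)\<^sup>2 * (K * (8 * exp (- 2 * Im A)))"
      using r1 by (intro mult_left_mono) auto
    then have r: "(norm A)\<^sup>2 * norm r \<le> 1 / 16" using high by (simp add: mult_ac)
    have "norm A * norm r \<le> (norm A)\<^sup>2 * norm r"
      using nA self_le_power[of "norm A" 2] by (intro mult_right_mono) auto
    then have "norm A * norm r \<le> 1 / 2" using r by simp
    from reciprocal_perturbation[OF A0 \<tau> rec[of j, folded r_def] this]
    have n: "norm (\<tau> j * y (Suc j) - A) \<le> 1 / 2" using r by simp
    have "Im (\<tau> j * y (Suc j)) > 0"
      using n abs_Im_le_cmod[of "\<tau> j * y (Suc j) - A"] L by auto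
    then have "\<tau> j = 1" using \<tau>[of j] Im[of "Suc j"] by auto
    then show ?thesis using n by simp
  qed
  have all: "norm (y j - A) \<le> 1" if "j \<ge> m" for j
    using that
  proof (induction j rule: dec_induct)
    case base then show ?case by (rule start)
  next
    case (step j) then show ?case using near[of j] by simp
  qed
  have contr: "norm (y (Suc (Suc j)) - y (Suc j)) \<le> norm (y (Suc j) - y j) / 2" if "j \<ge> m" for j
  proof -
    define e e' where "e = nome (y (Suc j))" and "e' = nome (y j)"
    have yb: "norm (y (Suc j)) \<le> 2 * norm A" "norm (y (Suc (Suc j))) \<le> 2 * norm A"
      using all[of "Suc j"] all[of "Suc (Suc j)"] that nA
        norm_triangle_ineq2[of "y (Suc j)" A] norm_triangle_ineq2[of "y (Suc (Suc j))" A] by auto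
    have ynz: "y i \<noteq> 0" for i using Im[of i] by auto
    have t1: "\<tau> j = 1" "\<tau> (Suc j) = 1" using near[of j] near[of "Suc j"] all that by auto
    have "y (Suc (Suc j)) - y (Suc j) = y (Suc (Suc j)) * y (Suc j) * (1 / y (Suc j) - 1 / y (Suc (Suc j)))"
      using ynz by (simp add: field_simps)
    also have "1 / y (Suc j) - 1 / y (Suc (Suc j)) = R e' - R e"
      unfolding rec t1 e_def e'_def by simp
    finally have "norm (y (Suc (Suc j)) - y (Suc j)) = norm (y (Suc (Suc j))) * norm (y (Suc j)) * norm (R e' - R e)"
      by (simp add: norm_mult)
    also have "\<dots> \<le> (2 * norm A) * (2 * norm A) * (K * norm (e' - e))"
      using yb R[of e' e] emA(2)[OF all[of j]] emA(2)[OF all[of "Suc j"]] that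
      by (intro mult_mono) (auto simp: e_def e'_def)
    also have "norm (e' - e) \<le> 2 * exp (- 2 * (Im A - 1)) * norm (y j - y (Suc j))"
      unfolding e_def e'_def
    proof (rule norm_exp_2i_diff_le)
      show "Im A - 1 \<le> Im (y j)" "Im A - 1 \<le> Im (y (Suc j))"
        using all[of j] all[of "Suc j"] that abs_Im_le_cmod[of "y j - A"] abs_Im_le_cmod[of "y (Suc j) - A"] by auto
    qed
    also have "2 * exp (- 2 * (Im A - 1)) = 2 * (exp 2 * exp (- 2 * Im A))"
      by (simp add: exp_add[symmetric] algebra_simps)
    also have "2 * norm A * (2 * norm A) * (K * (2 * (exp 2 * exp (- 2 * Im A)) * norm (y j - y (Suc j)))) \<le>
       2 * norm A * (2 * norm A) * (K * (2 * (8 * exp (- 2 * Im A)) * norm (y j - y (Suc j))))"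
      using e2 K by (intro mult_left_mono mult_right_mono) auto
    also have "\<dots> = (128 * K * (norm A)\<^sup>2 * exp (- 2 * Im A)) * (norm (y (Suc j) - y j) / 2)"
      by (simp add: power2_eq_square norm_minus_commute)
    also have "\<dots> \<le> 1 * (norm (y (Suc j) - y j) / 2)" using high by (intro mult_right_mono) auto
    finally show ?thesis using K by (simp add: mult_left_mono)
  qed
  have per: "norm (y (Suc (i + k)) - y (i + k)) = norm (y (Suc i) - y i)" for i
    using k(2)[of "Suc i"] k(2)[of i] by simp
  have "norm (y (Suc i) - y i) = 0"
    by (rule periodic_halving_zero[where m = m, OF k(1)]) (use contr per in auto)
  then show ?thesis by simp
qed

section \<open>Periodic chains of an exponential return map\<close>

text \<open>
  A periodic chain of points \<open>y i t\<close> in the upper half plane, each obtained from its predecessor through its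
  nome \<open>e\<close> by the map \<open>\<plusminus> 1 / (1 / A + R e)\<close> with \<open>R e = \<beta> e + O(e^2)\<close>. The last condition says that at
  each time one of the points is so high that its successor is \<open>\<plusminus> A\<close> up to \<open>O(1 / |A|)\<close>.
\<close>

locale exponential_return =
  fixes y :: "nat \<Rightarrow> real \<Rightarrow> complex" and A \<beta> :: "real \<Rightarrow> complex" and \<tau> :: "nat \<Rightarrow> complex"
    and R :: "real \<Rightarrow> complex \<Rightarrow> complex" and K \<delta> T :: real and \<beta>s :: complex and k :: nat
  assumes cont_y: "\<And>i. continuous_on {T..} (y i)"
    and cont_A: "continuous_on {T..} A"
    and cont_\<beta>: "continuous_on {T..} \<beta>"
    and k: "k \<ge> 1"
    and periodic: "\<And>i t. y (i + k) t = y i t"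
    and Im_pos: "\<And>i t. t \<ge> T \<Longrightarrow> Im (y i t) > 0"
    and Im_lim: "\<And>i. filterlim (\<lambda>t. Im (y i t)) at_top at_top"
    and A_lim: "filterlim A at_infinity at_top"
    and A_nz: "\<And>t. t \<ge> T \<Longrightarrow> A t \<noteq> 0"
    and \<beta>_lim: "(\<beta> \<longlongrightarrow> \<beta>s) at_top"
    and \<beta>s: "\<beta>s \<noteq> 0"
    and \<tau>: "\<And>i. \<tau> i = 1 \<or> \<tau> i = -1"
    and K: "K \<ge> 1"
    and \<delta>: "\<delta> > 0"
    and R0: "\<And>t e. \<lbrakk>t \<ge> T; norm e \<le> \<delta>\<rbrakk> \<Longrightarrow> norm (R t e) \<le> K * norm e"
    and R1: "\<And>t e. \<lbrakk>t \<ge> T; norm e \<le> \<delta>\<rbrakk> \<Longrightarrow> norm (R t e - \<beta> t * e) \<le> K * (norm e)\<^sup>2"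
    and R2: "\<And>t e e'. \<lbrakk>t \<ge> T; norm e \<le> \<delta>; norm e' \<le> \<delta>\<rbrakk> \<Longrightarrow> norm (R t e - R t e') \<le> K * norm (e - e')"
    and rec: "\<And>i t. t \<ge> T \<Longrightarrow> 1 / y (Suc i) t = \<tau> i * (1 / A t + R t (nome (y i t)))"
    and flat: "\<And>t. t \<ge> T \<Longrightarrow> \<exists>i. norm (nome (y i t)) * norm (A t) ^ 3 \<le> 1"
begin

lemma periodic_mod: "y i t = y (i mod k) t"
proof -
  have "y (i + j * k) t = y i t" for i j
  proof (induction j)
    case (Suc j)
    have "y (i + Suc j * k) t = y ((i + j * k) + k) t" by (simp add: algebra_simps)
    then show ?case using periodic Suc by simp
  qed simp
  from this[of "i mod k" "i div k"] show ?thesis by (simp add: add.commute)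
qed

lemma eventually_Im_ge: "eventually (\<lambda>t. \<forall>i. Im (y i t) \<ge> M) at_top"
proof -
  have "eventually (\<lambda>t. \<forall>i\<in>{..<k}. Im (y i t) \<ge> M) at_top"
    using Im_lim by (intro eventually_ball_finite) (auto simp: filterlim_at_top)
  then show ?thesis
  proof (rule eventually_mono)
    fix t assume *: "\<forall>i\<in>{..<k}. Im (y i t) \<ge> M"
    show "\<forall>i. Im (y i t) \<ge> M"
    proof
      fix i
      show "Im (y i t) \<ge> M" using * k periodic_mod[of i t] by auto
    qed
  qed
qed

lemma eventually_exp_le:
  assumes "\<epsilon> > 0"
  shows "eventually (\<lambda>t. \<forall>i. norm (nome (y i t)) \<le> \<epsilon>) at_top"
  using eventually_Im_ge[of "- ln \<epsilon> / 2"]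
proof (rule eventually_mono)
  fix t assume *: "\<forall>i. Im (y i t) \<ge> - ln \<epsilon> / 2"
  show "\<forall>i. norm (nome (y i t)) \<le> \<epsilon>"
  proof
    fix i
    have "norm (nome (y i t)) = exp (- 2 * Im (y i t))" by simp
    also have "\<dots> \<le> exp (ln \<epsilon>)" using *[rule_format, of i] by simp
    finally show "norm (nome (y i t)) \<le> \<epsilon>" using assms by simp
  qed
qed

lemma eventually_norm_A_ge: "eventually (\<lambda>t. norm (A t) \<ge> M) at_top"
  using filterlim_at_infinity_imp_norm_at_top[OF A_lim] by (simp add: filterlim_at_top)

lemma eventually_near:
  "eventually (\<lambda>t. \<exists>i<k. norm (nome (y i t)) * norm (A t) ^ 3 \<le> 1 \<and>
     norm (\<tau> i * y (Suc i) t - A t) \<le> 2 * K / norm (A t)) at_top"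
proof -
  have "eventually (\<lambda>t. t \<ge> T \<and> norm (A t) \<ge> 2 * K \<and> (\<forall>i. norm (nome (y i t)) \<le> \<delta>)) at_top"
    by (intro eventually_conj eventually_norm_A_ge eventually_exp_le[OF \<delta>] eventually_ge_at_top)
  then show ?thesis
  proof (rule eventually_mono)
    fix t assume t: "t \<ge> T \<and> norm (A t) \<ge> 2 * K \<and> (\<forall>i. norm (nome (y i t)) \<le> \<delta>)"
    then have tT: "t \<ge> T" by simp
    from flat[OF tT] obtain i' where "norm (nome (y i' t)) * norm (A t) ^ 3 \<le> 1" by blast
    then have "norm (nome (y (i' mod k) t)) * norm (A t) ^ 3 \<le> 1"
      by (subst periodic_mod[symmetric])
    moreover define i where "i = i' mod k"
    ultimately have i: "i < k" "norm (nome (y i t)) * norm (A t) ^ 3 \<le> 1" using k by auto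
    define a where "a = norm (A t)"
    define e where "e = nome (y i t)"
    have a: "a \<ge> 2 * K" "a \<ge> 2" using t K by (auto simp: a_def)
    have "norm (R t e) \<le> K * norm e" using t by (intro R0[OF tT]) (simp add: e_def del: norm_exp_eq_Re)
    also have "\<dots> \<le> K * (1 / a ^ 3)"
      using i(2) a K by (intro mult_left_mono) (auto simp: e_def a_def le_divide_eq)
    finally have r: "norm (R t e) \<le> K / a ^ 3" by simp
    have "a * norm (R t e) \<le> a * (K / a ^ 3)" using r a by (intro mult_left_mono) auto
    also have "\<dots> = K / a / a" using a by (simp add: power3_eq_cube)
    also have "\<dots> \<le> (1 / 2) / a" using a K by (intro divide_right_mono) (auto simp: field_simps)
    also have "\<dots> \<le> 1 / 2" using a by (simp add: field_simps)
    finally have small: "norm (A t) * norm (R t e) \<le> 1 / 2" by (simp add: a_def)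
    have "norm (\<tau> i * y (Suc i) t - A t) \<le> 2 * (norm (A t))\<^sup>2 * norm (R t e)"
      by (rule reciprocal_perturbation[OF A_nz[OF tT] \<tau> rec[OF tT, of i, folded e_def] small])
    also have "\<dots> \<le> 2 * a\<^sup>2 * (K / a ^ 3)" unfolding a_def[symmetric] using r by (intro mult_left_mono) auto
    also have "\<dots> = 2 * K / a" using a by (simp add: power2_eq_square power3_eq_cube)
    finally have "norm (\<tau> i * y (Suc i) t - A t) \<le> 2 * K / norm (A t)" by (simp add: a_def)
    with i show "\<exists>i<k. norm (nome (y i t)) * norm (A t) ^ 3 \<le> 1 \<and>
        norm (\<tau> i * y (Suc i) t - A t) \<le> 2 * K / norm (A t)" by blast
  qed
qed

lemma eventually_near_Im_ge:
  "eventually (\<lambda>t. \<exists>i<k. norm (nome (y i t)) * norm (A t) ^ 3 \<le> 1 \<and>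
     norm (\<tau> i * y (Suc i) t - A t) \<le> 2 * K / norm (A t) \<and> Im (\<tau> i * A t) \<ge> M) at_top"
proof -
  have "eventually (\<lambda>t. (\<exists>i<k. norm (nome (y i t)) * norm (A t) ^ 3 \<le> 1 \<and>
       norm (\<tau> i * y (Suc i) t - A t) \<le> 2 * K / norm (A t)) \<and>
      (\<forall>i. Im (y i t) \<ge> M + 1) \<and> norm (A t) \<ge> 2 * K) at_top"
    by (intro eventually_conj eventually_near eventually_Im_ge eventually_norm_A_ge)
  then show ?thesis
  proof (rule eventually_mono, elim conjE exE)
    fix t i
    assume i: "i < k" "norm (nome (y i t)) * norm (A t) ^ 3 \<le> 1"
        "norm (\<tau> i * y (Suc i) t - A t) \<le> 2 * K / norm (A t)"
      and Im: "\<forall>i. Im (y i t) \<ge> M + 1" and a: "norm (A t) \<ge> 2 * K"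
    have "2 * K / norm (A t) \<le> 1" using a K by (subst divide_le_eq_1_pos) linarith+
    then have "norm (\<tau> i * y (Suc i) t - A t) \<le> 1" using i by simp
    then have "\<bar>Im (\<tau> i * y (Suc i) t) - Im (A t)\<bar> \<le> 1"
      using abs_Im_le_cmod[of "\<tau> i * y (Suc i) t - A t"] by simp
    then have "Im (\<tau> i * A t) \<ge> Im (y (Suc i) t) - 1" using \<tau>[of i] by auto
    moreover have "Im (y (Suc i) t) \<ge> M + 1" using Im by blast
    ultimately have "Im (\<tau> i * A t) \<ge> M" by linarith
    with i show "\<exists>i<k. norm (nome (y i t)) * norm (A t) ^ 3 \<le> 1 \<and>
        norm (\<tau> i * y (Suc i) t - A t) \<le> 2 * K / norm (A t) \<and> Im (\<tau> i * A t) \<ge> M" by blast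
  qed
qed

text \<open>
  With the negative sign the nome of \<open>y j\<close> is \<open>- (A + y') / (A y' \<beta>)\<close> up to a factor tending to \<open>1\<close>, where \<open>y'\<close> is
  the next point. The numbers \<open>A\<close>, \<open>y'\<close> and \<open>A + y'\<close> lie in the upper half plane, so all logarithms are
  principal values with bounded imaginary part, and the branch never changes along the path.
\<close>

lemma negative_return_pins_real_part:
  assumes pos: "\<And>t. t \<ge> T \<Longrightarrow> Im (A t) > 0" and neg: "\<tau> j = -1"
  shows "\<exists>B. eventually (\<lambda>t. \<bar>Re (y j t)\<bar> \<le> B) at_top"
proof -
  define e where "e t = nome (y j t)" for t
  define \<gamma> where "\<gamma> t = - (1 / y (Suc j) t + 1 / A t) / (\<beta>s * e t)" for t
  have \<gamma>R: "\<gamma> t = R t (e t) / (\<beta>s * e t)" if "t \<ge> T" for t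
    unfolding \<gamma>_def rec[OF that] neg by (simp add: e_def)
  have e_lim: "(e \<longlongrightarrow> 0) at_top"
  proof (rule tendstoI)
    fix \<epsilon> :: real assume "\<epsilon> > 0"
    then show "eventually (\<lambda>t. dist (e t) 0 < \<epsilon>) at_top"
      using eventually_exp_le[of "\<epsilon> / 2"] by (auto elim!: eventually_mono simp: e_def order.strict_trans1[of _ "\<epsilon>/2"])
  qed
  have "((\<lambda>t. \<gamma> t - 1) \<longlongrightarrow> 0) at_top"
  proof (rule Lim_null_comparison)
    show "((\<lambda>t. norm (\<beta> t - \<beta>s) / norm \<beta>s + K * norm (e t) / norm \<beta>s) \<longlongrightarrow> 0) at_top"
      by (rule tendsto_eq_intros tendsto_norm_zero[OF e_lim] tendsto_norm_zero[OF LIM_zero[OF \<beta>_lim]] | simp add: \<beta>s)+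
    have "eventually (\<lambda>t. t \<ge> T \<and> (\<forall>i. norm (nome (y i t)) \<le> \<delta>)) at_top"
      by (intro eventually_conj eventually_exp_le[OF \<delta>] eventually_ge_at_top)
    then show "eventually (\<lambda>t. norm (\<gamma> t - 1) \<le> norm (\<beta> t - \<beta>s) / norm \<beta>s + K * norm (e t) / norm \<beta>s) at_top"
    proof (rule eventually_mono)
      fix t assume t: "t \<ge> T \<and> (\<forall>i. norm (nome (y i t)) \<le> \<delta>)"
      have e0: "e t \<noteq> 0" by (simp add: e_def)
      have "\<gamma> t - 1 = (\<beta> t - \<beta>s) / \<beta>s + (R t (e t) - \<beta> t * e t) / (\<beta>s * e t)"
        using t e0 \<beta>s by (simp add: \<gamma>R field_simps)
      also have "norm \<dots> \<le> norm (\<beta> t - \<beta>s) / norm \<beta>s + norm (R t (e t) - \<beta> t * e t) / (norm \<beta>s * norm (e t))"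
        by (metis norm_triangle_ineq norm_divide norm_mult)
      also have "norm (R t (e t) - \<beta> t * e t) / (norm \<beta>s * norm (e t)) \<le> (K * (norm (e t))\<^sup>2) / (norm \<beta>s * norm (e t))"
        using t by (intro divide_right_mono R1) (auto simp: e_def)
      also have "\<dots> = K * norm (e t) / norm \<beta>s" using e0 by (simp add: power2_eq_square)
      finally show "norm (\<gamma> t - 1) \<le> norm (\<beta> t - \<beta>s) / norm \<beta>s + K * norm (e t) / norm \<beta>s" by simp
    qed
  qed
  then have "eventually (\<lambda>t. dist (\<gamma> t - 1) 0 < 1) at_top" by (rule tendstoD) auto
  then obtain T1 where T1: "\<And>t. t \<ge> T1 \<Longrightarrow> norm (\<gamma> t - 1) < 1"
    by (auto simp: eventually_at_top_linorder)
  define T' where "T' = max T T1"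
  have Re\<gamma>: "Re (\<gamma> t) > 0" if "t \<ge> T'" for t
    using T1[of t] that abs_Re_le_cmod[of "\<gamma> t - 1"] by (auto simp: T'_def)
  have sub: "{T'..} \<subseteq> {T..}" by (auto simp: T'_def)
  have contT: "continuous_on {T'..} (y i)" "continuous_on {T'..} A" for i
    using cont_y cont_A sub continuous_on_subset by blast+
  have ynz: "y i t \<noteq> 0" if "t \<ge> T" for i t using Im_pos[OF that, of i] by auto
  have cont\<gamma>: "continuous_on {T'..} \<gamma>"
    unfolding \<gamma>_def e_def using sub by (intro continuous_intros contT) (auto simp: ynz A_nz \<beta>s)
  define g where "g t = (Ln (A t + y (Suc j) t) - Ln (A t) - Ln (y (Suc j) t) - Ln (\<gamma> t) - Ln (- \<beta>s)) / (2 * \<i>)" for t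
  have slit: "z \<notin> \<real>\<^sub>\<le>\<^sub>0" if "Im z > 0 \<or> Re z > 0" for z
    using that by (auto simp: complex_nonpos_Reals_iff)
  have "continuous_on {T'..} g"
    unfolding g_def using sub
    by (intro continuous_intros contT cont\<gamma>) (auto intro!: slit add_pos_pos pos Im_pos Re\<gamma>)
  moreover have "nome (y j t) = nome (g t)" if "t \<ge> T'" for t
  proof -
    have tT: "t \<ge> T" using that by (simp add: T'_def)
    have \<gamma>0: "\<gamma> t \<noteq> 0" using Re\<gamma>[OF that] by auto
    have sum0: "A t + y (Suc j) t \<noteq> 0"
    proof
      assume "A t + y (Suc j) t = 0"
      then have "Im (A t) + Im (y (Suc j) t) = 0" by (metis plus_complex.sel(2) zero_complex.sel(2))
      then show False using pos[OF tT] Im_pos[OF tT, of "Suc j"] by simp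
    qed
    have "nome (g t) = (A t + y (Suc j) t) / (A t * y (Suc j) t * \<gamma> t * (- \<beta>s))"
      unfolding g_def using \<gamma>0 sum0 \<beta>s tT by (simp add: exp_diff A_nz ynz)
    also have "\<dots> = e t"
    proof -
      have "\<gamma> t * (\<beta>s * e t) = - (1 / y (Suc j) t + 1 / A t)"
        using \<beta>s by (simp add: \<gamma>_def e_def)
      also have "\<dots> = - (A t + y (Suc j) t) / (A t * y (Suc j) t)"
        using tT by (simp add: A_nz ynz field_simps)
      finally show ?thesis using tT \<gamma>0 \<beta>s by (simp add: A_nz ynz field_simps)
    qed
    finally show ?thesis by (simp add: e_def)
  qed
  ultimately obtain N where N: "\<And>t. t \<ge> T' \<Longrightarrow> y j t = g t + of_real (pi * of_int N)"
    using log_branch_constant[OF contT(1)] by blast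
  have "\<bar>Re (y j t)\<bar> \<le> 3 * pi + \<bar>pi * of_int N\<bar>" if "t \<ge> T'" for t
  proof -
    have ImLn: "\<bar>Im (Ln z)\<bar> \<le> pi" if "z \<noteq> 0" for z
      using Im_Ln_le_pi[OF that] mpi_less_Im_Ln[OF that] by linarith
    have tT: "t \<ge> T" using that by (simp add: T'_def)
    have "A t + y (Suc j) t \<noteq> 0" using pos[OF tT] Im_pos[OF tT, of "Suc j"]
      by (metis add_pos_pos less_irrefl plus_complex.sel(2) zero_complex.sel(2))
    moreover have "\<gamma> t \<noteq> 0" using Re\<gamma>[OF that] by auto
    ultimately have "\<bar>Im (Ln (A t + y (Suc j) t))\<bar> \<le> pi" "\<bar>Im (Ln (A t))\<bar> \<le> pi"
      "\<bar>Im (Ln (y (Suc j) t))\<bar> \<le> pi" "\<bar>Im (Ln (\<gamma> t))\<bar> \<le> pi" "\<bar>Im (Ln (- \<beta>s))\<bar> \<le> pi"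
      using tT \<beta>s by (auto intro!: ImLn simp: A_nz ynz)
    moreover have "Re (g t) = (Im (Ln (A t + y (Suc j) t)) - Im (Ln (A t)) - Im (Ln (y (Suc j) t)) - Im (Ln (\<gamma> t)) - Im (Ln (- \<beta>s))) / 2"
      by (simp add: g_def Re_divide power2_eq_square diff_divide_distrib)
    ultimately have "\<bar>Re (g t)\<bar> \<le> 3 * pi" using pi_gt_zero
      unfolding abs_le_iff by - (elim conjE, rule conjI; simp)
    then show ?thesis unfolding N[OF that] by simp
  qed
  then show ?thesis by (auto simp: eventually_at_top_linorder)
qed

end

lemma ln_power_over_tendsto_0:
  fixes c :: real
  shows "((\<lambda>x::real. (c * ln x) ^ n / x) \<longlongrightarrow> 0) at_top"
proof -
  have "((\<lambda>x::real. ln x ^ n / exp (ln x)) \<longlongrightarrow> 0) at_top"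
    by (rule filterlim_compose[OF tendsto_power_div_exp_0 ln_at_top])
  then have "((\<lambda>x::real. c ^ n * (ln x ^ n / exp (ln x))) \<longlongrightarrow> c ^ n * 0) at_top"
    by (intro tendsto_mult_left)
  then have "((\<lambda>x::real. c ^ n * (ln x ^ n / exp (ln x))) \<longlongrightarrow> 0) at_top" by simp
  then show ?thesis
  proof (rule Lim_transform_eventually)
    show "eventually (\<lambda>x. c ^ n * (ln x ^ n / exp (ln x)) = (c * ln x) ^ n / x) at_top"
      using eventually_gt_at_top[of 0] by (rule eventually_mono) (simp add: power_mult_distrib)
  qed
qed

context exponential_return
begin

text \<open>
  The argument of the left-hand side is \<open>2 Re A\<close> plus a convergent term, because \<open>A / |A|\<close> tends to \<open>\<plusminus> 1\<close>.
  It is a continuous unbounded function of \<open>t\<close> and therefore takes the value \<open>pi / 2\<close> modulo \<open>2 pi\<close>.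
\<close>

lemma eventually_phase_attained:
  assumes Im_A: "((\<lambda>t. Im (A t) / norm (A t)) \<longlongrightarrow> 0) at_top"
    and ReA: "filterlim (\<lambda>t. \<bar>Re (A t)\<bar>) at_top at_top"
  obtains t c where "t \<ge> M" "c > 0" "(A t)\<^sup>2 * \<beta> t * nome (A t) = \<i> * of_real c"
proof -
  define P where "P t = (A t / of_real (norm (A t)))\<^sup>2 * (\<beta> t / \<beta>s)" for t
  have "((\<lambda>t. (A t / of_real (norm (A t)))\<^sup>2 - 1) \<longlongrightarrow> 0) at_top"
  proof (rule Lim_null_comparison)
    show "((\<lambda>t. 2 * \<bar>Im (A t) / norm (A t)\<bar>) \<longlongrightarrow> 0) at_top"
      using tendsto_mult_left[OF tendsto_rabs_zero[OF Im_A], of 2] by simp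
    show "eventually (\<lambda>t. norm ((A t / of_real (norm (A t)))\<^sup>2 - 1) \<le> 2 * \<bar>Im (A t) / norm (A t)\<bar>) at_top"
      using eventually_ge_at_top[of T]
    proof (rule eventually_mono)
      fix t assume "t \<ge> T"
      then have A0: "A t \<noteq> 0" by (rule A_nz)
      have "(A t / of_real (norm (A t)))\<^sup>2 - 1 = A t * (A t - cnj (A t)) / of_real ((norm (A t))\<^sup>2)"
      proof -
        have "of_real ((norm (A t))\<^sup>2) = A t * cnj (A t)" by (rule complex_norm_square)
        moreover have "complex_of_real ((norm (A t))\<^sup>2) \<noteq> 0" using A0 by simp
        ultimately show ?thesis by (simp add: power_divide right_diff_distrib diff_divide_distrib power2_eq_square)
      qed
      then have "norm ((A t / of_real (norm (A t)))\<^sup>2 - 1) = norm (A t) * norm (A t - cnj (A t)) / (norm (A t))\<^sup>2"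
        by (simp add: norm_divide norm_mult norm_power)
      also have "\<dots> = 2 * \<bar>Im (A t) / norm (A t)\<bar>"
        using A0 by (simp add: complex_diff_cnj norm_mult power2_eq_square)
      finally show "norm ((A t / of_real (norm (A t)))\<^sup>2 - 1) \<le> 2 * \<bar>Im (A t) / norm (A t)\<bar>" by simp
    qed
  qed
  then have "((\<lambda>t. (A t / of_real (norm (A t)))\<^sup>2) \<longlongrightarrow> 1) at_top" by (rule LIM_zero_cancel)
  moreover have "((\<lambda>t. \<beta> t / \<beta>s) \<longlongrightarrow> 1) at_top"
    using tendsto_divide[OF \<beta>_lim tendsto_const[of \<beta>s]] \<beta>s by simp
  ultimately have "(P \<longlongrightarrow> 1 * 1) at_top"
    unfolding P_def by (rule tendsto_mult)
  then have P_lim: "(P \<longlongrightarrow> 1) at_top" by simp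
  then have "eventually (\<lambda>t. dist (P t) 1 < 1) at_top" by (rule tendstoD) auto
  then obtain T1 where T1: "\<And>t. t \<ge> T1 \<Longrightarrow> norm (P t - 1) < 1"
    by (auto simp: eventually_at_top_linorder dist_norm)
  define T' where "T' = Max {T, T1, M}"
  have T': "T' \<ge> T" "T' \<ge> T1" "T' \<ge> M" by (auto simp: T'_def)
  have sub: "{T'..} \<subseteq> {T..}" using T' by auto
  have ReP: "Re (P t) > 0" if "t \<ge> T'" for t
    using T1[of t] that T' abs_Re_le_cmod[of "P t - 1"] by auto
  have contT: "continuous_on {T'..} A" "continuous_on {T'..} \<beta>"
    using cont_A cont_\<beta> sub continuous_on_subset by blast+
  have contP: "continuous_on {T'..} P"
    unfolding P_def using sub by (intro continuous_intros contT) (auto simp: A_nz \<beta>s)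
  define \<phi> where "\<phi> t = 2 * Re (A t) + Im (Ln (P t))" for t
  have cont\<phi>: "continuous_on {T'..} \<phi>"
    unfolding \<phi>_def
    by (intro continuous_intros contT contP) (use ReP in \<open>auto simp: complex_nonpos_Reals_iff dest: leD\<close>)
  have "filterlim (\<lambda>t. \<bar>\<phi> t\<bar>) at_top at_top"
  proof (rule filterlim_at_top_mono)
    show "filterlim (\<lambda>t. - pi + 2 * \<bar>Re (A t)\<bar>) at_top at_top"
      by (rule filterlim_tendsto_add_at_top[OF tendsto_const]
          filterlim_tendsto_pos_mult_at_top[OF tendsto_const _ ReA] | simp)+
    show "eventually (\<lambda>t. - pi + 2 * \<bar>Re (A t)\<bar> \<le> \<bar>\<phi> t\<bar>) at_top"
      using eventually_ge_at_top[of T']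
    proof (rule eventually_mono)
      fix t assume "t \<ge> T'"
      then have "P t \<noteq> 0" using ReP[of t] by auto
      then have "\<bar>Im (Ln (P t))\<bar> \<le> pi"
        using Im_Ln_le_pi[of "P t"] mpi_less_Im_Ln[of "P t"] by linarith
      then show "- pi + 2 * \<bar>Re (A t)\<bar> \<le> \<bar>\<phi> t\<bar>" unfolding \<phi>_def by linarith
    qed
  qed
  from attains_value_modulo[OF cont\<phi> this, of "pi / 2 - Im (Ln \<beta>s)"]
  obtain t N where t: "t \<ge> T'" "\<phi> t = pi / 2 - Im (Ln \<beta>s) + 2 * pi * of_int N" by blast
  have tT: "t \<ge> T" "t \<ge> M" using t T' by auto
  have P0: "P t \<noteq> 0" using ReP[OF t(1)] by auto
  define c where "c = (norm (A t))\<^sup>2 * norm \<beta>s * norm (P t) * exp (- 2 * Im (A t))"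
  have c0: "c > 0" using A_nz[OF tT(1)] \<beta>s P0 by (simp add: c_def)
  have pol: "z = of_real (norm z) * cis (Im (Ln z))" if "z \<noteq> 0" for z
    by (metis that Arg_eq_Im_Ln cis_conv_exp rcis_cmod_Arg rcis_def)
  have "(A t)\<^sup>2 * \<beta> t = of_real ((norm (A t))\<^sup>2) * \<beta>s * P t"
    using A_nz[OF tT(1)] \<beta>s by (simp add: P_def power_divide)
  moreover have "nome (A t) = of_real (exp (- 2 * Im (A t))) * cis (2 * Re (A t))"
    by (simp add: exp_eq_polar)
  ultimately have "(A t)\<^sup>2 * \<beta> t * nome (A t) =
      of_real ((norm (A t))\<^sup>2) * \<beta>s * P t * (of_real (exp (- 2 * Im (A t))) * cis (2 * Re (A t)))"
    by simp
  also have "\<dots> = of_real ((norm (A t))\<^sup>2) * (of_real (norm \<beta>s) * cis (Im (Ln \<beta>s))) *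
      (of_real (norm (P t)) * cis (Im (Ln (P t)))) * (of_real (exp (- 2 * Im (A t))) * cis (2 * Re (A t)))"
    using pol[OF \<beta>s] pol[OF P0] by metis
  also have "\<dots> = of_real c * (cis (Im (Ln \<beta>s)) * cis (Im (Ln (P t))) * cis (2 * Re (A t)))"
    by (simp add: c_def mult_ac)
  also have "cis (Im (Ln \<beta>s)) * cis (Im (Ln (P t))) * cis (2 * Re (A t)) = cis (Im (Ln \<beta>s) + \<phi> t)"
    by (simp add: cis_mult \<phi>_def add_ac)
  also have "Im (Ln \<beta>s) + \<phi> t = pi / 2 + 2 * pi * of_int N" unfolding t(2) by simp
  also have "cis (pi / 2 + 2 * pi * of_int N) = \<i>"
    by (simp add: cis_mult[symmetric] cis_multiple_2pi)
  finally show ?thesis using that[OF tT(2) c0] by (simp add: mult.commute)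
qed

text \<open>
  If \<open>A\<close> is high at some late time, the chain is attracted to a single point by \<open>contraction_return\<close>.
  Otherwise \<open>Im A \<le> 2 log |A|\<close> from some time on, so \<open>|Re A|\<close> tends to infinity, and
  \<open>eventually_phase_attained\<close> provides a time at which the displacement from \<open>A\<close> points down.
  Starting behind a very high point, the chain would have to return to it after \<open>k\<close> steps, but
  \<open>no_return_below\<close> keeps it below \<open>A\<close>. The sign hypothesis of that lemma holds because a negative sign
  pins the real part, while \<open>|Re A|\<close> grows.
\<close>

lemma constant_orbit_if_upper:
  assumes pos: "\<And>t. t \<ge> T \<Longrightarrow> Im (A t) > 0"
  shows "\<exists>t\<ge>T. \<forall>i. y (Suc i) t = y i t"
proof -
  have near_plus: "eventually (\<lambda>t. (\<exists>i<k. norm (nome (y i t)) * norm (A t) ^ 3 \<le> 1 \<and> norm (y (Suc i) t - A t) \<le> 2 * K / norm (A t)) \<and> Im (A t) \<ge> M) at_top" for M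
  proof -
    have "eventually (\<lambda>t. t \<ge> T \<and> (\<exists>i<k. norm (nome (y i t)) * norm (A t) ^ 3 \<le> 1 \<and>
       norm (\<tau> i * y (Suc i) t - A t) \<le> 2 * K / norm (A t) \<and> Im (\<tau> i * A t) \<ge> max 0 M)) at_top"
      by (intro eventually_conj eventually_ge_at_top eventually_near_Im_ge)
    then show ?thesis
    proof (rule eventually_mono, elim conjE exE)
      fix t i assume t: "t \<ge> T" and i: "i < k" "norm (nome (y i t)) * norm (A t) ^ 3 \<le> 1"
          "norm (\<tau> i * y (Suc i) t - A t) \<le> 2 * K / norm (A t)"
        and Im: "Im (\<tau> i * A t) \<ge> max 0 M"
      have "\<tau> i = 1" using \<tau>[of i] Im pos[OF t] by auto
      then show "(\<exists>i<k. norm (nome (y i t)) * norm (A t) ^ 3 \<le> 1 \<and> norm (y (Suc i) t - A t) \<le> 2 * K / norm (A t)) \<and> M \<le> Im (A t)"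
        using i Im by auto
    qed
  qed
  have Im_A_ge: "eventually (\<lambda>t. Im (A t) \<ge> M) at_top" for M
    using near_plus[of M] by (rule eventually_mono) blast
  define Q where "Q t \<longleftrightarrow> 128 * K * (norm (A t))\<^sup>2 * exp (- 2 * Im (A t)) \<le> 1" for t
  show ?thesis
  proof (cases "frequently Q at_top")
    case True
    have "eventually (\<lambda>t. t \<ge> T \<and> ((\<exists>i<k. norm (nome (y i t)) * norm (A t) ^ 3 \<le> 1 \<and> norm (y (Suc i) t - A t) \<le> 2 * K / norm (A t)) \<and> Im (A t) \<ge> 2)
        \<and> Im (A t) \<ge> 1 - ln \<delta> / 2 \<and> norm (A t) \<ge> 2 * K) at_top"
      by (intro eventually_conj eventually_ge_at_top near_plus Im_A_ge eventually_norm_A_ge)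
    from frequently_eventually_frequently[OF True this] obtain t i where t: "t \<ge> T" "Q t"
      "norm (y (Suc i) t - A t) \<le> 2 * K / norm (A t)" "Im (A t) \<ge> 2" "Im (A t) \<ge> 1 - ln \<delta> / 2" "norm (A t) \<ge> 2 * K"
      by (auto dest!: frequently_ex)
    have "2 * K / norm (A t) \<le> 1" using t(6) K by (subst divide_le_eq_1_pos) linarith+
    then have near: "norm (y (Suc i) t - A t) \<le> 1" using t(3) by simp
    have "exp (2 - 2 * Im (A t)) \<le> exp (ln \<delta>)" using t(5) by (subst exp_le_cancel_iff) linarith
    then have ex: "exp (2 - 2 * Im (A t)) \<le> \<delta>" using \<delta> by simp
    have "y (Suc j) t = y j t" for j
      by (rule contraction_return[where y = "\<lambda>j. y j t" and m = "Suc i", OF \<tau> K \<delta> R0[OF t(1)] R2[OF t(1)]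
            rec[OF t(1)] Im_pos[OF t(1)] t(4) ex t(2)[unfolded Q_def] near k periodic])
    then show ?thesis using t(1) by blast
  next
    case False
    then have notQ: "eventually (\<lambda>t. \<not> Q t) at_top" by (simp add: not_frequently)
    define q where "q = ln (128 * K) / 2"
    have upper: "eventually (\<lambda>t. Im (A t) \<le> 2 * ln (norm (A t)) \<and> exp (2 * Im (A t)) \<le> 128 * K * (norm (A t))\<^sup>2) at_top"
    proof -
      have "eventually (\<lambda>t. \<not> Q t \<and> norm (A t) \<ge> 1 + exp q) at_top"
        by (intro eventually_conj notQ eventually_norm_A_ge)
      then show ?thesis
      proof (rule eventually_mono, elim conjE)
        fix t assume nQ: "\<not> Q t" and a: "norm (A t) \<ge> 1 + exp q"
        then have a1: "norm (A t) > 1" by (smt (verit) exp_gt_zero)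
        have lt: "exp (2 * Im (A t)) < 128 * K * (norm (A t))\<^sup>2"
        proof -
          have "exp (2 * Im (A t)) * 1 < exp (2 * Im (A t)) * (128 * K * (norm (A t))\<^sup>2 * exp (- 2 * Im (A t)))"
            using nQ unfolding Q_def by (intro mult_strict_left_mono) auto
          also have "\<dots> = 128 * K * (norm (A t))\<^sup>2 * (exp (2 * Im (A t)) * exp (- 2 * Im (A t)))"
            by (simp add: mult_ac)
          also have "exp (2 * Im (A t)) * exp (- 2 * Im (A t)) = 1" by (simp add: exp_add[symmetric])
          finally show ?thesis by simp
        qed
        then have "ln (exp (2 * Im (A t))) \<le> ln (128 * K * (norm (A t))\<^sup>2)"
          using K a1 by (intro ln_mono) auto
        also have "\<dots> = ln (128 * K) + ln ((norm (A t))\<^sup>2)"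
          using K a1 by (intro ln_mult_pos) auto
        also have "ln ((norm (A t))\<^sup>2) = 2 * ln (norm (A t))"
          using a1 by (simp add: ln_realpow)
        finally have "2 * Im (A t) \<le> ln (128 * K) + 2 * ln (norm (A t))" by simp
        moreover have "q \<le> ln (norm (A t))"
          using a a1 by (subst ln_ge_iff) auto
        ultimately show "Im (A t) \<le> 2 * ln (norm (A t)) \<and> exp (2 * Im (A t)) \<le> 128 * K * (norm (A t))\<^sup>2"
          using lt by (simp add: q_def)
      qed
    qed
    have norm_A_top: "filterlim (\<lambda>t. norm (A t)) at_top at_top"
      by (rule filterlim_at_infinity_imp_norm_at_top[OF A_lim])
    have ratio: "((\<lambda>t. (81 * Im (A t)) ^ n / norm (A t)) \<longlongrightarrow> 0) at_top" if "n \<ge> 1" for n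
    proof (rule Lim_null_comparison)
      show "((\<lambda>t. (162 * ln (norm (A t))) ^ n / norm (A t)) \<longlongrightarrow> 0) at_top"
        by (rule filterlim_compose[OF ln_power_over_tendsto_0 norm_A_top])
      have "eventually (\<lambda>t. (Im (A t) \<le> 2 * ln (norm (A t)) \<and> exp (2 * Im (A t)) \<le> 128 * K * (norm (A t))\<^sup>2) \<and> Im (A t) \<ge> 0) at_top"
        by (intro eventually_conj upper Im_A_ge)
      then show "eventually (\<lambda>t. norm ((81 * Im (A t)) ^ n / norm (A t)) \<le> (162 * ln (norm (A t))) ^ n / norm (A t)) at_top"
      proof (rule eventually_mono, elim conjE)
        fix t assume t: "Im (A t) \<le> 2 * ln (norm (A t))" "0 \<le> Im (A t)"
        then have "(81 * Im (A t)) ^ n \<le> (162 * ln (norm (A t))) ^ n" by (intro power_mono) auto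
        moreover have "norm ((81 * Im (A t)) ^ n / norm (A t)) = (81 * Im (A t)) ^ n / norm (A t)"
          unfolding real_norm_def using t by (intro abs_of_nonneg divide_nonneg_nonneg zero_le_power) auto
        ultimately show "norm ((81 * Im (A t)) ^ n / norm (A t)) \<le> (162 * ln (norm (A t))) ^ n / norm (A t)"
          by (metis divide_right_mono norm_ge_zero)
      qed
    qed
    have Im_ratio: "((\<lambda>t. Im (A t) / norm (A t)) \<longlongrightarrow> 0) at_top"
      using tendsto_mult_left[OF ratio[of 1], of "1 / 81"] by simp
    then have "eventually (\<lambda>t. dist (Im (A t) / norm (A t)) 0 < 1 / 12) at_top" by (rule tendstoD) auto
    then have twelve: "eventually (\<lambda>t. 12 * Im (A t) \<le> norm (A t)) at_top"
      using eventually_norm_A_ge[of 1]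
    proof eventually_elim
      case (elim t)
      have "Im (A t) / norm (A t) < 1 / 12" using elim(1) unfolding dist_norm real_norm_def by linarith
      then show ?case using elim(2) by (subst (asm) pos_divide_less_eq) auto
    qed
    have Re_top: "filterlim (\<lambda>t. \<bar>Re (A t)\<bar>) at_top at_top"
    proof (rule filterlim_at_top_mono)
      show "filterlim (\<lambda>t. 1 / 2 * norm (A t)) at_top at_top"
        by (rule filterlim_tendsto_pos_mult_at_top[of "\<lambda>_. 1 / 2" "1 / 2", OF tendsto_const _ norm_A_top]) simp
      show "eventually (\<lambda>t. 1 / 2 * norm (A t) \<le> \<bar>Re (A t)\<bar>) at_top"
        using twelve Im_A_ge[of 0]
      proof eventually_elim
        case (elim t)
        then show ?case using cmod_le[of "A t"] by linarith
      qed
    qed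
    have pinned: "eventually (\<lambda>t. \<forall>j\<in>{..2 * k}. \<bar>Re (y j t - A t)\<bar> \<le> 1 \<longrightarrow> \<tau> j = 1) at_top"
    proof (intro eventually_ball_finite ballI)
      fix j
      show "eventually (\<lambda>t. \<bar>Re (y j t - A t)\<bar> \<le> 1 \<longrightarrow> \<tau> j = 1) at_top"
      proof (cases "\<tau> j = 1")
        case False
        then have "\<tau> j = -1" using \<tau>[of j] by simp
        from negative_return_pins_real_part[OF pos this] obtain B where
          B: "eventually (\<lambda>t. \<bar>Re (y j t)\<bar> \<le> B) at_top" by blast
        have "eventually (\<lambda>t. \<bar>Re (A t)\<bar> \<ge> B + 2) at_top" using Re_top by (simp add: filterlim_at_top)
        with B show ?thesis by eventually_elim auto
      qed auto
    qed auto
    have small: "eventually (\<lambda>t. (81 * Im (A t)) ^ k * (81 * (Im (A t))\<^sup>2 / norm (A t)) \<le> 1 / 10) at_top"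
    proof -
      have "eventually (\<lambda>t. dist ((81 * Im (A t)) ^ (k + 2) / norm (A t)) 0 < 1 / 10) at_top"
        by (rule tendstoD[OF ratio]) auto
      with Im_A_ge[of 0] show ?thesis
      proof eventually_elim
        case (elim t)
        have "(81 * Im (A t)) ^ k * (81 * (Im (A t))\<^sup>2 / norm (A t)) \<le> (81 * Im (A t)) ^ k * ((81 * Im (A t))\<^sup>2 / norm (A t))"
          using elim(1) by (intro mult_left_mono divide_right_mono) (auto simp: power_mult_distrib)
        also have "\<dots> = (81 * Im (A t)) ^ (k + 2) / norm (A t)" by (simp add: power_add power2_eq_square)
        finally show ?case using elim(2) unfolding dist_norm real_norm_def by linarith
      qed
    qed
    have \<beta>_near: "eventually (\<lambda>t. norm (\<beta> t) \<ge> norm \<beta>s / 2) at_top"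
    proof -
      have "((\<lambda>t. norm (\<beta> t)) \<longlongrightarrow> norm \<beta>s) at_top" by (rule tendsto_norm[OF \<beta>_lim])
      then have "eventually (\<lambda>t. norm (\<beta> t) > norm \<beta>s / 2) at_top"
        by (rule order_tendstoD) (use \<beta>s in auto)
      then show ?thesis by (rule eventually_mono) simp
    qed
    \<comment> \<open>Small enough for the expansion of \<open>R\<close> to be valid and dominated by its linear term.\<close>
  define \<epsilon> where "\<epsilon> = min \<delta> (norm \<beta>s / (20 * K))"
    have \<epsilon>: "\<epsilon> > 0" using \<delta> \<beta>s K by (simp add: \<epsilon>_def)
    have "eventually (\<lambda>t. t \<ge> T \<and> ((\<exists>i<k. norm (nome (y i t)) * norm (A t) ^ 3 \<le> 1 \<and> norm (y (Suc i) t - A t) \<le> 2 * K / norm (A t)) \<and> Im (A t) \<ge> 2 * K + 1) \<and>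
        (Im (A t) \<le> 2 * ln (norm (A t)) \<and> exp (2 * Im (A t)) \<le> 128 * K * (norm (A t))\<^sup>2) \<and>
        12 * Im (A t) \<le> norm (A t) \<and>
        (\<forall>j\<in>{..2 * k}. \<bar>Re (y j t - A t)\<bar> \<le> 1 \<longrightarrow> \<tau> j = 1) \<and>
        (81 * Im (A t)) ^ k * (81 * (Im (A t))\<^sup>2 / norm (A t)) \<le> 1 / 10 \<and>
        norm (\<beta> t) \<ge> norm \<beta>s / 2 \<and> (\<forall>i. norm (nome (y i t)) \<le> \<epsilon>) \<and>
        norm (A t) \<ge> 128 * K / (norm \<beta>s)\<^sup>2 \<and> norm (A t) \<ge> 2 * (128 * K) * exp 1) at_top"
      by (intro eventually_conj eventually_ge_at_top near_plus upper twelve pinned small \<beta>_near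
          eventually_exp_le[OF \<epsilon>] eventually_norm_A_ge)
    then obtain M where M: "\<And>t. t \<ge> M \<Longrightarrow> t \<ge> T \<and> 
        (\<exists>i<k. norm (nome (y i t)) * norm (A t) ^ 3 \<le> 1 \<and> norm (y (Suc i) t - A t) \<le> 2 * K / norm (A t)) \<and>
        Im (A t) \<ge> 2 * K + 1 \<and> exp (2 * Im (A t)) \<le> 128 * K * (norm (A t))\<^sup>2 \<and>
        12 * Im (A t) \<le> norm (A t) \<and>
        (\<forall>j\<in>{..2 * k}. \<bar>Re (y j t - A t)\<bar> \<le> 1 \<longrightarrow> \<tau> j = 1) \<and>
        (81 * Im (A t)) ^ k * (81 * (Im (A t))\<^sup>2 / norm (A t)) \<le> 1 / 10 \<and>
        norm (\<beta> t) \<ge> norm \<beta>s / 2 \<and> (\<forall>i. norm (nome (y i t)) \<le> \<epsilon>) \<and>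
        norm (A t) \<ge> 128 * K / (norm \<beta>s)\<^sup>2 \<and> norm (A t) \<ge> 2 * (128 * K) * exp 1"
      unfolding eventually_at_top_linorder by blast
    obtain t c where t: "t \<ge> M" and c: "c > 0" "(A t)\<^sup>2 * \<beta> t * nome (A t) = \<i> * of_real c"
      using eventually_phase_attained[OF Im_ratio Re_top] by blast
    have M': "t \<ge> T" "Im (A t) \<ge> 2 * K + 1" "exp (2 * Im (A t)) \<le> 128 * K * (norm (A t))\<^sup>2"
        "12 * Im (A t) \<le> norm (A t)"
        "\<And>j. j \<le> 2 * k \<Longrightarrow> \<bar>Re (y j t - A t)\<bar> \<le> 1 \<Longrightarrow> \<tau> j = 1"
        "(81 * Im (A t)) ^ k * (81 * (Im (A t))\<^sup>2 / norm (A t)) \<le> 1 / 10"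
        "norm (\<beta> t) \<ge> norm \<beta>s / 2" "\<And>i. norm (nome (y i t)) \<le> \<epsilon>"
        "norm (A t) \<ge> 128 * K / (norm \<beta>s)\<^sup>2" "norm (A t) \<ge> 2 * (128 * K) * exp 1"
      using M[OF t] by auto
    from M[OF t] obtain i where i: "i < k" "norm (nome (y i t)) * norm (A t) ^ 3 \<le> 1"
        "norm (y (Suc i) t - A t) \<le> 2 * K / norm (A t)"
      by blast
    define a where "a = norm (A t)"
    define L where "L = Im (A t)"
    have L: "L \<ge> 3" "L \<ge> 2 * K + 1" "12 * L \<le> a" using M'(2,4) K by (auto simp: L_def a_def)
    have a0: "a > 0" using L by simp
    have "2 * K / a \<le> 81 * L\<^sup>2 / a"
    proof (rule divide_right_mono)
      have "L * 1 \<le> L * L" using L by (intro mult_left_mono) auto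
      then show "2 * K \<le> 81 * L\<^sup>2" using L unfolding power2_eq_square by linarith
    qed (use a0 in auto)
    then have start: "norm (y (Suc i + 0) t - A t) \<le> 81 * (Im (A t))\<^sup>2 / norm (A t)"
      using i(3) by (simp add: a_def L_def)
    have \<beta>0: "\<beta> t \<noteq> 0" using M'(7) \<beta>s by auto
    have Ke: "K * norm (nome (y j t)) \<le> norm (\<beta> t) / 10" for j
    proof -
      have "K * norm (nome (y j t)) \<le> K * (norm \<beta>s / (20 * K))"
        using M'(8)[of j] K by (intro mult_left_mono) (auto simp: \<epsilon>_def)
      also have "\<dots> = norm \<beta>s / 20" using K by simp
      finally show ?thesis using M'(7) by simp
    qed
    have a32: "32 * K \<le> (norm (\<beta> t))\<^sup>2 * norm (A t)"
    proof -
      have "32 * K = (norm \<beta>s / 2)\<^sup>2 * (128 * K / (norm \<beta>s)\<^sup>2)"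
        using \<beta>s by (simp add: power_divide)
      also have "\<dots> \<le> (norm (\<beta> t))\<^sup>2 * norm (A t)"
        using M'(7,9) K by (intro mult_mono power_mono) auto
      finally show ?thesis .
    qed
    have R1': "norm (R t (nome (y j t)) - \<beta> t * nome (y j t)) \<le> K * (norm (nome (y j t)))\<^sup>2" for j
      using M'(8)[of j] by (intro R1[OF M'(1)]) (auto simp: \<epsilon>_def)
    have "\<bar>Re (y (Suc i + (k - 1)) t - A t)\<bar> \<le> (81 * Im (A t)) ^ (k - 1) * (81 * (Im (A t))\<^sup>2 / norm (A t)) \<and>
        Im (y (Suc i + (k - 1)) t - A t) \<le> (81 * Im (A t)) ^ (k - 1) * (81 * (Im (A t))\<^sup>2 / norm (A t))"
    proof (rule no_return_below[where y = "\<lambda>j. y (Suc i + j) t" and \<tau> = "\<lambda>j. \<tau> (Suc i + j)" and R = "R t" and k = k,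
            OF c \<beta>0 _ _ _ _ _ _ _ a32 _ M'(6) start])
      show "1 / y (Suc i + Suc j) t = \<tau> (Suc i + j) * (1 / A t + R t (nome (y (Suc i + j) t)))" for j
        using rec[OF M'(1), of "Suc i + j"] by simp
      show "\<tau> (Suc i + j) = 1" if "j < k" "\<bar>Re (y (Suc i + j) t - A t)\<bar> \<le> 1" for j
        using M'(5)[of "Suc i + j"] that i(1) by auto
    qed (use K R1' Ke Im_pos[OF M'(1)] L in \<open>auto simp: L_def a_def\<close>)
    moreover have "Suc i + (k - 1) = i + k" using k by simp
    ultimately have "Im (y i t - A t) \<le> (81 * L) ^ (k - 1) * (81 * L\<^sup>2 / a)"
      using periodic[of i t] by (simp add: L_def a_def)
    also have "\<dots> \<le> (81 * L) ^ k * (81 * L\<^sup>2 / a)"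
      using L a0 by (intro mult_right_mono power_increasing) auto
    also have "\<dots> \<le> 1 / 10" using M'(6) by (simp add: L_def a_def)
    finally have "Im (y i t) \<le> L + 1 / 2" by (simp add: L_def)
    then have "exp (- (2 * L + 1)) \<le> norm (nome (y i t))" by simp
    then have "exp (- (2 * L + 1)) * a ^ 3 \<le> norm (nome (y i t)) * a ^ 3"
      by (rule mult_right_mono) (use a0 in simp)
    also have "\<dots> \<le> 1" using i(2) by (simp only: a_def)
    finally have "exp (- (2 * L + 1)) * a ^ 3 \<le> 1" .
    then have "a ^ 3 \<le> exp (2 * L + 1)" by (simp only: exp_minus) (simp add: field_simps)
    also have "exp (2 * L + 1) = exp (2 * L) * exp 1" by (rule exp_add)
    also have "\<dots> \<le> 128 * K * a\<^sup>2 * exp 1" using M'(3) by (intro mult_right_mono) (auto simp: L_def a_def)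
    finally have "a\<^sup>2 * a \<le> a\<^sup>2 * (128 * K * exp 1)" by (simp add: power2_eq_square power3_eq_cube mult_ac)
    then have "a \<le> 128 * K * exp 1" using a0 by simp
    moreover have "a \<ge> 2 * (128 * K * exp 1)" using M'(10) by (simp add: a_def)
    moreover have "128 * K * exp 1 > 0" using K by simp
    ultimately have False by linarith
    then show ?thesis ..
  qed
qed

end

lemma (in exponential_return) later_start:
  assumes "T' \<ge> T"
  shows "exponential_return y A \<beta> \<tau> R K \<delta> T' \<beta>s k"
proof
  have sub: "{T'..} \<subseteq> {T..}" using assms by auto
  show "continuous_on {T'..} (y i)" "continuous_on {T'..} A" "continuous_on {T'..} \<beta>" for i
    using cont_y cont_A cont_\<beta> sub continuous_on_subset by blast+
qed (use assms k periodic Im_pos Im_lim A_lim A_nz \<beta>_lim \<beta>s \<tau> K \<delta> R0 R1 R2 rec flat in auto)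

lemma (in exponential_return) flip:
  "exponential_return y (\<lambda>t. - A t) (\<lambda>t. - \<beta> t) (\<lambda>i. - \<tau> i) (\<lambda>t e. - R t e) K \<delta> T (- \<beta>s) k"
proof
  show "norm (- R t e - - \<beta> t * e) \<le> K * (norm e)\<^sup>2" if "t \<ge> T" "norm e \<le> \<delta>" for t e
    using R1[OF that] by (simp add: norm_minus_commute)
  show "norm (- R t e - - R t e') \<le> K * norm (e - e')" if "t \<ge> T" "norm e \<le> \<delta>" "norm e' \<le> \<delta>" for t e e'
    using R2[OF that] by (simp add: norm_minus_commute)
  show "1 / y (Suc i) t = - \<tau> i * (1 / - A t + - R t (nome (y i t)))" if "t \<ge> T" for t i
    using rec[OF that, of i] by (simp add: algebra_simps)
  show "filterlim (\<lambda>t. - A t) at_infinity at_top"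
    using A_lim by (simp add: filterlim_at_infinity[of 0])
  show "- \<tau> i = 1 \<or> - \<tau> i = - 1" for i using \<tau>[of i] by auto
  show "continuous_on {T..} (\<lambda>t. - A t)" "continuous_on {T..} (\<lambda>t. - \<beta> t)"
    by (intro continuous_on_minus cont_A cont_\<beta>)+
  show "((\<lambda>t. - \<beta> t) \<longlongrightarrow> - \<beta>s) at_top" by (intro tendsto_minus \<beta>_lim)
  show "\<exists>i. norm (nome (y i t)) * norm (- A t) ^ 3 \<le> 1" if "t \<ge> T" for t
    using flat[OF that] by simp
  show "norm (- R t e) \<le> K * norm e" if "t \<ge> T" "norm e \<le> \<delta>" for t e using R0[OF that] by simp
  show "- A t \<noteq> 0" if "t \<ge> T" for t using A_nz[OF that] by simp
qed (rule cont_y k periodic Im_pos Im_lim K \<delta> | assumption | simp add: \<beta>s)+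

text \<open>
  Near a very high point \<open>A\<close> is close to plus or minus a point of the chain, so \<open>Im A\<close> does not vanish
  at late times and its sign is constant there; it may be taken positive after changing the signs of
  \<open>A\<close>, \<open>\<beta>\<close>, \<open>R\<close> and \<open>\<tau>\<close> together.
\<close>

theorem (in exponential_return) constant_orbit: "\<exists>t\<ge>T. \<forall>i. y (Suc i) t = y i t"
proof -
  have "eventually (\<lambda>t. \<bar>Im (A t)\<bar> \<ge> 1) at_top"
    using eventually_near_Im_ge[of 1]
  proof (rule eventually_mono, elim exE conjE)
    fix t i assume "1 \<le> Im (\<tau> i * A t)"
    then show "\<bar>Im (A t)\<bar> \<ge> 1" using \<tau>[of i] by auto
  qed
  then obtain M where M: "\<And>t. t \<ge> M \<Longrightarrow> \<bar>Im (A t)\<bar> \<ge> 1"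
    unfolding eventually_at_top_linorder by blast
  define T' where "T' = max T M"
  have T': "T' \<ge> T" "T' \<ge> M" by (auto simp: T'_def)
  interpret late: exponential_return y A \<beta> \<tau> R K \<delta> T' \<beta>s k by (rule later_start[OF T'(1)])
  have conn: "connected ((\<lambda>t. Im (A t)) ` {T'..})"
    by (intro connected_continuous_image connected_Ici continuous_intros late.cont_A)
  have no0: "0 \<notin> (\<lambda>t. Im (A t)) ` {T'..}"
  proof
    assume "0 \<in> (\<lambda>t. Im (A t)) ` {T'..}"
    then obtain t where "t \<ge> T'" "Im (A t) = 0" by auto
    then show False using M[of t] T' by simp
  qed
  have "(\<forall>t\<ge>T'. Im (A t) > 0) \<or> (\<forall>t\<ge>T'. Im (A t) < 0)"
  proof (rule ccontr)
    assume "\<not> ?thesis"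
    then obtain a b where "a \<ge> T'" "b \<ge> T'" "Im (A a) \<le> 0" "Im (A b) \<ge> 0" by (auto simp: not_less)
    then have "{Im (A a)..Im (A b)} \<subseteq> (\<lambda>t. Im (A t)) ` {T'..}"
      by (intro connected_contains_Icc[OF conn]) auto
    moreover have "0 \<in> {Im (A a)..Im (A b)}" using \<open>Im (A a) \<le> 0\<close> \<open>Im (A b) \<ge> 0\<close> by simp
    ultimately show False using no0 by blast
  qed
  then have "\<exists>t\<ge>T'. \<forall>i. y (Suc i) t = y i t"
  proof
    assume "\<forall>t\<ge>T'. Im (A t) > 0"
    then show ?thesis by (intro late.constant_orbit_if_upper) auto
  next
    assume *: "\<forall>t\<ge>T'. Im (A t) < 0"
    interpret neg: exponential_return y "\<lambda>t. - A t" "\<lambda>t. - \<beta> t" "\<lambda>i. - \<tau> i" "\<lambda>t e. - R t e" K \<delta> T' "- \<beta>s" k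
      by (rule late.flip)
    show ?thesis by (rule neg.constant_orbit_if_upper) (use * in auto)
  qed
  then show ?thesis using T' by (meson order_trans)
qed

section \<open>Cluster points of paths and countability of prepoles\<close>

lemma frequently_compact_cluster:
  fixes u :: "real \<Rightarrow> complex"
  assumes freq: "frequently (\<lambda>t. u t \<in> S) at_top" and S: "compact S"
  obtains \<zeta> and s :: "nat \<Rightarrow> real"
  where "\<zeta> \<in> S" "filterlim s at_top sequentially" "(\<lambda>m. u (s m)) \<longlonglongrightarrow> \<zeta>"
proof -
  have "\<exists>t\<ge>real m. u t \<in> S" for m
    using freq unfolding frequently_def eventually_at_top_linorder by blast
  then obtain s where s: "\<And>m. s m \<ge> real m" "\<And>m. u (s m) \<in> S" by metis
  have "\<forall>m. (u \<circ> s) m \<in> S" using s by simp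
  with S obtain \<zeta> r where r: "\<zeta> \<in> S" "strict_mono (r :: nat \<Rightarrow> nat)" "((u \<circ> s) \<circ> r) \<longlonglongrightarrow> \<zeta>"
    unfolding compact_def by blast
  have "filterlim s at_top sequentially"
    by (rule filterlim_at_top_mono[OF filterlim_real_sequentially]) (use s in auto)
  then have "filterlim (\<lambda>m. s (r m)) at_top sequentially"
    by (rule filterlim_compose[OF _ filterlim_subseq[OF r(2)]])
  then show ?thesis using r that[of \<zeta> "s \<circ> r"] by (simp add: o_def)
qed

text \<open>
  A path that neither tends to infinity nor converges to one of its cluster points \<open>\<zeta>\<close> crosses all
  small circles about \<open>\<zeta>\<close> again and again. One of these circles avoids the countable set, yet by
  compactness it carries a cluster point.
\<close>

lemma countable_cluster_dichotomy:
  fixes u :: "real \<Rightarrow> complex"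
  assumes cont: "continuous_on {0<..} u" and P: "countable P"
    and cluster: "\<And>\<zeta> s. \<lbrakk>filterlim s at_top sequentially; (\<lambda>m::nat. u (s m)) \<longlonglongrightarrow> \<zeta>\<rbrakk> \<Longrightarrow> \<zeta> \<in> P"
  shows "filterlim u at_infinity at_top \<or> (\<exists>\<zeta>. (u \<longlongrightarrow> \<zeta>) at_top)"
proof (rule ccontr)
  assume contra: "\<not> ?thesis"
  then have "\<not> filterlim u at_infinity at_top" by blast
  then obtain \<rho>0 where "frequently (\<lambda>t. norm (u t) < \<rho>0) at_top"
    by (auto simp: filterlim_at_infinity[of 0] not_eventually not_le)
  then have "frequently (\<lambda>t. u t \<in> cball 0 \<rho>0) at_top"
    by (rule frequently_elim1) auto
  then obtain \<zeta> s where s: "filterlim s at_top sequentially" "(\<lambda>m. u (s m)) \<longlonglongrightarrow> \<zeta>"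
    by (rule frequently_compact_cluster) auto
  have "\<not> (u \<longlongrightarrow> \<zeta>) at_top" using contra by blast
  then obtain \<rho> where \<rho>: "\<rho> > 0" and far: "frequently (\<lambda>t. dist (u t) \<zeta> \<ge> \<rho>) at_top"
    by (auto simp: tendsto_iff not_eventually not_less)
  have "countable (dist \<zeta> ` P)" using P by (rule countable_image)
  moreover have "uncountable {0<..<\<rho>}" using \<rho> by (simp add: uncountable_open_interval)
  ultimately have "\<not> {0<..<\<rho>} \<subseteq> dist \<zeta> ` P" using countable_subset by metis
  then obtain r where "r \<in> {0<..<\<rho>}" "r \<notin> dist \<zeta> ` P" by blast
  then have r: "0 < r" "r < \<rho>" "r \<notin> dist \<zeta> ` P" by auto
  have near: "frequently (\<lambda>t. dist (u t) \<zeta> < r) at_top"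
  proof -
    have ev: "eventually (\<lambda>m. dist (u (s m)) \<zeta> < r) sequentially"
      using s(2) r(1) by (rule tendstoD)
    have no: "eventually (\<lambda>m. \<not> dist (u (s m)) \<zeta> < r) sequentially"
      if "eventually (\<lambda>t. \<not> dist (u t) \<zeta> < r) at_top"
      using eventually_compose_filterlim[OF that s(1)] .
    have "eventually (\<lambda>m. False) sequentially"
      if "eventually (\<lambda>t. \<not> dist (u t) \<zeta> < r) at_top"
      by (rule eventually_elim2[OF ev no[OF that]]) auto
    then show ?thesis unfolding frequently_def by auto
  qed
  have "frequently (\<lambda>t. u t \<in> sphere \<zeta> r) at_top"
    unfolding frequently_def eventually_at_top_linorder
  proof (rule notI, elim exE)
    fix N assume N: "\<forall>t\<ge>N. u t \<notin> sphere \<zeta> r"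
    obtain a where a: "a \<ge> max N 1" "dist (u a) \<zeta> < r"
      using near unfolding frequently_def eventually_at_top_linorder by blast
    obtain b where b: "b \<ge> a" "dist (u b) \<zeta> \<ge> \<rho>"
      using far unfolding frequently_def eventually_at_top_linorder by blast
    have "\<exists>x\<ge>a. x \<le> b \<and> dist (u x) \<zeta> = r"
      by (rule IVT') (use a b r in \<open>auto intro!: continuous_intros continuous_on_subset[OF cont]\<close>)
    then obtain x where "x \<ge> a" "dist (u x) \<zeta> = r" by blast
    then show False using N[rule_format, of x] a by (simp add: dist_commute)
  qed
  then obtain \<xi> s' where "\<xi> \<in> sphere \<zeta> r" "filterlim s' at_top sequentially" "(\<lambda>m. u (s' m)) \<longlonglongrightarrow> \<xi>"
    by (rule frequently_compact_cluster) auto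
  then show False using cluster[of s' \<xi>] r(3) by auto
qed

lemma countable_cos_zeros: "countable {z::complex. cos z = 0}"
proof -
  have "{z::complex. cos z = 0} \<subseteq> range (\<lambda>n::int. complex_of_real ((of_int n + 1/2) * pi))"
  proof safe
    fix z :: complex assume "cos z = 0"
    then obtain n :: int where "z = of_int n * of_real pi + of_real pi / 2" by (auto simp: cos_eq_0)
    then have "z = complex_of_real ((of_int n + 1/2) * pi)" by (simp add: algebra_simps)
    then show "z \<in> range (\<lambda>n::int. complex_of_real ((of_int n + 1/2) * pi))" by blast
  qed
  then show ?thesis by (rule countable_subset) auto
qed

lemma is_pole_tan_map_iff_cos: "lam \<noteq> 0 \<Longrightarrow> is_pole (tan_map lam) z \<longleftrightarrow> cos z = 0"
  by (simp add: is_pole_tan_map_iff cos_eq_0 algebra_simps)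

lemma countable_tan_fibre: "countable {z::complex. tan z = c}"
proof (cases "\<exists>w. tan w = c \<and> cos w \<noteq> 0")
  case False
  then have "{z. tan z = c} \<subseteq> {z. cos z = 0}" by auto
  then show ?thesis using countable_cos_zeros countable_subset by blast
next
  case True
  then obtain w where w: "tan w = c" "cos w \<noteq> 0" by blast
  have "{z. tan z = c} \<subseteq> {z. cos z = 0} \<union> range (\<lambda>n::int. w + of_real (of_int n * pi))"
  proof safe
    fix z assume z: "c = tan z" "z \<notin> range (\<lambda>n::int. w + of_real (of_int n * pi))"
    show "cos z = 0"
    proof (rule ccontr)
      assume "cos z \<noteq> 0"
      then have "sin (z - w) = 0"
        using w z(1) by (simp add: sin_diff tan_def field_simps)
      then obtain n :: int where "z - w = of_real (of_int n * pi)"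
        by (auto simp: sin_eq_0)
      then have "z = w + of_real (of_int n * pi)" by (simp add: algebra_simps)
      with z(2) show False by blast
    qed
  qed
  then show ?thesis by (rule countable_subset) (intro countable_Un countable_cos_zeros, auto)
qed

text \<open>
  The condition \<open>cos w = 0\<close> says that \<open>w\<close> is a pole. There the formal iteration continues with
  \<open>tan w = 0\<close>, and \<open>0\<close> is a fixed point that is not a pole, so these are exactly the prepoles of order
  at most \<open>n\<close>.
\<close>

definition prepoles_below :: "complex \<Rightarrow> nat \<Rightarrow> complex set" where
  "prepoles_below lam n = {z. \<exists>r<n. cos ((tan_map lam ^^ r) z) = 0}"

lemma countable_prepoles_below:
  assumes "lam \<noteq> 0"
  shows "countable (prepoles_below lam n)"
proof -
  have "countable {z. cos ((tan_map lam ^^ r) z) = 0}" for r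
  proof (induction r)
    case 0 then show ?case using countable_cos_zeros by simp
  next
    case (Suc r)
    have "{z. cos ((tan_map lam ^^ Suc r) z) = 0} =
        (\<Union>c\<in>{z. cos ((tan_map lam ^^ r) z) = 0}. {z. tan z = c / lam})"
      using assms by (auto simp: funpow_Suc_right tan_map_def field_simps simp del: funpow.simps)
    then show ?case using Suc countable_tan_fibre by auto
  qed
  moreover have "prepoles_below lam n = (\<Union>r<n. {z. cos ((tan_map lam ^^ r) z) = 0})"
    by (auto simp: prepoles_below_def)
  ultimately show ?thesis by auto
qed

lemma tan_map_uminus: "tan_map lam (- z) = - tan_map lam z"
  by (simp add: tan_map_def)

lemma funpow_tan_map_uminus: "(tan_map lam ^^ r) (- z) = - (tan_map lam ^^ r) z"
  by (induction r) (auto simp: tan_map_uminus)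

text \<open>
  The nome is a Moebius image of the tangent; this form without division also makes sense when the
  denominator vanishes.
\<close>

lemma exp_tan_identity:
  assumes "cos z \<noteq> 0"
  shows "nome z * (1 - \<i> * tan z) = 1 + \<i> * tan z"
proof -
  have "nome z = exp (\<i> * z) * exp (\<i> * z)" by (simp add: exp_add[symmetric] algebra_simps)
  moreover have "cos z * (1 - \<i> * tan z) = exp (- (\<i> * z))" "cos z * (1 + \<i> * tan z) = exp (\<i> * z)"
    using assms by (simp_all add: tan_def exp_minus_Euler exp_Euler algebra_simps)
  moreover have "exp (\<i> * z) * exp (- (\<i> * z)) = 1" by (simp add: exp_minus)
  ultimately have "cos z * (nome z * (1 - \<i> * tan z)) = cos z * (1 + \<i> * tan z)"
    by (metis mult.assoc mult.commute mult_1)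
  then show ?thesis using assms by simp
qed

lemma tan_eq_exp:
  fixes w :: complex
  assumes "cos w \<noteq> 0"
  shows "1 + nome w \<noteq> 0" and "tan w = \<i> * (1 - nome w) / (1 + nome w)"
proof -
  define e where "e = nome w"
  have id: "e * (1 - \<i> * tan w) = 1 + \<i> * tan w" unfolding e_def by (rule exp_tan_identity[OF assms])
  have ne: "1 + e \<noteq> 0"
  proof
    assume "1 + e = 0"
    then have e: "e = -1" by (simp add: add_eq_0_iff)
    from id show False unfolding e by (simp add: algebra_simps)
  qed
  have "\<i> * (tan w * (1 + e)) = e - 1" using id by (simp add: algebra_simps)
  then have "\<i> * (\<i> * (tan w * (1 + e))) = \<i> * (e - 1)" by simp
  then have "tan w * (1 + e) = \<i> * (1 - e)" by (simp add: algebra_simps)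
  then show "tan w = \<i> * (1 - nome w) / (1 + nome w)"
    using ne by (simp add: e_def field_simps)
  show "1 + nome w \<noteq> 0" using ne by (simp add: e_def)
qed

lemma one_plus_tan_squared:
  fixes z :: complex
  assumes "cos z \<noteq> 0"
  shows "1 + tan z ^ 2 = 1 / cos z ^ 2"
  using assms sin_cos_squared_add[of z] by (simp add: tan_def power_divide field_simps)

lemma prod_lessThan_shift_periodic:
  fixes a :: "nat \<Rightarrow> complex"
  assumes "\<And>i. a (i + n) = a i"
  shows "(\<Prod>i<n. a (j + i)) = (\<Prod>i<n. a i)"
proof (induction j)
  case (Suc j)
  show ?case
  proof (cases n)
    case (Suc m)
    have "(\<Prod>i<n. a (Suc j + i)) = (\<Prod>i<m. a (j + Suc i)) * a (j + n)"
      by (simp add: Suc)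
    also have "a (j + n) = a j" by (rule assms)
    also have "(\<Prod>i<m. a (j + Suc i)) * a j = (\<Prod>i<n. a (j + i))"
      unfolding Suc by (subst prod.lessThan_Suc_shift) (simp add: mult.commute)
    finally show ?thesis using Suc.IH by simp
  qed simp
qed simp

section \<open>Orbits of degenerating cycles\<close>

lemma Im_at_top_if_exp_to_0:
  fixes w :: "real \<Rightarrow> complex"
  assumes "((\<lambda>t. nome (w t)) \<longlongrightarrow> 0) at_top"
  shows "filterlim (\<lambda>t. Im (w t)) at_top at_top"
  unfolding filterlim_at_top
proof
  fix M :: real
  have "eventually (\<lambda>t. dist (nome (w t)) 0 < exp (- 2 * M)) at_top"
    using assms by (rule tendstoD) simp
  then show "eventually (\<lambda>t. M \<le> Im (w t)) at_top" by (rule eventually_mono) simp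
qed

lemma tendsto_tan_complex:
  fixes f :: "'a \<Rightarrow> complex"
  shows "(f \<longlongrightarrow> a) F \<Longrightarrow> cos a \<noteq> 0 \<Longrightarrow> ((\<lambda>x. tan (f x)) \<longlongrightarrow> tan a) F"
  by (rule isCont_tendsto_compose [OF isCont_tan])

text \<open>
  An orbit of period \<open>n\<close>, without poles, followed along a path of parameters that converges to \<open>ls\<close>, such that the
  derivative of the \<open>n\<close>-th iterate tends to zero.
\<close>

locale tangent_cycle_path =
  fixes lam :: "real \<Rightarrow> complex" and z :: "nat \<Rightarrow> real \<Rightarrow> complex" and n :: nat and ls :: complex
  assumes cont_lam: "continuous_on {0<..} lam"
    and cont_z: "\<And>j. continuous_on {0<..} (z j)"
    and n: "n \<ge> 1"
    and periodic: "\<And>j t. t > 0 \<Longrightarrow> z (j + n) t = z j t"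
    and no_pole: "\<And>j t. t > 0 \<Longrightarrow> cos (z j t) \<noteq> 0"
    and step: "\<And>j t. t > 0 \<Longrightarrow> z (Suc j) t = tan_map (lam t) (z j t)"
    and lam_nz: "\<And>t. t > 0 \<Longrightarrow> lam t \<noteq> 0"
    and lam_lim: "(lam \<longlongrightarrow> ls) at_top"
    and ls: "ls \<noteq> 0"
    and multiplier_lim: "((\<lambda>t. \<Prod>j<n. lam t * (1 + tan (z j t) ^ 2)) \<longlongrightarrow> 0) at_top"
begin

lemma step_tendsto:
  assumes s: "filterlim s at_top F" and lim: "((\<lambda>m. z j (s m)) \<longlongrightarrow> \<zeta>) F" and "cos \<zeta> \<noteq> 0"
  shows "((\<lambda>m. z (Suc j) (s m)) \<longlongrightarrow> tan_map ls \<zeta>) F"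
proof -
  have "((\<lambda>m. lam (s m) * tan (z j (s m))) \<longlongrightarrow> ls * tan \<zeta>) F"
    by (intro tendsto_mult tendsto_tan_complex filterlim_compose[OF lam_lim s] lim assms)
  then show ?thesis
    unfolding tan_map_def
  proof (rule Lim_transform_eventually)
    have "eventually (\<lambda>m. s m > 0) F" using s by (simp add: filterlim_at_top_dense)
    then show "eventually (\<lambda>m. lam (s m) * tan (z j (s m)) = z (Suc j) (s m)) F"
      by (rule eventually_mono) (simp add: step tan_map_def)
  qed
qed

lemma iterate_tendsto:
  assumes s: "filterlim s at_top F" and lim: "((\<lambda>m. z j (s m)) \<longlongrightarrow> \<zeta>) F"
    and "\<And>r'. r' < r \<Longrightarrow> cos ((tan_map ls ^^ r') \<zeta>) \<noteq> 0"
  shows "((\<lambda>m. z (j + r) (s m)) \<longlongrightarrow> (tan_map ls ^^ r) \<zeta>) F"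
  using assms(3)
proof (induction r)
  case 0 then show ?case using lim by simp
next
  case (Suc r)
  then show ?case using step_tendsto[OF s, of "j + r"] by simp
qed

lemma pole_step_tendsto:
  assumes lim: "(z j \<longlongrightarrow> \<zeta>) at_top" and "cos \<zeta> = 0"
  shows "filterlim (z (Suc j)) at_infinity at_top"
proof -
  have sin0: "sin \<zeta> \<noteq> 0" using assms sin_cos_squared_add[of \<zeta>] by auto
  have "filterlim (\<lambda>t. cos (z j t)) (at 0) at_top"
    unfolding filterlim_at
  proof
    show "eventually (\<lambda>t. cos (z j t) \<in> UNIV \<and> cos (z j t) \<noteq> 0) at_top"
      using eventually_gt_at_top[of 0] by (rule eventually_mono) (simp add: no_pole)
    show "((\<lambda>t. cos (z j t)) \<longlongrightarrow> 0) at_top" using tendsto_cos[OF lim] assms by simp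
  qed
  moreover have "((\<lambda>t. lam t * sin (z j t)) \<longlongrightarrow> ls * sin \<zeta>) at_top"
    by (intro tendsto_intros lam_lim lim)
  ultimately have "filterlim (\<lambda>t. lam t * sin (z j t) / cos (z j t)) at_infinity at_top"
    unfolding divide_inverse using sin0 ls
    by (intro tendsto_mult_filterlim_at_infinity[where c = "ls * sin \<zeta>"]
        filterlim_compose[OF filterlim_inverse_at_infinity]) auto
  moreover have "eventually (\<lambda>t. lam t * sin (z j t) / cos (z j t) = z (Suc j) t) at_top"
    using eventually_gt_at_top[of 0] by (rule eventually_mono) (simp add: step tan_map_def tan_def)
  ultimately show ?thesis by (rule filterlim_mono_eventually[OF _ order_refl order_refl])
qed

text \<open>
  If all orbit points converge to finite points that are not poles, the multiplier tends to a product of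
  the numbers \<open>ls / cos^2\<close>, none of which is zero.
\<close>

lemma product_limit_nonzero:
  fixes F :: "'a filter"
  assumes s: "filterlim s at_top F" and F: "F \<noteq> bot"
    and lim: "\<And>i. i < n \<Longrightarrow> ((\<lambda>m. z (j + i) (s m)) \<longlongrightarrow> \<zeta> i) F"
    and nz: "\<And>i. i < n \<Longrightarrow> cos (\<zeta> i) \<noteq> 0"
  shows False
proof -
  have "((\<lambda>m. \<Prod>i<n. lam (s m) * (1 + tan (z (j + i) (s m)) ^ 2)) \<longlongrightarrow> (\<Prod>i<n. ls * (1 + tan (\<zeta> i) ^ 2))) F"
    by (intro tendsto_prod tendsto_mult tendsto_add tendsto_const tendsto_power tendsto_tan_complex
        filterlim_compose[OF lam_lim s] lim nz) auto
  moreover have "eventually (\<lambda>m. (\<Prod>i<n. lam (s m) * (1 + tan (z (j + i) (s m)) ^ 2)) =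
      (\<Prod>i<n. lam (s m) * (1 + tan (z i (s m)) ^ 2))) F"
  proof -
    have "eventually (\<lambda>m. s m > 0) F" using s by (simp add: filterlim_at_top_dense)
    then show ?thesis
    proof (rule eventually_mono)
      fix m assume "s m > 0"
      then show "(\<Prod>i<n. lam (s m) * (1 + tan (z (j + i) (s m)) ^ 2)) = (\<Prod>i<n. lam (s m) * (1 + tan (z i (s m)) ^ 2))"
        by (intro prod_lessThan_shift_periodic[where a = "\<lambda>i. lam (s m) * (1 + tan (z i (s m)) ^ 2)"]) (simp add: periodic)
    qed
  qed
  ultimately have "((\<lambda>m. \<Prod>i<n. lam (s m) * (1 + tan (z i (s m)) ^ 2)) \<longlongrightarrow> (\<Prod>i<n. ls * (1 + tan (\<zeta> i) ^ 2))) F"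
    by (rule Lim_transform_eventually)
  moreover have "((\<lambda>m. \<Prod>i<n. lam (s m) * (1 + tan (z i (s m)) ^ 2)) \<longlongrightarrow> 0) F"
    by (rule filterlim_compose[OF multiplier_lim s])
  ultimately have "(\<Prod>i<n. ls * (1 + tan (\<zeta> i) ^ 2)) = 0" by (rule tendsto_unique[OF F])
  then obtain i where "i < n" "ls * (1 + tan (\<zeta> i) ^ 2) = 0" by auto
  then show False using ls nz one_plus_tan_squared[of "\<zeta> i"] by auto
qed

text \<open>
  A finite cluster point that never meets a pole determines finite limits for all later orbit points along
  the same sequence of times, contrary to \<open>product_limit_nonzero\<close>.
\<close>

lemma cluster_point_prepole:
  fixes s :: "nat \<Rightarrow> real"
  assumes s: "filterlim s at_top sequentially" and lim: "(\<lambda>m. z j (s m)) \<longlonglongrightarrow> \<zeta>"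
  shows "\<zeta> \<in> prepoles_below ls n"
proof (rule ccontr)
  assume "\<zeta> \<notin> prepoles_below ls n"
  then have nz: "\<And>r. r < n \<Longrightarrow> cos ((tan_map ls ^^ r) \<zeta>) \<noteq> 0" by (auto simp: prepoles_below_def)
  show False
    by (rule product_limit_nonzero[OF s, of j "\<lambda>i. (tan_map ls ^^ i) \<zeta>"])
      (use nz in \<open>auto intro!: iterate_tendsto[OF s lim]\<close>)
qed

lemma sphere_convergence:
  "filterlim (z j) at_infinity at_top \<or> (\<exists>\<zeta>. (z j \<longlongrightarrow> \<zeta>) at_top)"
  by (rule countable_cluster_dichotomy[OF cont_z countable_prepoles_below[OF ls, of n]])
    (rule cluster_point_prepole)

lemma not_both: "filterlim (z j) at_infinity at_top \<Longrightarrow> (z j \<longlongrightarrow> \<zeta>) at_top \<Longrightarrow> False"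
  using not_tendsto_and_filterlim_at_infinity[OF trivial_limit_at_top_linorder] by blast

lemma escaping_index: "\<exists>j. filterlim (z j) at_infinity at_top"
proof (rule ccontr)
  assume no: "\<nexists>j. filterlim (z j) at_infinity at_top"
  then have "\<forall>j. \<exists>\<zeta>. (z j \<longlongrightarrow> \<zeta>) at_top" using sphere_convergence by blast
  then obtain \<zeta> where \<zeta>: "\<And>j. (z j \<longlongrightarrow> \<zeta> j) at_top" by metis
  have "cos (\<zeta> j) \<noteq> 0" for j using pole_step_tendsto[OF \<zeta>[of j]] no by blast
  then show False
    using product_limit_nonzero[of "\<lambda>t. t" at_top 0 \<zeta>] \<zeta> by (auto simp: filterlim_ident)
qed

lemma exp_identity:
  assumes "t > 0"
  shows "nome (z j t) * (lam t - \<i> * z (Suc j) t) = lam t + \<i> * z (Suc j) t"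
proof -
  have "lam t - \<i> * z (Suc j) t = lam t * (1 - \<i> * tan (z j t))"
    "lam t + \<i> * z (Suc j) t = lam t * (1 + \<i> * tan (z j t))"
    by (simp_all add: step[OF assms] tan_map_def algebra_simps)
  then show ?thesis using exp_tan_identity[OF no_pole[OF assms, of j]]
    by (metis mult.left_commute)
qed

lemma convergent_if_exp_convergent:
  assumes lim: "((\<lambda>t. nome (z j t)) \<longlongrightarrow> c) at_top" and c: "c \<noteq> 0"
  shows "\<exists>\<zeta>. (z j \<longlongrightarrow> \<zeta>) at_top"
proof -
  define h where "h t = nome (z j t) / c" for t
  have h_lim: "(h \<longlongrightarrow> 1) at_top"
    unfolding h_def using tendsto_divide[OF lim tendsto_const[of c]] c by simp
  then have "eventually (\<lambda>t. dist (h t) 1 < 1) at_top" by (rule tendstoD) auto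
  then obtain T1 where T1: "\<And>t. t \<ge> T1 \<Longrightarrow> norm (h t - 1) < 1"
    by (auto simp: eventually_at_top_linorder dist_norm)
  define T where "T = max 1 T1"
  have sub: "{T..} \<subseteq> {0<..}" by (auto simp: T_def)
  have Reh: "Re (h t) > 0" if "t \<ge> T" for t
    using T1[of t] that abs_Re_le_cmod[of "h t - 1"] by (auto simp: T_def)
  have cz: "continuous_on {T..} (z j)" using cont_z sub continuous_on_subset by blast
  define g where "g t = (Ln (h t) + Ln c) / (2 * \<i>)" for t
  have "continuous_on {T..} h" unfolding h_def using c by (intro continuous_intros cz) auto
  then have "continuous_on {T..} g"
    unfolding g_def using Reh by (intro continuous_intros) (auto simp: complex_nonpos_Reals_iff dest!: leD)
  moreover have "nome (z j t) = nome (g t)" if "t \<ge> T" for t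
  proof -
    have "h t \<noteq> 0" using Reh[OF that] by auto
    then have "nome (g t) = h t * c" using c by (simp add: g_def exp_add)
    then show ?thesis using c by (simp add: h_def)
  qed
  ultimately obtain N where N: "\<And>t. t \<ge> T \<Longrightarrow> z j t = g t + of_real (pi * of_int N)"
    using log_branch_constant[OF cz] by blast
  have "(g \<longlongrightarrow> (Ln 1 + Ln c) / (2 * \<i>)) at_top"
    unfolding g_def by (intro tendsto_intros h_lim) auto
  then have "((\<lambda>t. g t + of_real (pi * of_int N)) \<longlongrightarrow> (Ln 1 + Ln c) / (2 * \<i>) + of_real (pi * of_int N)) at_top"
    by (intro tendsto_intros)
  moreover have "eventually (\<lambda>t. g t + of_real (pi * of_int N) = z j t) at_top"
    using eventually_ge_at_top[of T] by (rule eventually_mono) (simp add: N)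
  ultimately have "(z j \<longlongrightarrow> (Ln 1 + Ln c) / (2 * \<i>) + of_real (pi * of_int N)) at_top"
    by (rule Lim_transform_eventually)
  then show ?thesis by blast
qed

text \<open>
  The nome of \<open>z j\<close> is a Moebius function of \<open>z (j + 1)\<close> whose zero and pole are the two asymptotic values.
  Any other limit of \<open>z (j + 1)\<close>, including infinity, gives the nome a finite nonzero limit, and then
  \<open>z j\<close> would converge by \<open>convergent_if_exp_convergent\<close>.
\<close>

lemma after_infinity:
  assumes inf: "filterlim (z j) at_infinity at_top"
  shows "\<exists>\<sigma>. (\<sigma> = 1 \<or> \<sigma> = -1) \<and> (z (Suc j) \<longlongrightarrow> \<sigma> * (ls * \<i>)) at_top \<and>
    filterlim (\<lambda>t. Im (\<sigma> * z j t)) at_top at_top"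
proof -
  define e where "e t = nome (z j t)" for t
  have id: "eventually (\<lambda>t. e t * (lam t - \<i> * z (Suc j) t) = lam t + \<i> * z (Suc j) t) at_top"
    using eventually_gt_at_top[of 0] by (rule eventually_mono) (simp add: exp_identity e_def)
  have e_lim: "(e \<longlongrightarrow> c) at_top \<Longrightarrow> c = 0" for c
    using convergent_if_exp_convergent[of j c] not_both[OF inf] unfolding e_def by blast
  have not_inf: "\<not> filterlim (z (Suc j)) at_infinity at_top"
  proof
    assume inf': "filterlim (z (Suc j)) at_infinity at_top"
    have q: "((\<lambda>t. lam t / z (Suc j) t) \<longlongrightarrow> 0) at_top"
      by (rule tendsto_divide_0[OF lam_lim inf'])
    have "((\<lambda>t. (lam t / z (Suc j) t + \<i>) / (lam t / z (Suc j) t - \<i>)) \<longlongrightarrow> (0 + \<i>) / (0 - \<i>)) at_top"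
      by (intro tendsto_intros q) auto
    moreover have "eventually (\<lambda>t. (lam t / z (Suc j) t + \<i>) / (lam t / z (Suc j) t - \<i>) = e t) at_top"
    proof -
      have "eventually (\<lambda>t. z (Suc j) t \<noteq> 0) at_top"
        using inf' by (rule filterlim_at_infinity_imp_eventually_ne)
      moreover have "eventually (\<lambda>t. dist (lam t / z (Suc j) t) 0 < 1) at_top" using q by (rule tendstoD) simp
      ultimately show ?thesis using id
      proof eventually_elim
        case (elim t)
        define w where "w = z (Suc j) t"
        have w: "w \<noteq> 0" "norm (lam t / w) < 1" using elim by (auto simp: w_def)
        have "lam t / w - \<i> \<noteq> 0" using w by auto
        have "(lam t / w + \<i>) * w = e t * ((lam t / w - \<i>) * w)"
          using elim(3) w by (simp add: w_def[symmetric] algebra_simps)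
        then have "lam t / w + \<i> = e t * (lam t / w - \<i>)" using w by (simp add: mult.assoc[symmetric])
        then show ?case using \<open>lam t / w - \<i> \<noteq> 0\<close> by (simp add: w_def)
      qed
    qed
    ultimately have "(e \<longlongrightarrow> (0 + \<i>) / (0 - \<i>)) at_top" by (rule Lim_transform_eventually)
    from e_lim[OF this] show False by simp
  qed
  then obtain \<zeta> where \<zeta>: "(z (Suc j) \<longlongrightarrow> \<zeta>) at_top" using sphere_convergence by blast
  have num: "((\<lambda>t. lam t + \<i> * z (Suc j) t) \<longlongrightarrow> ls + \<i> * \<zeta>) at_top"
    and den: "((\<lambda>t. lam t - \<i> * z (Suc j) t) \<longlongrightarrow> ls - \<i> * \<zeta>) at_top"
    by (intro tendsto_intros lam_lim \<zeta>)+
  show ?thesis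
  proof (cases "ls - \<i> * \<zeta> = 0")
    case False
    have "((\<lambda>t. (lam t + \<i> * z (Suc j) t) / (lam t - \<i> * z (Suc j) t)) \<longlongrightarrow> (ls + \<i> * \<zeta>) / (ls - \<i> * \<zeta>)) at_top"
      by (intro tendsto_intros num den False)
    moreover have "eventually (\<lambda>t. (lam t + \<i> * z (Suc j) t) / (lam t - \<i> * z (Suc j) t) = e t) at_top"
      using tendsto_imp_eventually_ne[OF den False] id by eventually_elim (auto simp: field_simps)
    ultimately have e: "(e \<longlongrightarrow> (ls + \<i> * \<zeta>) / (ls - \<i> * \<zeta>)) at_top" by (rule Lim_transform_eventually)
    have "(ls + \<i> * \<zeta>) / (ls - \<i> * \<zeta>) = 0" by (rule e_lim[OF e])
    then have "ls + \<i> * \<zeta> = 0" using False by simp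
    then have "\<i> * (ls + \<i> * \<zeta>) = 0" by simp
    then have "\<zeta> = ls * \<i>" by (simp add: algebra_simps)
    moreover have "filterlim (\<lambda>t. Im (z j t)) at_top at_top"
      using e \<open>ls + \<i> * \<zeta> = 0\<close> unfolding e_def by (intro Im_at_top_if_exp_to_0) simp
    ultimately show ?thesis using \<zeta> by (intro exI[of _ 1]) auto
  next
    case True
    then have "\<i> * (ls - \<i> * \<zeta>) = 0" by simp
    then have \<zeta>': "\<zeta> = - (ls * \<i>)" by (simp add: algebra_simps add_eq_0_iff)
    then have ne: "ls + \<i> * \<zeta> \<noteq> 0" using ls by (simp add: algebra_simps)
    have "((\<lambda>t. (lam t - \<i> * z (Suc j) t) / (lam t + \<i> * z (Suc j) t)) \<longlongrightarrow> (ls - \<i> * \<zeta>) / (ls + \<i> * \<zeta>)) at_top"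
      by (intro tendsto_intros num den ne)
    moreover have "eventually (\<lambda>t. (lam t - \<i> * z (Suc j) t) / (lam t + \<i> * z (Suc j) t) = nome (- z j t)) at_top"
      using tendsto_imp_eventually_ne[OF num ne] id
    proof eventually_elim
      case (elim t)
      have "e t * nome (- z j t) = 1" by (simp add: e_def exp_minus)
      then have "lam t - \<i> * z (Suc j) t = nome (- z j t) * (lam t + \<i> * z (Suc j) t)"
        unfolding elim(2)[symmetric] by (metis mult.assoc mult.commute mult_1)
      then show ?case using elim(1) by simp
    qed
    ultimately have "((\<lambda>t. nome (- z j t)) \<longlongrightarrow> (ls - \<i> * \<zeta>) / (ls + \<i> * \<zeta>)) at_top"
      by (rule Lim_transform_eventually)
    then have "((\<lambda>t. nome (- z j t)) \<longlongrightarrow> 0) at_top" using True by simp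
    then have "filterlim (\<lambda>t. Im (- z j t)) at_top at_top" by (rule Im_at_top_if_exp_to_0)
    then show ?thesis using \<zeta> \<zeta>' by (intro exI[of _ "-1"]) auto
  qed
qed

end

context tangent_cycle_path
begin

definition crit :: "nat \<Rightarrow> complex" where
  "crit r = (tan_map ls ^^ r) (ls * \<i>)"

lemma periodic_filterlim: "filterlim (z (j + n)) G at_top \<longleftrightarrow> filterlim (z j) G at_top"
proof (rule filterlim_cong[OF refl refl])
  show "eventually (\<lambda>t. z (j + n) t = z j t) at_top"
    using eventually_gt_at_top[of 0] by (rule eventually_mono) (rule periodic)
qed

lemma follow_critical_orbit:
  assumes lim: "(z j \<longlongrightarrow> \<sigma> * (ls * \<i>)) at_top" and \<sigma>: "\<sigma> = 1 \<or> \<sigma> = -1"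
    and nz: "\<And>r'. r' < r \<Longrightarrow> cos (crit r') \<noteq> 0"
  shows "(z (j + r) \<longlongrightarrow> \<sigma> * crit r) at_top"
proof -
  have eq: "(tan_map ls ^^ r') (\<sigma> * (ls * \<i>)) = \<sigma> * crit r'" for r'
    using \<sigma> funpow_tan_map_uminus[of r' ls "ls * \<i>"] by (auto simp: crit_def)
  have "cos ((tan_map ls ^^ r') (\<sigma> * (ls * \<i>))) \<noteq> 0" if "r' < r" for r'
    unfolding eq using \<sigma> nz[OF that] by auto
  then show ?thesis
    using iterate_tendsto[of "\<lambda>t. t" at_top j "\<sigma> * (ls * \<i>)" r] lim eq by (simp add: filterlim_ident)
qed

lemma critical_orbit_meets_pole: "\<exists>r. cos (crit r) = 0"
proof (rule ccontr)
  assume no: "\<nexists>r. cos (crit r) = 0"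
  obtain j where inf: "filterlim (z j) at_infinity at_top" using escaping_index by blast
  obtain \<sigma> where \<sigma>: "\<sigma> = 1 \<or> \<sigma> = -1" "(z (Suc j) \<longlongrightarrow> \<sigma> * (ls * \<i>)) at_top"
    using after_infinity[OF inf] by blast
  have "(z (Suc j + (n - 1)) \<longlongrightarrow> \<sigma> * crit (n - 1)) at_top"
    by (rule follow_critical_orbit) (use \<sigma> no in auto)
  moreover have "Suc j + (n - 1) = j + n" using n by simp
  ultimately have "(z (j + n) \<longlongrightarrow> \<sigma> * crit (n - 1)) at_top" by simp
  then show False using not_both[OF inf] periodic_filterlim by blast
qed

text \<open>
  The order of \<open>ls * \<i>\<close> as a prepole of the limit map.
\<close>

definition q :: nat where "q = Suc (LEAST r. cos (crit r) = 0)"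

lemma crit_pole: "cos (crit (q - 1)) = 0"
  unfolding q_def using critical_orbit_meets_pole by (auto intro: LeastI_ex)

lemma crit_no_pole: "r < q - 1 \<Longrightarrow> cos (crit r) \<noteq> 0"
  unfolding q_def by (auto dest: not_less_Least)

lemma q_pos: "q \<ge> 1" by (simp add: q_def)

lemma prepole_q: "prepole ls q (ls * \<i>)"
  unfolding prepole_def is_pole_tan_map_iff_cos[OF ls]
  using q_pos crit_pole crit_no_pole by (auto simp: crit_def)

text \<open>
  Behind a point tending to infinity the orbit follows that of an asymptotic value of the limit map
  until the latter reaches a pole, and then it tends to infinity again.
\<close>

lemma excursion:
  assumes inf: "filterlim (z j) at_infinity at_top"
  obtains \<sigma> where "\<sigma> = 1 \<or> \<sigma> = -1" "\<And>r. r < q \<Longrightarrow> (z (Suc j + r) \<longlongrightarrow> \<sigma> * crit r) at_top"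
    "filterlim (z (j + Suc q)) at_infinity at_top" "filterlim (\<lambda>t. Im (\<sigma> * z j t)) at_top at_top"
proof -
  obtain \<sigma> where \<sigma>: "\<sigma> = 1 \<or> \<sigma> = -1" "(z (Suc j) \<longlongrightarrow> \<sigma> * (ls * \<i>)) at_top"
    "filterlim (\<lambda>t. Im (\<sigma> * z j t)) at_top at_top"
    using after_infinity[OF inf] by blast
  have lim: "(z (Suc j + r) \<longlongrightarrow> \<sigma> * crit r) at_top" if "r < q" for r
    by (rule follow_critical_orbit) (use \<sigma> crit_no_pole that in auto)
  have "cos (\<sigma> * crit (q - 1)) = 0" using \<sigma>(1) crit_pole by auto
  then have "filterlim (z (Suc (Suc j + (q - 1)))) at_infinity at_top"
    using pole_step_tendsto[OF lim[of "q - 1"]] q_pos by simp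
  moreover have "Suc (Suc j + (q - 1)) = j + Suc q" using q_pos by simp
  ultimately show ?thesis using that[of \<sigma>] \<sigma> lim by metis
qed

lemma shift: "tangent_cycle_path lam (\<lambda>i. z (j + i)) n ls"
proof
  have "((\<lambda>t. \<Prod>i<n. lam t * (1 + tan (z (j + i) t) ^ 2)) \<longlongrightarrow> 0) at_top \<longleftrightarrow>
     ((\<lambda>t. \<Prod>i<n. lam t * (1 + tan (z i t) ^ 2)) \<longlongrightarrow> 0) at_top"
  proof (rule filterlim_cong[OF refl refl])
    show "eventually (\<lambda>t. (\<Prod>i<n. lam t * (1 + tan (z (j + i) t) ^ 2)) = (\<Prod>i<n. lam t * (1 + tan (z i t) ^ 2))) at_top"
      using eventually_gt_at_top[of 0]
    proof (rule eventually_mono)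
      fix t :: real assume "t > 0"
      then show "(\<Prod>i<n. lam t * (1 + tan (z (j + i) t) ^ 2)) = (\<Prod>i<n. lam t * (1 + tan (z i t) ^ 2))"
        by (intro prod_lessThan_shift_periodic[where a = "\<lambda>i. lam t * (1 + tan (z i t) ^ 2)"]) (simp add: periodic)
    qed
  qed
  then show "((\<lambda>t. \<Prod>i<n. lam t * (1 + tan (z (j + i) t) ^ 2)) \<longlongrightarrow> 0) at_top"
    using multiplier_lim by simp
  show "z (j + (i + n)) t = z (j + i) t" if "t > 0" for i t
    using periodic[OF that, of "j + i"] by (simp add: add.assoc)
  show "z (j + Suc i) t = tan_map (lam t) (z (j + i) t)" if "t > 0" for i t
    using step[OF that, of "j + i"] by simp
qed (simp_all add: cont_lam cont_z n[simplified] no_pole lam_nz lam_lim ls)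

end

text \<open>
  The numbering starts at a point tending to infinity, and the multiplier is flat, that is, smaller than every
  power of the distance of the parameter from its limit.
\<close>

locale escaping_cycle_path = tangent_cycle_path +
  assumes inf0: "filterlim (z 0) at_infinity at_top"
    and flat: "\<And>N. eventually (\<lambda>t. norm (\<Prod>j<n. lam t * (1 + tan (z j t) ^ 2)) \<le> norm (lam t - ls) ^ N) at_top"
begin

lemma block_start_infinite: "filterlim (z (i * Suc q)) at_infinity at_top"
proof (induction i)
  case 0 then show ?case using inf0 by simp
next
  case (Suc i)
  have "filterlim (z (i * Suc q + Suc q)) at_infinity at_top" by (rule excursion[OF Suc])
  moreover have "i * Suc q + Suc q = Suc i * Suc q" by simp
  ultimately show ?case by (simp only:)
qed

lemma infinite_iff: "filterlim (z j) at_infinity at_top \<longleftrightarrow> Suc q dvd j"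
proof
  assume inf: "filterlim (z j) at_infinity at_top"
  show "Suc q dvd j"
  proof (rule ccontr)
    assume "\<not> Suc q dvd j"
    define i r where "i = j div Suc q" and "r = j mod Suc q"
    have r: "r > 0" "r < Suc q" using \<open>\<not> Suc q dvd j\<close> by (auto simp: r_def dvd_eq_mod_eq_0)
    have j: "j = Suc (i * Suc q) + (r - 1)"
      using r div_mult_mod_eq[of j "Suc q"] unfolding i_def r_def by linarith
    obtain \<sigma> where \<sigma>: "\<And>r. r < q \<Longrightarrow> (z (Suc (i * Suc q) + r) \<longlongrightarrow> \<sigma> * crit r) at_top"
      using excursion[OF block_start_infinite[of i]] by blast
    have "r - 1 < q" using r by simp
    from \<sigma>[OF this] show False using not_both[OF inf] unfolding j by blast
  qed
next
  assume "Suc q dvd j"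
  then obtain i where "j = i * Suc q" by (metis dvdE mult.commute)
  then show "filterlim (z j) at_infinity at_top" using block_start_infinite by simp
qed

lemma period_dvd: "Suc q dvd n"
  using infinite_iff[of n] periodic_filterlim[of 0 at_infinity] inf0 by simp

definition k :: nat where "k = n div Suc q"

lemma n_eq: "n = k * Suc q" using period_dvd unfolding k_def by (simp only: dvd_div_mult_self)

lemma k_pos: "k \<ge> 1" using n n_eq by (cases k) auto

end

section \<open>Local expansion of the return map\<close>

text \<open>
  Cauchy estimates on a disc of fixed radius in \<open>e\<close>; they are uniform in the parameter because \<open>W\<close> is
  bounded on the compact product.
\<close>

lemma second_order_expansion:
  fixes W :: "complex \<Rightarrow> complex \<Rightarrow> complex"
  assumes r: "r > 0"
    and cont: "continuous_on (cball ls r \<times> cball 0 r) (\<lambda>p. W (fst p) (snd p))"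
    and hol: "\<And>lam. lam \<in> cball ls r \<Longrightarrow> W lam holomorphic_on ball 0 r"
  obtains K where "K \<ge> 1"
    "\<And>lam e. \<lbrakk>lam \<in> cball ls r; norm e \<le> r / 4\<rbrakk> \<Longrightarrow> norm (W lam e - W lam 0) \<le> K * norm e"
    "\<And>lam e. \<lbrakk>lam \<in> cball ls r; norm e \<le> r / 4\<rbrakk> \<Longrightarrow> norm (W lam e - W lam 0 - deriv (W lam) 0 * e) \<le> K * (norm e)\<^sup>2"
    "\<And>lam e e'. \<lbrakk>lam \<in> cball ls r; norm e \<le> r / 4; norm e' \<le> r / 4\<rbrakk> \<Longrightarrow> norm (W lam e - W lam e') \<le> K * norm (e - e')"
    "continuous_on (cball ls r) (\<lambda>lam. deriv (W lam) 0)"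
proof -
  have comp: "compact (cball ls r \<times> cball (0::complex) r)" by (intro compact_Times compact_cball)
  obtain B where B: "\<And>lam e. \<lbrakk>lam \<in> cball ls r; e \<in> cball 0 r\<rbrakk> \<Longrightarrow> norm (W lam e) \<le> B" and B0: "B > 0"
  proof -
    have "bounded ((\<lambda>p. W (fst p) (snd p)) ` (cball ls r \<times> cball 0 r))"
      by (intro compact_imp_bounded compact_continuous_image cont comp)
    then obtain B where "B > 0" "\<forall>w\<in>(\<lambda>p. W (fst p) (snd p)) ` (cball ls r \<times> cball 0 r). norm w \<le> B"
      by (auto simp: bounded_pos)
    then show ?thesis using that[of B] by force
  qed
  have contW: "continuous_on (cball 0 r) (W lam)" if "lam \<in> cball ls r" for lam
  proof -
    have "continuous_on (cball 0 r) (\<lambda>e. (\<lambda>p. W (fst p) (snd p)) (lam, e))"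
      by (rule continuous_on_compose2[OF cont]) (use that in \<open>auto intro!: continuous_intros\<close>)
    then show ?thesis by simp
  qed
  define K1 where "K1 = 2 * B / r"
  define K2 where "K2 = 32 * B / r\<^sup>2"
  define K where "K = Max {1, K1, K2}"
  have K: "K \<ge> 1" "K \<ge> K1" "K \<ge> K2" by (auto simp: K_def)
  have bounds: "norm (deriv (W lam) e) \<le> K1" "norm ((deriv ^^ 2) (W lam) e) \<le> K2"
    if lam: "lam \<in> cball ls r" and e: "norm e \<le> r / 4" for lam e
  proof -
    have sub: "cball e (r / 2) \<subseteq> ball 0 r"
    proof
      fix x assume "x \<in> cball e (r / 2)"
      then have "norm (x - e) \<le> r / 2" by (simp add: dist_norm norm_minus_commute)
      then have "norm x \<le> r / 2 + r / 4" using e norm_triangle_ineq[of "x - e" e] by simp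
      then show "x \<in> ball 0 r" using r by simp
    qed
    have Cau: "norm ((deriv ^^ m) (W lam) e) \<le> fact m * B / (r / 2) ^ m" for m
    proof (rule Cauchy_inequality)
      show "W lam holomorphic_on ball e (r / 2)"
        using hol[OF lam] by (rule holomorphic_on_subset) (use sub ball_subset_cball in blast)
      show "continuous_on (cball e (r / 2)) (W lam)"
        using contW[OF lam] by (rule continuous_on_subset) (use sub ball_subset_cball in blast)
      show "norm (W lam x) \<le> B" if "norm (e - x) = r / 2" for x
      proof -
        have "x \<in> cball e (r / 2)" using that by (simp add: dist_norm)
        then show ?thesis using B[OF lam] sub by (metis mem_ball mem_cball less_imp_le subsetD)
      qed
    qed (use r in auto)
    show "norm (deriv (W lam) e) \<le> K1" using Cau[of 1] by (simp add: K1_def field_simps)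
    show "norm ((deriv ^^ 2) (W lam) e) \<le> K2"
    proof -
      have "norm ((deriv ^^ 2) (W lam) e) \<le> 8 * B / r\<^sup>2" using Cau[of 2] by (simp add: fact_2 power_divide)
      also have "\<dots> \<le> K2" using B0 by (simp add: K2_def divide_right_mono)
      finally show ?thesis .
    qed
  qed
  have der: "((deriv ^^ m) (W lam) has_field_derivative (deriv ^^ Suc m) (W lam) x) (at x within cball 0 (r / 4))"
    if lam: "lam \<in> cball ls r" and "x \<in> cball 0 (r / 4)" for lam x m
  proof -
    have "(deriv ^^ m) (W lam) holomorphic_on ball 0 r" by (rule holomorphic_higher_deriv[OF hol[OF lam]]) auto
    moreover have "x \<in> ball 0 r" using that r by auto
    ultimately show ?thesis by (simp add: holomorphic_derivI)
  qed
  have lip: "norm (W lam e - W lam e') \<le> K * norm (e - e')"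
    if lam: "lam \<in> cball ls r" and e: "norm e \<le> r / 4" "norm e' \<le> r / 4" for lam e e'
  proof (rule field_differentiable_bound[where S = "cball 0 (r / 4)" and f' = "deriv (W lam)"])
    show "(W lam has_field_derivative deriv (W lam) x) (at x within cball 0 (r / 4))" if "x \<in> cball 0 (r / 4)" for x
      using der[OF lam that, of 0] by simp
    show "norm (deriv (W lam) x) \<le> K" if "x \<in> cball 0 (r / 4)" for x
      using bounds(1)[OF lam, of x] that K by simp
  qed (use e in auto)
  have taylor: "norm (W lam e - W lam 0 - deriv (W lam) 0 * e) \<le> K * (norm e)\<^sup>2"
    if lam: "lam \<in> cball ls r" and e: "norm e \<le> r / 4" for lam e
  proof -
    have "norm ((deriv ^^ 0) (W lam) e - (\<Sum>i\<le>1. (deriv ^^ i) (W lam) 0 * (e - 0) ^ i / fact i)) \<le> K2 * norm (e - 0) ^ Suc 1 / fact 1"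
    proof (rule complex_Taylor[where S = "cball 0 (r / 4)" and f = "\<lambda>i. (deriv ^^ i) (W lam)"])
      show "norm ((deriv ^^ Suc 1) (W lam) x) \<le> K2" if "x \<in> cball 0 (r / 4)" for x
        using bounds(2)[OF lam, of x] that by (simp add: numeral_2_eq_2)
      show "((deriv ^^ i) (W lam) has_field_derivative (deriv ^^ Suc i) (W lam) x) (at x within cball 0 (r / 4))"
        if "x \<in> cball 0 (r / 4)" for i x by (rule der[OF lam that])
    qed (use e r in auto)
    then have "norm (W lam e - W lam 0 - deriv (W lam) 0 * e) \<le> K2 * (norm e)\<^sup>2"
      by (simp add: power2_eq_square diff_diff_eq)
    also have "\<dots> \<le> K * (norm e)\<^sup>2" using K by (intro mult_right_mono) auto
    finally show ?thesis .
  qed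
  have contd: "continuous_on (cball ls r) (\<lambda>lam. deriv (W lam) 0)"
    unfolding continuous_on_iff
  proof (intro ballI allI impI)
    fix lam and \<epsilon> :: real assume lam: "lam \<in> cball ls r" and \<epsilon>: "\<epsilon> > 0"
    have "uniformly_continuous_on (cball ls r \<times> cball 0 r) (\<lambda>p. W (fst p) (snd p))"
      by (rule compact_uniformly_continuous[OF cont comp])
    then obtain d where d: "d > 0" "\<And>p p'. \<lbrakk>p \<in> cball ls r \<times> cball 0 r; p' \<in> cball ls r \<times> cball 0 r; dist p' p < d\<rbrakk> \<Longrightarrow>
        dist (W (fst p') (snd p')) (W (fst p) (snd p)) < \<epsilon> * r / 4"
      unfolding uniformly_continuous_on_def using \<epsilon> r by (metis divide_pos_pos mult_pos_pos zero_less_numeral)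
    show "\<exists>d>0. \<forall>lam'\<in>cball ls r. dist lam' lam < d \<longrightarrow> dist (deriv (W lam') 0) (deriv (W lam) 0) < \<epsilon>"
    proof (intro exI conjI ballI impI)
      fix lam' assume lam': "lam' \<in> cball ls r" "dist lam' lam < d"
      have sub: "cball 0 (r / 2) \<subseteq> ball (0::complex) r" "cball 0 (r / 2) \<subseteq> cball (0::complex) r" using r by auto
      have "norm ((deriv ^^ 1) (\<lambda>e. W lam' e - W lam e) 0) \<le> fact 1 * (\<epsilon> * r / 4) / (r / 2) ^ 1"
      proof (rule Cauchy_inequality)
        show "(\<lambda>e. W lam' e - W lam e) holomorphic_on ball 0 (r / 2)"
          by (intro holomorphic_intros holomorphic_on_subset[OF hol]) (use lam lam' r in auto)
        show "continuous_on (cball 0 (r / 2)) (\<lambda>e. W lam' e - W lam e)"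
          by (intro continuous_intros continuous_on_subset[OF contW]) (use lam lam' r in auto)
        show "norm (W lam' x - W lam x) \<le> \<epsilon> * r / 4" if "norm (0 - x) = r / 2" for x
        proof -
          have "dist (lam', x) (lam, x) < d" using lam' by (simp add: dist_prod_def)
          moreover have "x \<in> cball 0 r" using that r by simp
          ultimately show ?thesis using d(2)[of "(lam, x)" "(lam', x)"] lam lam' by (simp add: dist_norm)
        qed
      qed (use r in auto)
      also have "fact 1 * (\<epsilon> * r / 4) / (r / 2) ^ 1 = \<epsilon> / 2" using r by simp
      also have "(deriv ^^ 1) (\<lambda>e. W lam' e - W lam e) 0 = deriv (W lam') 0 - deriv (W lam) 0"
      proof -
        have "W lam' field_differentiable at 0" "W lam field_differentiable at 0"
          using hol[OF lam'(1)] hol[OF lam] r by (auto intro!: holomorphic_on_imp_differentiable_at[of _ "ball 0 r"])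
        then show ?thesis by simp
      qed
      finally show "dist (deriv (W lam') 0) (deriv (W lam) 0) < \<epsilon>" using \<epsilon> by (simp add: dist_norm)
    qed (use d in auto)
  qed
  show ?thesis
  proof (rule that[OF K(1)])
    show "norm (W lam e - W lam 0) \<le> K * norm e" if "lam \<in> cball ls r" "norm e \<le> r / 4" for lam e
      using lip[OF that, of 0] r by simp
  qed (use lip taylor contd in auto)
qed

text \<open>
  A substitute for joint holomorphy near \<open>(ls, 0)\<close>: it is stable under composition with
  \<open>tan_map\<close> and provides the two facts needed about the return map, its first-order expansion in \<open>e\<close> and the
  holomorphic dependence of its value at \<open>e = 0\<close> on the parameter.
\<close>

definition transversal_family :: "(complex \<Rightarrow> complex \<Rightarrow> complex) \<Rightarrow> complex \<Rightarrow> bool" where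
  "transversal_family F ls \<longleftrightarrow> (\<exists>\<delta>>0.
     continuous_on (ball ls \<delta> \<times> ball 0 \<delta>) (\<lambda>p. F (fst p) (snd p)) \<and>
     (\<forall>lam\<in>ball ls \<delta>. F lam holomorphic_on ball 0 \<delta>) \<and>
     (\<lambda>lam. F lam 0) holomorphic_on ball ls \<delta> \<and>
     (\<exists>D. (F ls has_field_derivative D) (at 0) \<and> D \<noteq> 0))"

lemma nonvanishing_near:
  fixes h :: "complex \<times> complex \<Rightarrow> complex"
  assumes \<delta>: "\<delta> > 0" and cont: "continuous_on (ball ls \<delta> \<times> ball 0 \<delta>) h" and nz: "h (ls, 0) \<noteq> 0"
  obtains \<delta>' where "\<delta>' > 0" "\<delta>' \<le> \<delta>" "\<And>lam e. \<lbrakk>lam \<in> ball ls \<delta>'; e \<in> ball 0 \<delta>'\<rbrakk> \<Longrightarrow> h (lam, e) \<noteq> 0"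
proof -
  have op: "open (ball ls \<delta> \<times> ball (0::complex) \<delta>)" by (intro open_Times open_ball)
  have "isCont h (ls, 0)" using cont \<delta> by (intro continuous_on_interior[OF cont]) (simp add: interior_open[OF op])
  then have "eventually (\<lambda>p. h p \<noteq> 0) (nhds (ls, 0))"
    using nz by (intro tendsto_imp_eventually_ne[where c = "h (ls, 0)"]) (auto simp: isCont_def tendsto_nhds_iff)
  then obtain S where S: "open S" "(ls, 0) \<in> S" "\<And>p. p \<in> S \<Longrightarrow> h p \<noteq> 0"
    by (auto simp: eventually_nhds)
  then obtain A B where AB: "open A" "open B" "ls \<in> A" "0 \<in> B" "A \<times> B \<subseteq> S"
    by (metis mem_Sigma_iff open_prod_elim)
  obtain a b where "a > 0" "ball ls a \<subseteq> A" "b > 0" "ball 0 b \<subseteq> B"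
    using AB openE by metis
  then show ?thesis
    using that[of "min \<delta> (min a b)"] \<delta> AB S by (force simp: subset_iff)
qed

lemma transversal_family_init:
  assumes ls: "ls \<noteq> 0"
  shows "transversal_family (\<lambda>lam e. lam * \<i> * (1 - e) / (1 + e)) ls"
  unfolding transversal_family_def
proof (rule exI[of _ 1], intro conjI ballI)
  have nz: "1 + e \<noteq> 0" if "e \<in> ball 0 1" for e :: complex
    using that by (auto simp: add_eq_0_iff)
  show "continuous_on (ball ls 1 \<times> ball 0 1) (\<lambda>p. fst p * \<i> * (1 - snd p) / (1 + snd p))"
    by (intro continuous_intros) (use nz in auto)
  show "(\<lambda>e. lam * \<i> * (1 - e) / (1 + e)) holomorphic_on ball 0 1" for lam
    by (intro holomorphic_intros) (use nz in auto)
  show "(\<lambda>lam. lam * \<i> * (1 - 0) / (1 + 0)) holomorphic_on ball ls 1" by (intro holomorphic_intros) auto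
  have "((\<lambda>e. ls * \<i> * (1 - e) / (1 + e)) has_field_derivative - 2 * ls * \<i>) (at 0)"
    by (auto intro!: derivative_eq_intros)
  then show "\<exists>D. ((\<lambda>e. ls * \<i> * (1 - e) / (1 + e)) has_field_derivative D) (at 0) \<and> D \<noteq> 0"
    using ls by (intro exI[of _ "- 2 * ls * \<i>"]) auto
qed auto

lemma transversal_family_compose:
  fixes G :: "complex \<Rightarrow> complex \<Rightarrow> complex" and N :: "complex \<Rightarrow> complex \<Rightarrow> complex"
  assumes F: "transversal_family F ls"
    and N: "continuous_on UNIV (\<lambda>p. N (fst p) (snd p))" "N ls (F ls 0) \<noteq> 0"
    and G: "continuous_on {p. N (fst p) (snd p) \<noteq> 0} (\<lambda>p. G (fst p) (snd p))"
    and Gw: "\<And>lam. G lam holomorphic_on {w. N lam w \<noteq> 0}"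
    and Gl: "\<And>g S. \<lbrakk>g holomorphic_on S; \<And>lam. lam \<in> S \<Longrightarrow> N lam (g lam) \<noteq> 0\<rbrakk> \<Longrightarrow> (\<lambda>lam. G lam (g lam)) holomorphic_on S"
    and D: "(G ls has_field_derivative D) (at (F ls 0))" "D \<noteq> 0"
  shows "transversal_family (\<lambda>lam e. G lam (F lam e)) ls"
proof -
  from F obtain \<delta> D' where \<delta>: "\<delta> > 0" and cF: "continuous_on (ball ls \<delta> \<times> ball 0 \<delta>) (\<lambda>p. F (fst p) (snd p))"
    and hF: "\<And>lam. lam \<in> ball ls \<delta> \<Longrightarrow> F lam holomorphic_on ball 0 \<delta>"
    and hF0: "(\<lambda>lam. F lam 0) holomorphic_on ball ls \<delta>"
    and D': "(F ls has_field_derivative D') (at 0)" "D' \<noteq> 0"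
    unfolding transversal_family_def by blast
  have "continuous_on (ball ls \<delta> \<times> ball 0 \<delta>) (\<lambda>p. (\<lambda>p. N (fst p) (snd p)) (fst p, F (fst p) (snd p)))"
    by (rule continuous_on_compose2[OF N(1)]) (auto intro!: continuous_intros cF)
  then have "continuous_on (ball ls \<delta> \<times> ball 0 \<delta>) (\<lambda>p. N (fst p) (F (fst p) (snd p)))" by simp
  from nonvanishing_near[OF \<delta> this] N(2) obtain \<delta>' where \<delta>': "\<delta>' > 0" "\<delta>' \<le> \<delta>"
    "\<And>lam e. \<lbrakk>lam \<in> ball ls \<delta>'; e \<in> ball 0 \<delta>'\<rbrakk> \<Longrightarrow> N lam (F lam e) \<noteq> 0" by auto
  show ?thesis
    unfolding transversal_family_def
  proof (rule exI[of _ \<delta>'], intro conjI ballI)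
    have "continuous_on (ball ls \<delta>' \<times> ball 0 \<delta>') (\<lambda>p. (\<lambda>p. G (fst p) (snd p)) (fst p, F (fst p) (snd p)))"
      by (rule continuous_on_compose2[OF G])
        (use \<delta>' in \<open>auto intro!: continuous_intros continuous_on_subset[OF cF]\<close>)
    then show "continuous_on (ball ls \<delta>' \<times> ball 0 \<delta>') (\<lambda>p. G (fst p) (F (fst p) (snd p)))" by simp
    show "(\<lambda>e. G lam (F lam e)) holomorphic_on ball 0 \<delta>'" if "lam \<in> ball ls \<delta>'" for lam
    proof -
      have "(G lam \<circ> F lam) holomorphic_on ball 0 \<delta>'"
        by (rule holomorphic_on_compose_gen[OF holomorphic_on_subset[OF hF] Gw]) (use \<delta>' that in auto)
      then show ?thesis by (simp add: o_def)
    qed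
    show "(\<lambda>lam. G lam (F lam 0)) holomorphic_on ball ls \<delta>'"
      by (rule Gl[OF holomorphic_on_subset[OF hF0]]) (use \<delta>' in auto)
    have "((\<lambda>e. G ls (F ls e)) has_field_derivative D * D') (at 0)"
      by (rule DERIV_chain2[OF D(1) D'(1)])
    then show "\<exists>D. ((\<lambda>e. G ls (F ls e)) has_field_derivative D) (at 0) \<and> D \<noteq> 0"
      using D(2) D'(2) by (intro exI[of _ "D * D'"]) auto
  qed (rule \<delta>'(1))
qed

lemma transversal_family_tan_map:
  assumes F: "transversal_family F ls" and "cos (F ls 0) \<noteq> 0" and ls: "ls \<noteq> 0"
  shows "transversal_family (\<lambda>lam e. tan_map lam (F lam e)) ls"
proof (rule transversal_family_compose[where N = "\<lambda>lam w. cos w", OF F])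
  show "continuous_on UNIV (\<lambda>p::complex \<times> complex. cos (snd p))" by (intro continuous_intros)
  show "continuous_on {p. cos (snd p) \<noteq> 0} (\<lambda>p. tan_map (fst p) (snd p))"
    unfolding tan_map_def tan_def by (intro continuous_intros) auto
  show "tan_map lam holomorphic_on {w. cos w \<noteq> 0}" for lam
    unfolding tan_map_def[abs_def] tan_def by (intro holomorphic_intros) auto
  show "(\<lambda>lam. tan_map lam (g lam)) holomorphic_on S"
    if "g holomorphic_on S" "\<And>lam. lam \<in> S \<Longrightarrow> cos (g lam) \<noteq> 0" for g S
    unfolding tan_map_def[abs_def] tan_def using that by (intro holomorphic_intros) auto
  show "(tan_map ls has_field_derivative ls * inverse (cos (F ls 0) ^ 2)) (at (F ls 0))"
    unfolding tan_map_def[abs_def] using assms by (intro DERIV_cmult DERIV_tan)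
qed (use assms in auto)

lemma transversal_family_cot:
  assumes F: "transversal_family F ls" and sin0: "sin (F ls 0) \<noteq> 0" and ls: "ls \<noteq> 0"
  shows "transversal_family (\<lambda>lam e. cos (F lam e) / (lam * sin (F lam e))) ls"
proof (rule transversal_family_compose[where N = "\<lambda>lam w. lam * sin w" and G = "\<lambda>lam w. cos w / (lam * sin w)", OF F])
  show "continuous_on UNIV (\<lambda>p::complex \<times> complex. fst p * sin (snd p))" by (intro continuous_intros)
  show "continuous_on {p. fst p * sin (snd p) \<noteq> 0} (\<lambda>p::complex \<times> complex. cos (snd p) / (fst p * sin (snd p)))"
    by (intro continuous_intros) auto
  show "(\<lambda>w. cos w / (lam * sin w)) holomorphic_on {w. lam * sin w \<noteq> 0}" for lam
    by (intro holomorphic_intros) auto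
  show "(\<lambda>lam. cos (g lam) / (lam * sin (g lam))) holomorphic_on S"
    if "g holomorphic_on S" "\<And>lam. lam \<in> S \<Longrightarrow> lam * sin (g lam) \<noteq> 0" for g S
    using that by (intro holomorphic_intros) auto
  define w where "w = F ls 0"
  have sw: "sin w \<noteq> 0" using sin0 by (simp add: w_def)
  have "((\<lambda>w. cos w / (ls * sin w)) has_field_derivative
      ((- sin w) * (ls * sin w) - cos w * (ls * cos w)) / ((ls * sin w) * (ls * sin w))) (at w)"
    using sw ls by (auto intro!: derivative_eq_intros)
  also have "((- sin w) * (ls * sin w) - cos w * (ls * cos w)) / ((ls * sin w) * (ls * sin w)) = - 1 / (ls * (sin w)\<^sup>2)"
  proof -
    have "(- sin w) * (ls * sin w) - cos w * (ls * cos w) = - ls * ((sin w)\<^sup>2 + (cos w)\<^sup>2)"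
      by algebra
    also have "\<dots> = - ls" by simp
    finally show ?thesis using ls sw by (simp add: power2_eq_square)
  qed
  finally show "((\<lambda>w. cos w / (ls * sin w)) has_field_derivative - 1 / (ls * (sin w)\<^sup>2)) (at (F ls 0))"
    by (simp add: w_def)
  show "- 1 / (ls * (sin w)\<^sup>2) \<noteq> 0" using sw ls by simp
qed (use assms in auto)

text \<open>
  The value of \<open>tan_map lam ^^ Suc r\<close> at a point with nome \<open>e\<close>, since
  \<open>tan w = \<i> (1 - e) / (1 + e)\<close>. At \<open>e = 0\<close>, the nome of the upper end of the plane, the orbit starts at the
  asymptotic value \<open>lam * \<i>\<close>.
\<close>

definition asymptotic_orbit :: "nat \<Rightarrow> complex \<Rightarrow> complex \<Rightarrow> complex" where
  "asymptotic_orbit r lam e = (tan_map lam ^^ r) (lam * \<i> * (1 - e) / (1 + e))"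

lemma transversal_asymptotic_orbit:
  assumes ls: "ls \<noteq> 0" and nz: "\<And>r'. r' < r \<Longrightarrow> cos ((tan_map ls ^^ r') (ls * \<i>)) \<noteq> 0"
  shows "transversal_family (asymptotic_orbit r) ls"
  using nz
proof (induction r)
  case 0
  then show ?case using transversal_family_init[OF ls] by (simp add: asymptotic_orbit_def)
next
  case (Suc r)
  have "transversal_family (\<lambda>lam e. tan_map lam (asymptotic_orbit r lam e)) ls"
    by (rule transversal_family_tan_map) (use Suc ls in \<open>auto simp: asymptotic_orbit_def\<close>)
  then show ?case by (simp add: asymptotic_orbit_def)
qed

section \<open>From a degenerating cycle to its return map\<close>

context escaping_cycle_path
begin

text \<open>
  The end of the plane, upper or lower, to which the first point of the block with number \<open>i\<close> tends.
\<close>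

definition block_side :: "nat \<Rightarrow> complex" where
  "block_side i = (SOME \<sigma>. (\<sigma> = 1 \<or> \<sigma> = -1) \<and>
     (\<forall>r<q. (z (Suc (i * Suc q) + r) \<longlongrightarrow> \<sigma> * crit r) at_top) \<and>
     filterlim (\<lambda>t. Im (\<sigma> * z (i * Suc q) t)) at_top at_top)"

lemma block_side: "block_side i = 1 \<or> block_side i = -1"
    "r < q \<Longrightarrow> (z (Suc (i * Suc q) + r) \<longlongrightarrow> block_side i * crit r) at_top"
    "filterlim (\<lambda>t. Im (block_side i * z (i * Suc q) t)) at_top at_top"
proof -
  have "\<exists>\<sigma>. (\<sigma> = 1 \<or> \<sigma> = -1) \<and>
     (\<forall>r<q. (z (Suc (i * Suc q) + r) \<longlongrightarrow> \<sigma> * crit r) at_top) \<and>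
     filterlim (\<lambda>t. Im (\<sigma> * z (i * Suc q) t)) at_top at_top"
    using excursion[OF block_start_infinite[of i]] by metis
  from someI_ex[OF this] show "block_side i = 1 \<or> block_side i = -1"
    "r < q \<Longrightarrow> (z (Suc (i * Suc q) + r) \<longlongrightarrow> block_side i * crit r) at_top"
    "filterlim (\<lambda>t. Im (block_side i * z (i * Suc q) t)) at_top at_top"
    unfolding block_side_def by blast+
qed

definition side :: "nat \<Rightarrow> complex" where "side i = block_side (i mod k)"

text \<open>
  The reduction of the block number modulo \<open>k\<close> makes the chain periodic for all \<open>t\<close>, whereas the orbit
  itself is periodic for positive \<open>t\<close> only.
\<close>

definition y :: "nat \<Rightarrow> real \<Rightarrow> complex" where
  "y i t = side i * z ((i mod k) * Suc q) t"

lemma side: "side i = 1 \<or> side i = -1" by (simp add: side_def block_side)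

lemma side_mult_self: "side i * side i = 1" using side[of i] by auto

lemma periodic_mult:
  assumes "t > 0"
  shows "z (j + m * n) t = z j t"
proof (induction m)
  case (Suc m)
  have "z (j + Suc m * n) t = z ((j + m * n) + n) t" by (simp add: algebra_simps)
  then show ?case using periodic[OF assms] Suc by simp
qed simp

lemma block_mod:
  assumes "t > 0"
  shows "z (i * Suc q) t = z ((i mod k) * Suc q) t"
proof -
  have "i * Suc q = (i mod k + (i div k) * k) * Suc q" by (simp only: mod_div_mult_eq)
  also have "\<dots> = (i mod k) * Suc q + (i div k) * (k * Suc q)" by (simp only: distrib_right mult.assoc)
  also have "\<dots> = (i mod k) * Suc q + (i div k) * n"
    using arg_cong[OF n_eq, of "\<lambda>m. (i mod k) * Suc q + (i div k) * m"] by (rule sym)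
  finally show ?thesis using periodic_mult[OF assms] by metis
qed

lemma y_eq: "t > 0 \<Longrightarrow> y i t = side i * z (i * Suc q) t"
  unfolding y_def by (subst block_mod[of t i]) auto

lemma y_periodic: "y (i + k) t = y i t" by (simp add: y_def side_def)

lemma Im_y_lim: "filterlim (\<lambda>t. Im (y i t)) at_top at_top"
  unfolding y_def side_def by (rule block_side(3))

lemma y_lim: "filterlim (y i) at_infinity at_top"
  by (rule filterlim_at_infinity_conv_norm_at_top[THEN iffD2])
    (rule filterlim_at_top_mono[OF Im_y_lim[of i]], auto intro!: always_eventually order_trans[OF abs_ge_self abs_Im_le_cmod])

lemma cos_y: "t > 0 \<Longrightarrow> cos (y i t) \<noteq> 0"
  using side[of i] no_pole[of t "(i mod k) * Suc q"] unfolding y_def by auto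

lemma z_asymptotic:
  assumes t: "t > 0"
  shows "z (Suc (i * Suc q) + r) t = side i * asymptotic_orbit r (lam t) (nome (y i t))"
proof (induction r)
  case 0
  have "z (i * Suc q) t = side i * y i t"
    unfolding y_eq[OF t] mult.assoc[symmetric] side_mult_self by simp
  then have "z (Suc (i * Suc q)) t = tan_map (lam t) (side i * y i t)" using step[OF t] by simp
  also have "\<dots> = side i * tan_map (lam t) (y i t)" using side[of i] by (auto simp: tan_map_def)
  also have "tan_map (lam t) (y i t) = asymptotic_orbit 0 (lam t) (nome (y i t))"
    unfolding tan_map_def asymptotic_orbit_def by (subst tan_eq_exp(2)[OF cos_y[OF t]]) (simp add: mult.assoc)
  finally show ?case by simp
next
  case (Suc r)
  have "z (Suc (i * Suc q) + Suc r) t = tan_map (lam t) (z (Suc (i * Suc q) + r) t)"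
    using step[OF t, of "Suc (i * Suc q) + r"] by simp
  also have "\<dots> = tan_map (lam t) (side i * asymptotic_orbit r (lam t) (nome (y i t)))" by (simp only: Suc)
  also have "\<dots> = side i * tan_map (lam t) (asymptotic_orbit r (lam t) (nome (y i t)))"
    using side[of i] by (auto simp: tan_map_def)
  finally show ?case by (simp add: asymptotic_orbit_def)
qed

text \<open>
  The reciprocal of the next escaping point as a function of the nome of the present one; it has a zero, and
  not a pole, at the limit.
\<close>

definition W :: "complex \<Rightarrow> complex \<Rightarrow> complex" where
  "W \<mu> e = cos (asymptotic_orbit (q - 1) \<mu> e) / (\<mu> * sin (asymptotic_orbit (q - 1) \<mu> e))"

lemma y_Suc:
  assumes t: "t > 0"
  shows "1 / y (Suc i) t = side (Suc i) * side i * W (lam t) (nome (y i t))"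
proof -
  define w where "w = asymptotic_orbit (q - 1) (lam t) (nome (y i t))"
  have "Suc (i * Suc q) + q = Suc i * Suc q" by simp
  then have "z (Suc i * Suc q) t = side i * asymptotic_orbit q (lam t) (nome (y i t))"
    using z_asymptotic[OF t, of i q] by (simp only:)
  also have "asymptotic_orbit q (lam t) (nome (y i t)) = tan_map (lam t) w"
  proof -
    have "q = Suc (q - 1)" using q_pos by simp
    then show ?thesis unfolding w_def asymptotic_orbit_def by (metis comp_apply funpow.simps(2))
  qed
  finally have "y (Suc i) t = side (Suc i) * side i * tan_map (lam t) w"
    unfolding y_eq[OF t] by (simp only: mult.assoc)
  moreover have "1 / (side (Suc i) * side i * tan_map (lam t) w) = side (Suc i) * side i * (cos w / (lam t * sin w))"
    using side[of i] side[of "Suc i"] by (auto simp: tan_map_def tan_def)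
  ultimately show ?thesis by (simp add: W_def w_def)
qed

lemma asymptotic_orbit_0: "asymptotic_orbit r ls 0 = crit r"
  by (simp add: asymptotic_orbit_def crit_def)

lemma W_zero: "W ls 0 = 0"
  using crit_pole by (simp add: W_def asymptotic_orbit_0)

lemma W_transversal: "transversal_family W ls"
proof -
  have "transversal_family (asymptotic_orbit (q - 1)) ls"
    by (rule transversal_asymptotic_orbit[OF ls]) (use crit_no_pole in \<open>auto simp: crit_def\<close>)
  moreover have "sin (asymptotic_orbit (q - 1) ls 0) \<noteq> 0"
    using crit_pole sin_cos_squared_add[of "crit (q - 1)"] by (auto simp: asymptotic_orbit_0)
  ultimately show ?thesis unfolding W_def[abs_def] by (rule transversal_family_cot[OF _ _ ls])
qed

lemma exp_y_lim: "((\<lambda>t. nome (y i t)) \<longlongrightarrow> 0) at_top"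
proof (rule tendstoI)
  fix \<epsilon> :: real assume \<epsilon>: "\<epsilon> > 0"
  have "eventually (\<lambda>t. Im (y i t) \<ge> 1 - ln \<epsilon> / 2) at_top" using Im_y_lim[of i] by (simp add: filterlim_at_top)
  then show "eventually (\<lambda>t. dist (nome (y i t)) 0 < \<epsilon>) at_top"
  proof (rule eventually_mono)
    fix t assume "Im (y i t) \<ge> 1 - ln \<epsilon> / 2"
    then have "exp (- 2 * Im (y i t)) < exp (ln \<epsilon>)" by (subst exp_less_cancel_iff) linarith
    then show "dist (nome (y i t)) 0 < \<epsilon>" using \<epsilon> by simp
  qed
qed

definition step_derivative :: "nat \<Rightarrow> real \<Rightarrow> complex" where
  "step_derivative j t = lam t * (1 + tan (z j t) ^ 2)"

text \<open>
  Within a block the first derivative is \<open>4 lam e / (1 + e)^2\<close>, the last one is \<open>(lam^2 + x^2) / lam\<close> with \<open>x\<close>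
  the next escaping point, and all others have finite nonzero limits.
\<close>

lemma block_factor_bound:
  "\<exists>\<kappa>>0. eventually (\<lambda>t. \<kappa> * (norm (nome (y i t)) * norm (y (Suc i) t) ^ 2) \<le>
      norm (\<Prod>r<Suc q. step_derivative (i * Suc q + r) t)) at_top"
proof -
  define P where "P t = (\<Prod>r\<in>{1..<q}. step_derivative (i * Suc q + r) t)" for t
  define P0 where "P0 = (\<Prod>r\<in>{1..<q}. ls * (1 + tan (block_side i * crit (r - 1)) ^ 2))"
  have P_lim: "(P \<longlongrightarrow> P0) at_top"
    unfolding P_def P0_def step_derivative_def
  proof (intro tendsto_prod tendsto_mult tendsto_add tendsto_const tendsto_power tendsto_tan_complex lam_lim)
    fix r assume r: "r \<in> {1..<q}"
    then have "r - 1 < q" "Suc (i * Suc q) + (r - 1) = i * Suc q + r" by auto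
    then show "(z (i * Suc q + r) \<longlongrightarrow> block_side i * crit (r - 1)) at_top" using block_side(2)[of "r - 1" i] by metis
    show "cos (block_side i * crit (r - 1)) \<noteq> 0" using crit_no_pole[of "r - 1"] r block_side(1)[of i] by auto
  qed
  have P0: "norm P0 > 0"
  proof -
    have "ls * (1 + tan (block_side i * crit (r - 1)) ^ 2) \<noteq> 0" if r: "r \<in> {1..<q}" for r
    proof -
      have "cos (block_side i * crit (r - 1)) \<noteq> 0" using crit_no_pole[of "r - 1"] r block_side(1)[of i] by auto
      then show ?thesis using ls one_plus_tan_squared by simp
    qed
    then show ?thesis unfolding P0_def by (simp add: prod_zero_iff)
  qed
  define l where "l = norm ls"
  have l: "l > 0" using ls by (simp add: l_def)
  have "eventually (\<lambda>t. norm (P t) > norm P0 / 2) at_top"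
    using tendsto_norm[OF P_lim] by (rule order_tendstoD) (use P0 in auto)
  moreover have "eventually (\<lambda>t. norm (lam t) > l / 2) at_top" "eventually (\<lambda>t. norm (lam t) < 2 * l) at_top"
    by (rule order_tendstoD[OF tendsto_norm[OF lam_lim, folded l_def]], use l in simp)+
  moreover have "eventually (\<lambda>t. dist (nome (y i t)) 0 < 1) at_top" using exp_y_lim by (rule tendstoD) simp
  moreover have "eventually (\<lambda>t. norm (y (Suc i) t) \<ge> 4 * l) at_top"
    using filterlim_at_infinity_imp_norm_at_top[OF y_lim[of "Suc i"]] by (simp add: filterlim_at_top)
  ultimately have "eventually (\<lambda>t. (l / 2) * (norm P0 / 2) * (1 / (4 * l)) * (norm (nome (y i t)) * norm (y (Suc i) t) ^ 2) \<le>
      norm (\<Prod>r<Suc q. step_derivative (i * Suc q + r) t)) at_top"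
    using eventually_gt_at_top[of 0]
  proof eventually_elim
    case (elim t)
    note t = elim(6)
    define e where "e = nome (y i t)"
    have e: "norm e < 1" using elim(4) by (simp add: e_def)
    have set: "{..<Suc q} = insert 0 (insert q {1..<q})" using q_pos by auto
    have prod: "(\<Prod>r<Suc q. step_derivative (i * Suc q + r) t) = step_derivative (i * Suc q) t * step_derivative (i * Suc q + q) t * P t"
      unfolding set using q_pos by (simp add: P_def mult.assoc)
    have f0: "norm (step_derivative (i * Suc q) t) \<ge> (l / 2) * norm e"
    proof -
      have ne: "1 + e \<noteq> 0" and T: "tan (y i t) = \<i> * (1 - e) / (1 + e)"
        unfolding e_def by (rule tan_eq_exp[OF cos_y[OF t, of i]])+
      have "tan (z (i * Suc q) t) ^ 2 = tan (y i t) ^ 2"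
        unfolding y_eq[OF t] using side[of i] by auto
      also have "\<dots> = - ((1 - e)\<^sup>2 / (1 + e)\<^sup>2)"
        unfolding T by (simp add: power_divide power_mult_distrib)
      finally have "1 + tan (z (i * Suc q) t) ^ 2 = ((1 + e)\<^sup>2 - (1 - e)\<^sup>2) / (1 + e)\<^sup>2"
        using ne by (simp add: diff_divide_distrib)
      also have "(1 + e)\<^sup>2 - (1 - e)\<^sup>2 = 4 * e" by (simp add: power2_eq_square algebra_simps)
      finally have "step_derivative (i * Suc q) t = lam t * (4 * e / (1 + e)\<^sup>2)" unfolding step_derivative_def by (rule arg_cong)
      then have "norm (step_derivative (i * Suc q) t) = norm (lam t) * (4 * norm e / (norm (1 + e))\<^sup>2)"
        by (simp only: norm_mult norm_divide norm_power norm_numeral)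
      moreover have "4 * norm e / 2\<^sup>2 \<le> 4 * norm e / (norm (1 + e))\<^sup>2"
      proof (rule divide_left_mono)
        have "norm (1 + e) \<le> 2" using e norm_triangle_ineq[of 1 e] by simp
        then show "(norm (1 + e))\<^sup>2 \<le> 2\<^sup>2" by (intro power_mono) auto
        have "1 + e \<noteq> 0" using tan_eq_exp(1)[OF cos_y[OF t, of i]] by (simp add: e_def)
        then show "0 < 2\<^sup>2 * (norm (1 + e))\<^sup>2" by simp
      qed auto
      then have "norm e \<le> 4 * norm e / (norm (1 + e))\<^sup>2" by simp
      then have "norm (lam t) * norm e \<le> norm (lam t) * (4 * norm e / (norm (1 + e))\<^sup>2)"
        by (rule mult_left_mono) simp
      ultimately have "norm (step_derivative (i * Suc q) t) \<ge> norm (lam t) * norm e" by simp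
      moreover have "(l / 2) * norm e \<le> norm (lam t) * norm e" using elim(2) by (intro mult_right_mono) auto
      ultimately show ?thesis by linarith
    qed
    have fq: "norm (step_derivative (i * Suc q + q) t) \<ge> 1 / (4 * l) * norm (y (Suc i) t) ^ 2"
    proof -
      define v where "v = norm (y (Suc i) t)"
      have "Suc (i * Suc q + q) = Suc i * Suc q" by simp
      then have zq: "z (Suc i * Suc q) t = lam t * tan (z (i * Suc q + q) t)"
        using step[OF t, of "i * Suc q + q"] unfolding tan_map_def by metis
      have v: "v = norm (z (Suc i * Suc q) t)"
        unfolding v_def y_eq[OF t] using side[of "Suc i"] by (auto simp: norm_mult)
      have "step_derivative (i * Suc q + q) t = (lam t ^ 2 + z (Suc i * Suc q) t ^ 2) / lam t"
        unfolding zq step_derivative_def using lam_nz[OF t] by (simp add: field_simps power2_eq_square)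
      then have "norm (step_derivative (i * Suc q + q) t) = norm (lam t ^ 2 + z (Suc i * Suc q) t ^ 2) / norm (lam t)"
        by (simp add: norm_divide)
      also have "\<dots> \<ge> (v\<^sup>2 / 2) / (2 * l)"
      proof (rule frac_le)
        have "norm (lam t) \<le> v / 2" using elim(3,5) by (simp add: v_def)
        then have "norm (lam t) ^ 2 \<le> (v / 2)\<^sup>2" by (intro power_mono) auto
        moreover have "norm (lam t ^ 2 + z (Suc i * Suc q) t ^ 2) \<ge> v\<^sup>2 - norm (lam t) ^ 2"
          using norm_diff_ineq[of "z (Suc i * Suc q) t ^ 2" "lam t ^ 2"] by (simp add: v norm_power add.commute)
        moreover have "(v / 2)\<^sup>2 \<le> v\<^sup>2 / 2" by (simp add: power_divide)
        ultimately show "v\<^sup>2 / 2 \<le> norm (lam t ^ 2 + z (Suc i * Suc q) t ^ 2)" by linarith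
      qed (use elim lam_nz[OF t] in auto)
      finally show ?thesis by (simp add: v_def)
    qed
    have "(l / 2 * norm e) * (1 / (4 * l) * norm (y (Suc i) t) ^ 2) * (norm P0 / 2) \<le>
        norm (step_derivative (i * Suc q) t) * norm (step_derivative (i * Suc q + q) t) * norm (P t)"
      using f0 fq elim(1) l P0 by (intro mult_mono) auto
    then show ?case unfolding prod norm_mult e_def[symmetric] by (simp only: mult_ac)
  qed
  moreover have "(l / 2) * (norm P0 / 2) * (1 / (4 * l)) > 0" using l P0 by simp
  ultimately show ?thesis by blast
qed

lemma multiplier_lower_bound:
  obtains \<kappa> where "\<kappa> > 0" "eventually (\<lambda>t. \<kappa> * (\<Prod>i<k. norm (nome (y i t)) * norm (y (Suc i) t) ^ 2) \<le>
      norm (\<Prod>j<n. lam t * (1 + tan (z j t) ^ 2))) at_top"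
proof -
  have "\<forall>i. \<exists>\<kappa>. \<kappa> > 0 \<and> eventually (\<lambda>t. \<kappa> * (norm (nome (y i t)) * norm (y (Suc i) t) ^ 2) \<le>
      norm (\<Prod>r<Suc q. step_derivative (i * Suc q + r) t)) at_top"
    using block_factor_bound by blast
  then have "\<exists>\<kappa>. \<forall>i. \<kappa> i > 0 \<and> eventually (\<lambda>t. \<kappa> i * (norm (nome (y i t)) * norm (y (Suc i) t) ^ 2) \<le>
      norm (\<Prod>r<Suc q. step_derivative (i * Suc q + r) t)) at_top"
    by (rule choice)
  then obtain \<kappa> :: "nat \<Rightarrow> real" where \<kappa>: "\<And>i. \<kappa> i > 0"
    "\<And>i. eventually (\<lambda>t. \<kappa> i * (norm (nome (y i t)) * norm (y (Suc i) t) ^ 2) \<le>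
      norm (\<Prod>r<Suc q. step_derivative (i * Suc q + r) t)) at_top" by blast
  have ev: "eventually (\<lambda>t. \<forall>i\<in>{..<k}. \<kappa> i * (norm (nome (y i t)) * norm (y (Suc i) t) ^ 2) \<le>
      norm (\<Prod>r<Suc q. step_derivative (i * Suc q + r) t)) at_top"
    by (intro eventually_ball_finite ballI \<kappa>(2)) simp
  have block: "(\<Prod>j\<in>{a..<a + m}. f j) = (\<Prod>r<m. f (a + r))" for a m and f :: "nat \<Rightarrow> complex"
    by (induction m) (auto simp: mult.commute)
  from ev have "eventually (\<lambda>t. (\<Prod>i<k. \<kappa> i) * (\<Prod>i<k. norm (nome (y i t)) * norm (y (Suc i) t) ^ 2) \<le>
      norm (\<Prod>j<n. lam t * (1 + tan (z j t) ^ 2))) at_top"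
  proof (rule eventually_mono)
    fix t assume *: "\<forall>i\<in>{..<k}. \<kappa> i * (norm (nome (y i t)) * norm (y (Suc i) t) ^ 2) \<le>
      norm (\<Prod>r<Suc q. step_derivative (i * Suc q + r) t)"
    have "(\<Prod>j<n. lam t * (1 + tan (z j t) ^ 2)) = (\<Prod>j<k * Suc q. step_derivative j t)"
      unfolding step_derivative_def by (rule arg_cong[OF n_eq, of "\<lambda>m. \<Prod>j<m. lam t * (1 + tan (z j t) ^ 2)"])
    also have "\<dots> = (\<Prod>i<k. \<Prod>j\<in>{i * Suc q..<i * Suc q + Suc q}. step_derivative j t)"
      by (rule prod.nat_group[symmetric])
    also have "\<dots> = (\<Prod>i<k. \<Prod>r<Suc q. step_derivative (i * Suc q + r) t)"
      by (rule prod.cong[OF refl]) (rule block)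
    finally have eq: "(\<Prod>j<n. lam t * (1 + tan (z j t) ^ 2)) = (\<Prod>i<k. \<Prod>r<Suc q. step_derivative (i * Suc q + r) t)" .
    have "(\<Prod>i<k. \<kappa> i * (norm (nome (y i t)) * norm (y (Suc i) t) ^ 2)) \<le>
       (\<Prod>i<k. norm (\<Prod>r<Suc q. step_derivative (i * Suc q + r) t))"
    proof (rule prod_mono)
      fix i assume "i \<in> {..<k}"
      then show "0 \<le> \<kappa> i * (norm (nome (y i t)) * norm (y (Suc i) t) ^ 2) \<and>
          \<kappa> i * (norm (nome (y i t)) * norm (y (Suc i) t) ^ 2) \<le> norm (\<Prod>r<Suc q. step_derivative (i * Suc q + r) t)"
        using * less_imp_le[OF \<kappa>(1)[of i]] by (intro conjI mult_nonneg_nonneg) auto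
    qed
    then show "(\<Prod>i<k. \<kappa> i) * (\<Prod>i<k. norm (nome (y i t)) * norm (y (Suc i) t) ^ 2) \<le>
      norm (\<Prod>j<n. lam t * (1 + tan (z j t) ^ 2))"
      unfolding eq prod_norm by (simp add: prod.distrib)
  qed
  moreover have "(\<Prod>i<k. \<kappa> i) > 0" using \<kappa>(1) by (intro prod_pos) auto
  ultimately show ?thesis using that by blast
qed

end

context escaping_cycle_path
begin

lemma eventually_lam_ne: "eventually (\<lambda>t. lam t \<noteq> ls) at_top"
  using flat[of 1] eventually_gt_at_top[of 0]
proof eventually_elim
  case (elim t)
  have "(\<Prod>j<n. lam t * (1 + tan (z j t) ^ 2)) \<noteq> 0"
    using lam_nz[OF elim(2)] no_pole[OF elim(2)] by (simp add: one_plus_tan_squared)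
  then show ?case using elim(1) by auto
qed

text \<open>
  The reciprocal return map is expanded at the nome \<open>0\<close>, and \<open>A\<close> is the inverse of its constant term.
  This term is a holomorphic function of the parameter with a zero at \<open>ls\<close>, hence bounded below by a power of
  the distance to \<open>ls\<close>. If no point of the chain were as high as \<open>exponential_return\<close> demands, the
  multiplier would be bounded below by another such power, contrary to its flatness.
\<close>

lemma return_relation:
  obtains t where "t > 0" "\<And>i. y (Suc i) t = y i t"
proof -
  from W_transversal obtain \<rho> where \<rho>: "\<rho> > 0"
    and contW: "continuous_on (ball ls \<rho> \<times> ball 0 \<rho>) (\<lambda>p. W (fst p) (snd p))"
    and holW: "\<And>\<mu>. \<mu> \<in> ball ls \<rho> \<Longrightarrow> W \<mu> holomorphic_on ball 0 \<rho>"
    and holb: "(\<lambda>\<mu>. W \<mu> 0) holomorphic_on ball ls \<rho>"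
    and derW: "\<exists>D. (W ls has_field_derivative D) (at 0) \<and> D \<noteq> 0"
    unfolding transversal_family_def by blast
  define r where "r = \<rho> / 2"
  have r: "r > 0" "cball ls r \<subseteq> ball ls \<rho>" "cball 0 r \<subseteq> ball (0::complex) \<rho>" using \<rho> by (auto simp: r_def)
  have cW: "continuous_on (cball ls r \<times> cball 0 r) (\<lambda>p. W (fst p) (snd p))"
    by (rule continuous_on_subset[OF contW]) (use r in blast)
  have hW: "W \<mu> holomorphic_on ball 0 r" if "\<mu> \<in> cball ls r" for \<mu>
    by (rule holomorphic_on_subset[OF holW]) (use r that ball_subset_cball in blast)+
  obtain K where K: "K \<ge> 1"
    and K0: "\<And>\<mu> e. \<lbrakk>\<mu> \<in> cball ls r; norm e \<le> r / 4\<rbrakk> \<Longrightarrow> norm (W \<mu> e - W \<mu> 0) \<le> K * norm e"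
    and K1: "\<And>\<mu> e. \<lbrakk>\<mu> \<in> cball ls r; norm e \<le> r / 4\<rbrakk> \<Longrightarrow> norm (W \<mu> e - W \<mu> 0 - deriv (W \<mu>) 0 * e) \<le> K * (norm e)\<^sup>2"
    and K2: "\<And>\<mu> e e'. \<lbrakk>\<mu> \<in> cball ls r; norm e \<le> r / 4; norm e' \<le> r / 4\<rbrakk> \<Longrightarrow> norm (W \<mu> e - W \<mu> e') \<le> K * norm (e - e')"
    and contD: "continuous_on (cball ls r) (\<lambda>\<mu>. deriv (W \<mu>) 0)"
    by (rule second_order_expansion[OF r(1) cW hW]) blast+
  define b where "b t = W (lam t) 0" for t
  define \<beta> where "\<beta> t = deriv (W (lam t)) 0" for t
  define \<beta>side where "\<beta>side = deriv (W ls) 0"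
  have \<beta>side: "\<beta>side \<noteq> 0" using derW DERIV_imp_deriv unfolding \<beta>side_def by blast
  have lam_near: "eventually (\<lambda>t. lam t \<in> cball ls r) at_top"
    using tendstoD[OF lam_lim r(1)] by (rule eventually_mono) (simp add: dist_commute)
  have e_near: "eventually (\<lambda>t. \<forall>i\<in>{..<k}. norm (nome (y i t)) \<le> r / 4) at_top"
  proof (intro eventually_ball_finite ballI)
    fix i
    show "eventually (\<lambda>t. norm (nome (y i t)) \<le> r / 4) at_top"
      using tendstoD[OF exp_y_lim[of i], of "r / 4"] r(1) by (auto elim!: eventually_mono)
  qed simp
  obtain \<kappa> where \<kappa>: "\<kappa> > 0" "eventually (\<lambda>t. \<kappa> * (\<Prod>i<k. norm (nome (y i t)) * norm (y (Suc i) t) ^ 2) \<le>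
      norm (\<Prod>j<n. lam t * (1 + tan (z j t) ^ 2))) at_top"
    by (rule multiplier_lower_bound)
  have y_large: "eventually (\<lambda>t. \<forall>i\<in>{..<k}. norm (y (Suc i) t) \<ge> K) at_top"
  proof (intro eventually_ball_finite ballI)
    fix i show "eventually (\<lambda>t. norm (y (Suc i) t) \<ge> K) at_top"
      using filterlim_at_infinity_imp_norm_at_top[OF y_lim[of "Suc i"]] by (simp add: filterlim_at_top)
  qed simp
  have mult_small: "eventually (\<lambda>t. norm (\<Prod>j<n. lam t * (1 + tan (z j t) ^ 2)) < \<kappa>) at_top"
    using tendstoD[OF multiplier_lim \<kappa>(1)] by simp
  \<comment> \<open>Were the unperturbed term identically zero, each escaping point would be at least of the
    order of the inverse of the preceding nome, and the multiplier would not tend to zero.\<close>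
  have nonconst: "\<not> (\<lambda>\<mu>. W \<mu> 0) constant_on ball ls \<rho>"
  proof
    assume "(\<lambda>\<mu>. W \<mu> 0) constant_on ball ls \<rho>"
    then have zero: "W \<mu> 0 = 0" if "\<mu> \<in> ball ls \<rho>" for \<mu>
      using W_zero that \<rho> unfolding constant_on_def by (metis centre_in_ball)
    have "eventually (\<lambda>t. lam t \<in> cball ls r \<and> (\<forall>i\<in>{..<k}. norm (nome (y i t)) \<le> r / 4) \<and>
        (\<forall>i\<in>{..<k}. norm (y (Suc i) t) \<ge> K) \<and> norm (\<Prod>j<n. lam t * (1 + tan (z j t) ^ 2)) < \<kappa> \<and>
        \<kappa> * (\<Prod>i<k. norm (nome (y i t)) * norm (y (Suc i) t) ^ 2) \<le>
          norm (\<Prod>j<n. lam t * (1 + tan (z j t) ^ 2)) \<and> t > 0) at_top"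
      by (intro eventually_conj lam_near e_near y_large mult_small \<kappa>(2) eventually_gt_at_top)
    then obtain t where elim: "lam t \<in> cball ls r" "\<forall>i\<in>{..<k}. norm (nome (y i t)) \<le> r / 4"
        "\<forall>i\<in>{..<k}. norm (y (Suc i) t) \<ge> K" "norm (\<Prod>j<n. lam t * (1 + tan (z j t) ^ 2)) < \<kappa>"
        "\<kappa> * (\<Prod>i<k. norm (nome (y i t)) * norm (y (Suc i) t) ^ 2) \<le>
          norm (\<Prod>j<n. lam t * (1 + tan (z j t) ^ 2))" "t > 0"
      by (blast dest: eventually_happens'[OF trivial_limit_at_top_linorder])
    show False
    proof -
      have "(\<Prod>i<k. norm (nome (y i t)) * norm (y (Suc i) t) ^ 2) \<ge> (\<Prod>i<k. 1)"
      proof (rule prod_mono)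
        fix i assume i: "i \<in> {..<k}"
        define e where "e = nome (y i t)"
        have yl: "norm (y (Suc i) t) \<ge> K" using elim(3) i by blast
        have "1 / norm (y (Suc i) t) = norm (1 / y (Suc i) t)" by (simp add: norm_divide)
        also have "\<dots> = norm (W (lam t) e)"
          unfolding y_Suc[OF elim(6)] e_def norm_mult using side[of i] side[of "Suc i"] by auto
        also have "\<dots> = norm (W (lam t) e - W (lam t) 0)" using zero[of "lam t"] elim(1) r(2) by auto
        also have "\<dots> \<le> K * norm e" by (rule K0) (use elim i in \<open>auto simp: e_def\<close>)
        finally have "1 / norm (y (Suc i) t) \<le> K * norm e" .
        moreover have "norm (y (Suc i) t) > 0" using yl K by linarith
        ultimately have "1 \<le> K * norm e * norm (y (Suc i) t)" by (simp only: pos_divide_le_eq)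
        also have "\<dots> \<le> norm (y (Suc i) t) * norm e * norm (y (Suc i) t)"
          using yl by (intro mult_right_mono) auto
        finally show "0 \<le> (1::real) \<and> 1 \<le> norm (nome (y i t)) * norm (y (Suc i) t) ^ 2"
          unfolding e_def power2_eq_square by (simp only: mult_ac zero_le_one simp_thms)
      qed
      then have "\<kappa> * 1 \<le> \<kappa> * (\<Prod>i<k. norm (nome (y i t)) * norm (y (Suc i) t) ^ 2)"
        using \<kappa>(1) by (intro mult_left_mono) auto
      then show ?thesis using elim(4,5) by linarith
    qed
  qed
  obtain g r1 d where d: "0 < d" "0 < r1" "ball ls r1 \<subseteq> ball ls \<rho>" "g holomorphic_on ball ls r1"
      "\<And>w. w \<in> ball ls r1 \<Longrightarrow> W w 0 = (w - ls) ^ d * g w" "\<And>w. w \<in> ball ls r1 \<Longrightarrow> g w \<noteq> 0"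
    by (rule holomorphic_factor_zero_nonconstant[OF holb open_ball connected_ball _ W_zero nonconst])
      (use \<rho> in \<open>simp, blast\<close>)
  have lam_near1: "eventually (\<lambda>t. lam t \<in> ball ls r1) at_top"
    using tendstoD[OF lam_lim d(2)] by (rule eventually_mono) (simp add: dist_commute)
  have b_nz: "eventually (\<lambda>t. b t \<noteq> 0) at_top"
    using lam_near1 eventually_lam_ne by eventually_elim (simp add: b_def d)
  define \<gamma> where "\<gamma> = norm (g ls) / 2"
  have \<gamma>: "\<gamma> > 0" using d by (simp add: \<gamma>_def)
  have g_lim: "((\<lambda>t. g (lam t)) \<longlongrightarrow> g ls) at_top"
  proof (rule isCont_tendsto_compose[OF _ lam_lim])
    show "isCont g ls" using d(2,4) by (intro continuous_on_interior[OF holomorphic_on_imp_continuous_on[OF d(4)]]) auto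
  qed
  have b_lower: "eventually (\<lambda>t. norm (b t) \<ge> norm (lam t - ls) ^ d * \<gamma>) at_top"
  proof -
    have "eventually (\<lambda>t. norm (g (lam t)) > \<gamma>) at_top"
      by (rule order_tendstoD[OF tendsto_norm[OF g_lim]]) (use \<gamma> in \<open>auto simp: \<gamma>_def\<close>)
    then show ?thesis using lam_near1
      by eventually_elim (auto simp: b_def d norm_mult norm_power intro!: mult_left_mono)
  qed
  define A where "A t = 1 / b t" for t
  have flat_e: "eventually (\<lambda>t. \<exists>i. norm (nome (y i t)) * norm (A t) ^ 3 \<le> 1) at_top"
  proof -
    \<comment> \<open>If every nome exceeded \<open>|b|^3\<close>, the multiplier would be at least of the order of
      \<open>|lam - ls|^(3 d k)\<close>; one more power of flatness contradicts this.\<close>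
    define N where "N = 3 * d * k + 1"
    have "((\<lambda>t. norm (lam t - ls)) \<longlongrightarrow> 0) at_top" using tendsto_norm_zero[OF LIM_zero[OF lam_lim]] .
    then have small: "eventually (\<lambda>t. norm (lam t - ls) < \<kappa> * (\<gamma> ^ 3) ^ k) at_top"
      by (rule order_tendstoD) (use \<kappa> \<gamma> in auto)
    show ?thesis
      using small flat[of N] \<kappa>(2) b_lower b_nz y_large eventually_lam_ne
    proof eventually_elim
      case (elim t)
      show ?case
      proof (rule ccontr)
        assume "\<nexists>i. norm (nome (y i t)) * norm (A t) ^ 3 \<le> 1"
        then have big: "norm (nome (y i t)) * norm (A t) ^ 3 > 1" for i by (meson not_le)
        define u where "u = norm (lam t - ls)"
        have u: "u > 0" using elim(7) by (simp add: u_def)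
        have eb: "norm (nome (y i t)) \<ge> norm (b t) ^ 3" for i
          using big[of i] elim(5) unfolding A_def norm_divide norm_one power_divide power_one
          by (simp add: pos_less_divide_eq less_imp_le del: norm_exp_eq_Re)
        have "(\<Prod>i<k. norm (nome (y i t)) * norm (y (Suc i) t) ^ 2) \<ge> (\<Prod>i<k. (u ^ d * \<gamma>) ^ 3)"
        proof (rule prod_mono)
          fix i assume i: "i \<in> {..<k}"
          have "(u ^ d * \<gamma>) ^ 3 \<le> norm (b t) ^ 3"
            using elim(4) u \<gamma> by (intro power_mono) (auto simp: u_def)
          also have "\<dots> \<le> norm (nome (y i t))" by (rule eb)
          also have "\<dots> = norm (nome (y i t)) * 1" by simp
          also have "\<dots> \<le> norm (nome (y i t)) * norm (y (Suc i) t) ^ 2"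
          proof (rule mult_left_mono)
            have "norm (y (Suc i) t) \<ge> 1" using elim(6) i K by force
            then show "1 \<le> norm (y (Suc i) t) ^ 2" by (rule one_le_power)
          qed simp
          finally show "0 \<le> (u ^ d * \<gamma>) ^ 3 \<and> (u ^ d * \<gamma>) ^ 3 \<le> norm (nome (y i t)) * norm (y (Suc i) t) ^ 2"
            using u \<gamma> by simp
        qed
        then have "\<kappa> * ((u ^ d * \<gamma>) ^ 3) ^ k \<le> \<kappa> * (\<Prod>i<k. norm (nome (y i t)) * norm (y (Suc i) t) ^ 2)"
          using \<kappa>(1) by (intro mult_left_mono) auto
        also have "\<dots> \<le> norm (\<Prod>j<n. lam t * (1 + tan (z j t) ^ 2))" by (rule elim(3))
        also have "\<dots> \<le> u ^ N" unfolding u_def by (rule elim(2))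
        also have "u ^ N = u ^ (3 * d * k) * u" by (simp add: N_def)
        also have "\<kappa> * ((u ^ d * \<gamma>) ^ 3) ^ k = u ^ (3 * d * k) * (\<kappa> * (\<gamma> ^ 3) ^ k)"
          by (simp add: power_mult_distrib power_mult[symmetric] mult_ac)
        finally have "\<kappa> * (\<gamma> ^ 3) ^ k \<le> u" using u by simp
        then show False using elim(1) by (simp add: u_def)
      qed
    qed
  qed
  have Im_y_pos: "eventually (\<lambda>t. \<forall>i\<in>{..<k}. Im (y i t) > 0) at_top"
    by (intro eventually_ball_finite ballI) (use Im_y_lim in \<open>auto simp: filterlim_at_top_dense\<close>)
  have "eventually (\<lambda>t. t > 0 \<and> lam t \<in> cball ls r \<and> (\<forall>i\<in>{..<k}. Im (y i t) > 0) \<and> b t \<noteq> 0 \<and>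
      (\<exists>i. norm (nome (y i t)) * norm (A t) ^ 3 \<le> 1)) at_top"
    by (intro eventually_conj eventually_gt_at_top lam_near Im_y_pos b_nz flat_e)
  then obtain T where T: "\<And>t. t \<ge> T \<Longrightarrow> t > 0 \<and> lam t \<in> cball ls r \<and> (\<forall>i\<in>{..<k}. Im (y i t) > 0) \<and> b t \<noteq> 0 \<and>
      (\<exists>i. norm (nome (y i t)) * norm (A t) ^ 3 \<le> 1)"
    unfolding eventually_at_top_linorder by blast
  have sub: "{T..} \<subseteq> {0<..}" using T by auto
  have clam: "continuous_on {T..} lam" using cont_lam sub continuous_on_subset by blast
  have cb: "continuous_on {T..} b"
    unfolding b_def
  proof (rule continuous_on_compose2[OF _ clam])
    show "continuous_on (cball ls r) (\<lambda>\<mu>. W \<mu> 0)"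
      using holomorphic_on_imp_continuous_on[OF holb] r(2) continuous_on_subset by blast
  qed (use T in auto)
  have b_lim: "(b \<longlongrightarrow> 0) at_top"
    unfolding b_def
  proof -
    have "isCont (\<lambda>\<mu>. W \<mu> 0) ls"
      using \<rho> by (intro continuous_on_interior[OF holomorphic_on_imp_continuous_on[OF holb]]) auto
    from isCont_tendsto_compose[OF this lam_lim] show "((\<lambda>t. W (lam t) 0) \<longlongrightarrow> 0) at_top" by (simp add: W_zero)
  qed
  interpret exponential_return y A \<beta> "\<lambda>i. side (Suc i) * side i" "\<lambda>t e. W (lam t) e - W (lam t) 0" K "r / 4" T \<beta>side k
  proof
    show "continuous_on {T..} (y i)" for i
      unfolding y_def by (intro continuous_intros continuous_on_subset[OF cont_z sub])
    show "continuous_on {T..} A" unfolding A_def by (intro continuous_intros cb) (use T in auto)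
    show "continuous_on {T..} \<beta>"
      unfolding \<beta>_def by (rule continuous_on_compose2[OF contD clam]) (use T in auto)
    show "1 \<le> k" by (rule k_pos)
    show "y (i + k) t = y i t" for i t by (rule y_periodic)
    show "0 < Im (y i t)" if "T \<le> t" for i t
    proof -
      have "y i t = y (i mod k) t" by (simp add: y_def side_def)
      moreover have "i mod k < k" using k_pos by simp
      ultimately show ?thesis using T[OF that] by auto
    qed
    show "filterlim (\<lambda>t. Im (y i t)) at_top at_top" for i by (rule Im_y_lim)
    show "filterlim A at_infinity at_top"
    proof -
      have "filterlim b (at 0) at_top" unfolding filterlim_at using b_lim b_nz by auto
      from filterlim_compose[OF filterlim_inverse_at_infinity this]
      show ?thesis unfolding A_def by (simp add: inverse_eq_divide)
    qed
    show "A t \<noteq> 0" if "T \<le> t" for t using T[OF that] by (simp add: A_def)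
    show "(\<beta> \<longlongrightarrow> \<beta>side) at_top"
    proof -
      have "isCont (\<lambda>\<mu>. deriv (W \<mu>) 0) ls" using r(1) by (intro continuous_on_interior[OF contD]) auto
      from isCont_tendsto_compose[OF this lam_lim] show ?thesis by (simp add: \<beta>_def[abs_def] \<beta>side_def)
    qed
    show "\<beta>side \<noteq> 0" by (rule \<beta>side)
    show "side (Suc i) * side i = 1 \<or> side (Suc i) * side i = -1" for i using side[of i] side[of "Suc i"] by auto
    show "1 \<le> K" by (rule K)
    show "0 < r / 4" using r by simp
    show "norm (W (lam t) e - W (lam t) 0) \<le> K * norm e" if "T \<le> t" "norm e \<le> r / 4" for t e
      by (rule K0) (use T that in auto)
    show "norm (W (lam t) e - W (lam t) 0 - \<beta> t * e) \<le> K * (norm e)\<^sup>2" if "T \<le> t" "norm e \<le> r / 4" for t e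
      unfolding \<beta>_def by (rule K1) (use T that in auto)
    show "norm (W (lam t) e - W (lam t) 0 - (W (lam t) e' - W (lam t) 0)) \<le> K * norm (e - e')"
      if "T \<le> t" "norm e \<le> r / 4" "norm e' \<le> r / 4" for t e e'
      using K2[of "lam t" e e'] T[OF that(1)] that by simp
    show "1 / y (Suc i) t = side (Suc i) * side i * (1 / A t + (W (lam t) (nome (y i t)) - W (lam t) 0))" if "T \<le> t" for i t
      using y_Suc[of t i] T[OF that] by (simp add: A_def b_def)
    show "\<exists>i. norm (nome (y i t)) * norm (A t) ^ 3 \<le> 1" if "T \<le> t" for t using T[OF that] by blast
  qed
  obtain t where "t \<ge> T" "\<And>i. y (Suc i) t = y i t" using constant_orbit by blast
  then show ?thesis using that T by blast
qed

theorem half_cycle_closes: "\<exists>t>0. z (Suc q) t = z 0 t \<or> z (Suc q) t = - z 0 t"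
proof -
  obtain t where t: "t > 0" "\<And>i. y (Suc i) t = y i t" using return_relation by blast
  have "side 1 * z (1 * Suc q) t = side 0 * z (0 * Suc q) t" using t(2)[of 0] unfolding y_eq[OF t(1)] by simp
  then have "z (Suc q) t = z 0 t \<or> z (Suc q) t = - z 0 t" using side[of 0] side[of 1] by (auto dest: arg_cong[where f = uminus])
  then show ?thesis using t(1) by blast
qed

end

section \<open>Decay of the multiplier along an internal ray\<close>

text \<open>
  Let \<open>L\<close> be a logarithm of \<open>g - c\<close>. As \<open>g\<close> is injective, the image of \<open>L\<close> contains no two points that differ by
  \<open>2 pi i\<close>, hence no disc of radius greater than \<open>pi\<close>. Bloch's theorem on the disc about \<open>w\<close> of radius \<open>Im w\<close> gives
  \<open>Im w |L' w| \<le> 12 pi < 38\<close>, and integration along the imaginary axis gives the power of \<open>t\<close>.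
\<close>

lemma univalent_omitted_value_growth:
  fixes g :: "complex \<Rightarrow> complex"
  assumes hol: "g holomorphic_on {w. Im w > 0}" and inj: "inj_on g {w. Im w > 0}"
    and omit: "c \<notin> g ` {w. Im w > 0}"
  obtains \<kappa> where "\<kappa> > 0" "\<And>t. t \<ge> 1 \<Longrightarrow> \<kappa> \<le> norm (g (\<i> * of_real t) - c) * t ^ 38"
proof -
  define H where "H = {w::complex. Im w > 0}"
  have H: "open H" "convex H" by (auto simp: H_def open_halfspace_Im_gt convex_halfspace_Im_gt)
  have sc: "simply_connected H" by (rule convex_imp_simply_connected[OF H(2)])
  have nz: "g w - c \<noteq> 0" if "w \<in> H" for w using omit that by (auto simp: H_def)
  have holc: "(\<lambda>w. g w - c) holomorphic_on H" using hol unfolding H_def by (intro holomorphic_intros)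
  have "\<forall>f. f holomorphic_on H \<and> (\<forall>w\<in>H. f w \<noteq> 0) \<longrightarrow>
      (\<exists>L. L holomorphic_on H \<and> (\<forall>w\<in>H. f w = exp (L w)))"
    using simply_connected_eq_holomorphic_log[OF H(1)] sc by (rule iffD1[THEN conjunct2])
  from this[rule_format, of "\<lambda>w. g w - c"] holc nz
  obtain L where L: "L holomorphic_on H" "\<And>w. w \<in> H \<Longrightarrow> g w - c = exp (L w)"
    by blast
  have bound: "Im w * norm (deriv L w) \<le> 38" if w: "w \<in> H" for w
  proof (rule ccontr)
    assume big: "\<not> ?thesis"
    have sub: "ball w (Im w) \<subseteq> H"
    proof
      fix v assume "v \<in> ball w (Im w)"
      then have "\<bar>Im (w - v)\<bar> < Im w" using abs_Im_le_cmod[of "w - v"] by (simp add: dist_norm)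
      then show "v \<in> H" by (simp add: H_def)
    qed
    define r where "r = Im w * norm (deriv L w) / 12"
    have r: "r > pi" using big pi_approx by (simp add: r_def)
    obtain b where b: "ball b r \<subseteq> L ` ball w (Im w)"
      by (rule Bloch[OF holomorphic_on_subset[OF L(1) sub], of r]) (use w in \<open>auto simp: r_def H_def\<close>)
    \<comment> \<open>Two points of the image of \<open>L\<close> at distance \<open>2 pi\<close> on a vertical line.\<close>
    have "b + of_real pi * \<i> \<in> ball b r" "b - of_real pi * \<i> \<in> ball b r"
      using r by (auto simp: dist_norm norm_mult)
    then have "b + of_real pi * \<i> \<in> L ` H" "b - of_real pi * \<i> \<in> L ` H" using b sub by blast+
    then obtain u v where uv: "u \<in> H" "v \<in> H" "L u = b + of_real pi * \<i>" "L v = b - of_real pi * \<i>"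
      by (metis imageE)
    have "exp (L u) = exp (L v)" unfolding exp_eq uv(3,4) by (intro exI[of _ 1]) simp
    then have "g u - c = g v - c" using L(2)[OF uv(1)] L(2)[OF uv(2)] by simp
    then have "g u = g v" by (metis diff_add_cancel)
    then have "u = v" using inj uv by (auto simp: H_def inj_on_def)
    then show False using uv by simp
  qed
  define F where "F t = Re (L (\<i> * of_real t)) + 38 * ln t" for t :: real
  have mono: "F 1 \<le> F t" if "t \<ge> 1" for t
  proof (rule DERIV_nonneg_imp_nondecreasing[OF that])
    fix x :: real assume x: "1 \<le> x" "x \<le> t"
    have xH: "\<i> * of_real x \<in> H" using x by (simp add: H_def)
    have "(L has_field_derivative deriv L (\<i> * of_real x)) (at (\<i> * of_real x))"
      by (rule holomorphic_derivI[OF L(1) H(1) xH])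
    then have "((\<lambda>z. L (\<i> * z)) has_field_derivative deriv L (\<i> * of_real x) * \<i>) (at (of_real x))"
      by (rule DERIV_chain2) (auto intro!: derivative_eq_intros)
    then have "((\<lambda>t. L (\<i> * of_real t)) has_vector_derivative deriv L (\<i> * of_real x) * \<i>) (at x)"
      by (rule has_vector_derivative_real_field)
    then have "((\<lambda>t. Re (L (\<i> * of_real t))) has_real_derivative Re (deriv L (\<i> * of_real x) * \<i>)) (at x)"
      by (rule has_field_derivative_Re)
    moreover have "((\<lambda>t. 38 * ln t) has_real_derivative 38 * (1 / x)) (at x)"
      using x by (auto intro!: derivative_eq_intros)
    ultimately have "(F has_real_derivative Re (deriv L (\<i> * of_real x) * \<i>) + 38 * (1 / x)) (at x)"
      unfolding F_def by (rule DERIV_add)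
    moreover have "Re (deriv L (\<i> * of_real x) * \<i>) + 38 * (1 / x) \<ge> 0"
    proof -
      have "x * norm (deriv L (\<i> * of_real x)) \<le> 38" using bound[OF xH] by simp
      then have "norm (deriv L (\<i> * of_real x) * \<i>) \<le> 38 / x" using x by (simp add: norm_mult field_simps)
      then show ?thesis using abs_Re_le_cmod[of "deriv L (\<i> * of_real x) * \<i>"] by simp
    qed
    ultimately show "\<exists>y. (F has_real_derivative y) (at x) \<and> 0 \<le> y" by blast
  qed
  show ?thesis
  proof (rule that[of "exp (F 1)"])
    fix t :: real assume t: "t \<ge> 1"
    have tH: "\<i> * of_real t \<in> H" using t by (simp add: H_def)
    have "exp (F 1) \<le> exp (F t)" using mono[OF t] by simp
    also have "exp (F t) = exp (Re (L (\<i> * of_real t))) * exp (38 * ln t)" by (simp add: F_def exp_add)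
    also have "exp (38 * ln t) = t ^ 38"
      using t exp_of_nat_mult[of 38 "ln t"] by simp
    also have "exp (Re (L (\<i> * of_real t))) = norm (g (\<i> * of_real t) - c)" using L(2)[OF tH] by simp
    finally show "exp (F 1) \<le> norm (g (\<i> * of_real t) - c) * t ^ 38" .
  qed simp
qed

lemma exponential_flatness:
  fixes h :: "real \<Rightarrow> real"
  assumes \<kappa>: "\<kappa> > 0" and lower: "\<And>t. t \<ge> 1 \<Longrightarrow> \<kappa> \<le> h t * t ^ 38" and h: "\<And>t. h t \<ge> 0"
  shows "eventually (\<lambda>t. exp (- 2 * pi * t) \<le> h t ^ N) at_top"
proof -
  have "((\<lambda>t::real. t ^ (38 * N) / exp t) \<longlongrightarrow> 0) at_top" by (rule tendsto_power_div_exp_0)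
  then have "eventually (\<lambda>t. t ^ (38 * N) / exp t < \<kappa> ^ N) at_top" by (rule order_tendstoD) (use \<kappa> in auto)
  then show ?thesis using eventually_ge_at_top[of 1]
  proof eventually_elim
    case (elim t)
    have "\<kappa> ^ N \<le> (h t * t ^ 38) ^ N" using lower[OF elim(2)] \<kappa> by (intro power_mono) auto
    also have "\<dots> = h t ^ N * t ^ (38 * N)" by (simp add: power_mult_distrib power_mult)
    finally have 1: "\<kappa> ^ N \<le> h t ^ N * t ^ (38 * N)" .
    have "t ^ (38 * N) < \<kappa> ^ N * exp t" using elim(1) by (simp add: pos_divide_less_eq)
    also have "\<dots> \<le> h t ^ N * t ^ (38 * N) * exp t" using 1 by (intro mult_right_mono) auto
    finally have "t ^ (38 * N) * 1 < t ^ (38 * N) * (h t ^ N * exp t)" by (simp add: mult_ac)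
    then have "1 < h t ^ N * exp t" using elim(2) by (subst (asm) mult_less_cancel_left_pos) auto
    then have "exp (- t) < h t ^ N" by (simp add: exp_minus field_simps)
    moreover have "exp (- 2 * pi * t) \<le> exp (- t)" using elim(2) pi_gt3 by simp
    ultimately show ?case by linarith
  qed
qed

section \<open>Cycles and their multipliers\<close>

definition orbit_multiplier :: "complex \<Rightarrow> nat \<Rightarrow> complex \<Rightarrow> complex" where
  "orbit_multiplier lam n z = (\<Prod>j<n. lam * (1 + tan ((tan_map lam ^^ j) z) ^ 2))"

definition cyclic_point :: "complex \<Rightarrow> nat \<Rightarrow> complex \<Rightarrow> bool" where
  "cyclic_point lam n z \<longleftrightarrow> n \<ge> 1 \<and> (tan_map lam ^^ n) z = z \<and>
     (\<forall>j. 0 < j \<and> j < n \<longrightarrow> (tan_map lam ^^ j) z \<noteq> z) \<and>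
     (\<forall>j<n. cos ((tan_map lam ^^ j) z) \<noteq> 0)"

text \<open>
  The full forward orbit, so that no period enters; for a periodic point it is the cycle.
\<close>

definition orbit_set :: "complex \<Rightarrow> complex \<Rightarrow> complex set" where
  "orbit_set lam z = range (\<lambda>j. (tan_map lam ^^ j) z)"

lemma DERIV_tan_map:
  "cos z \<noteq> 0 \<Longrightarrow> (tan_map lam has_field_derivative lam * (1 + tan z ^ 2)) (at z)"
  unfolding tan_map_def[abs_def] one_plus_tan_squared
  using DERIV_cmult[OF DERIV_tan[of z], of lam] by (simp add: inverse_eq_divide)

lemma DERIV_iterate:
  assumes "\<And>j. j < n \<Longrightarrow> cos ((tan_map lam ^^ j) z) \<noteq> 0"
  shows "((tan_map lam ^^ n) has_field_derivative orbit_multiplier lam n z) (at z)"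
  using assms
proof (induction n)
  case 0
  then show ?case by (simp add: orbit_multiplier_def id_def)
next
  case (Suc n)
  have "((\<lambda>z. tan_map lam ((tan_map lam ^^ n) z)) has_field_derivative
      lam * (1 + tan ((tan_map lam ^^ n) z) ^ 2) * orbit_multiplier lam n z) (at z)"
    by (rule DERIV_chain2[OF DERIV_tan_map]) (use Suc in auto)
  then show ?case by (simp add: orbit_multiplier_def o_def mult.commute)
qed

lemma cyclic_point_mod:
  assumes "cyclic_point lam n z"
  shows "(tan_map lam ^^ (j mod n)) z = (tan_map lam ^^ j) z"
  using assms by (simp add: cyclic_point_def funpow_mod_eq)

lemma cyclic_point_cos:
  assumes "cyclic_point lam n z"
  shows "cos ((tan_map lam ^^ j) z) \<noteq> 0"
proof -
  have "j mod n < n" using assms by (simp add: cyclic_point_def)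
  then have "cos ((tan_map lam ^^ (j mod n)) z) \<noteq> 0" using assms unfolding cyclic_point_def by blast
  then show ?thesis by (simp add: cyclic_point_mod[OF assms])
qed

lemma cyclic_point_add_period:
  assumes "cyclic_point lam n z"
  shows "(tan_map lam ^^ (j + n * m)) z = (tan_map lam ^^ j) z"
  using cyclic_point_mod[OF assms, of "j + n * m"] cyclic_point_mod[OF assms, of j] by simp

lemma cyclic_point_back:
  assumes "cyclic_point lam n z"
  shows "(tan_map lam ^^ (n * j - j)) ((tan_map lam ^^ j) z) = z"
proof -
  have "n \<ge> 1" using assms by (simp add: cyclic_point_def)
  then have "n * j - j + j = n * j" by simp
  then have "(tan_map lam ^^ (n * j - j)) ((tan_map lam ^^ j) z) = (tan_map lam ^^ (n * j)) z"
    by (metis comp_apply funpow_add)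
  also have "\<dots> = z" using cyclic_point_add_period[OF assms, of 0 j] by simp
  finally show ?thesis .
qed

lemma cyclic_point_iterate:
  assumes "cyclic_point lam n z"
  shows "cyclic_point lam n ((tan_map lam ^^ j) z)"
  unfolding cyclic_point_def
proof (intro conjI allI impI)
  let ?f = "tan_map lam"
  have com: "(?f ^^ a) ((?f ^^ b) x) = (?f ^^ b) ((?f ^^ a) x)" for a b x
    by (metis add.commute comp_apply funpow_add)
  show "n \<ge> 1" using assms by (simp add: cyclic_point_def)
  show "(?f ^^ n) ((?f ^^ j) z) = (?f ^^ j) z"
    using assms com[of n j z] by (simp add: cyclic_point_def)
  show "(?f ^^ i) ((?f ^^ j) z) \<noteq> (?f ^^ j) z" if i: "0 < i \<and> i < n" for i
  proof
    assume "(?f ^^ i) ((?f ^^ j) z) = (?f ^^ j) z"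
    then have "(?f ^^ i) z = z"
      using com[of i "n * j - j" "(?f ^^ j) z"] cyclic_point_back[OF assms, of j] by metis
    then show False using assms i unfolding cyclic_point_def by blast
  qed
  show "cos ((?f ^^ i) ((?f ^^ j) z)) \<noteq> 0" for i
    using cyclic_point_cos[OF assms, of "i + j"] by (simp add: funpow_add)
qed

lemma orbit_set_iterate:
  assumes "cyclic_point lam n z"
  shows "orbit_set lam ((tan_map lam ^^ j) z) = orbit_set lam z"
proof
  show "orbit_set lam ((tan_map lam ^^ j) z) \<subseteq> orbit_set lam z"
    unfolding orbit_set_def by clarsimp (metis comp_apply funpow_add rangeI)
  show "orbit_set lam z \<subseteq> orbit_set lam ((tan_map lam ^^ j) z)"
  proof -
    have "(tan_map lam ^^ i) z = (tan_map lam ^^ (i + (n * j - j))) ((tan_map lam ^^ j) z)" for i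
      using cyclic_point_back[OF assms, of j] by (simp add: funpow_add)
    then show ?thesis unfolding orbit_set_def by blast
  qed
qed

lemma orbit_set_eq:
  assumes "cyclic_point lam n z"
  shows "orbit_set lam z = (\<lambda>j. (tan_map lam ^^ j) z) ` {..<n}"
proof -
  have "n \<ge> 1" using assms by (simp add: cyclic_point_def)
  then have "(tan_map lam ^^ j) z \<in> (\<lambda>j. (tan_map lam ^^ j) z) ` {..<n}" for j
    using cyclic_point_mod[OF assms, of j] by (intro image_eqI[of _ _ "j mod n"]) auto
  then show ?thesis unfolding orbit_set_def by blast
qed

lemma in_orbit_set: "z \<in> orbit_set lam z"
  unfolding orbit_set_def by (rule range_eqI[of _ _ 0]) simp

lemma cyclic_point_dvd:
  assumes "cyclic_point lam n z" and "(tan_map lam ^^ m) z = z"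
  shows "n dvd m"
proof (rule ccontr)
  assume "\<not> n dvd m"
  then have "0 < m mod n" by (simp add: mod_greater_zero_iff_not_dvd)
  moreover have "m mod n < n" using assms(1) by (simp add: cyclic_point_def)
  moreover have "(tan_map lam ^^ (m mod n)) z = z" using cyclic_point_mod[OF assms(1), of m] assms(2) by simp
  ultimately show False using assms(1) unfolding cyclic_point_def by blast
qed

lemma card_orbit_set:
  assumes "cyclic_point lam n z"
  shows "card (orbit_set lam z) = n"
proof -
  have "inj_on (\<lambda>j. (tan_map lam ^^ j) z) {..<n}"
  proof (rule linorder_inj_onI)
    fix i j assume "i < j" "i \<in> {..<n}" "j \<in> {..<n}"
    show "(tan_map lam ^^ i) z \<noteq> (tan_map lam ^^ j) z"
    proof
      assume eq: "(tan_map lam ^^ i) z = (tan_map lam ^^ j) z"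
      have "(tan_map lam ^^ (j - i)) ((tan_map lam ^^ i) z) = (tan_map lam ^^ j) z"
        using \<open>i < j\<close> by (metis comp_apply funpow_add le_add_diff_inverse2 less_imp_le)
      then have "n dvd j - i" using cyclic_point_dvd[OF cyclic_point_iterate[OF assms]] eq by metis
      then show False using \<open>i < j\<close> \<open>j \<in> {..<n}\<close> by (auto dest!: dvd_imp_le)
    qed
  qed auto
  then show ?thesis by (simp add: orbit_set_eq[OF assms] card_image)
qed

lemma orbit_multiplier_iterate:
  assumes "cyclic_point lam n z"
  shows "orbit_multiplier lam n ((tan_map lam ^^ j) z) = orbit_multiplier lam n z"
proof -
  have "(\<Prod>i<n. lam * (1 + tan ((tan_map lam ^^ (j + i)) z) ^ 2)) = (\<Prod>i<n. lam * (1 + tan ((tan_map lam ^^ i) z) ^ 2))"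
    by (rule prod_lessThan_shift_periodic) (use cyclic_point_add_period[OF assms, of _ 1] in simp)
  then show ?thesis unfolding orbit_multiplier_def by (simp add: funpow_add add.commute[of j])
qed

lemma periodic_cycle_iff:
  assumes "lam \<noteq> 0"
  shows "periodic_cycle lam n C \<longleftrightarrow> (\<exists>z. cyclic_point lam n z \<and> C = orbit_set lam z)"
proof
  assume "periodic_cycle lam n C"
  then obtain z where "cyclic_point lam n z" "C = (\<lambda>j. (tan_map lam ^^ j) z) ` {..<n}"
    unfolding periodic_cycle_def cyclic_point_def using is_pole_tan_map_iff_cos[OF assms] by auto
  then show "\<exists>z. cyclic_point lam n z \<and> C = orbit_set lam z" using orbit_set_eq by blast
next
  assume "\<exists>z. cyclic_point lam n z \<and> C = orbit_set lam z"
  then obtain z where z: "cyclic_point lam n z" "C = (\<lambda>j. (tan_map lam ^^ j) z) ` {..<n}"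
    using orbit_set_eq by blast
  then show "periodic_cycle lam n C"
    unfolding periodic_cycle_def cyclic_point_def using is_pole_tan_map_iff_cos[OF assms] by auto
qed

lemma periodic_cycle_point:
  assumes "lam \<noteq> 0" "periodic_cycle lam n C" "z \<in> C"
  shows "cyclic_point lam n z" "C = orbit_set lam z" "cycle_multiplier lam C = orbit_multiplier lam n z" "card C = n"
proof -
  obtain z0 where z0: "cyclic_point lam n z0" "C = orbit_set lam z0"
    using assms periodic_cycle_iff by blast
  have pt: "cyclic_point lam n w \<and> C = orbit_set lam w \<and> orbit_multiplier lam n w = orbit_multiplier lam n z0"
    if "w \<in> C" for w
  proof -
    from that z0(2) obtain j where "w = (tan_map lam ^^ j) z0" by (auto simp: orbit_set_def)
    then show ?thesis
      using cyclic_point_iterate[OF z0(1)] orbit_set_iterate[OF z0(1)] orbit_multiplier_iterate[OF z0(1)] z0(2) by simp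
  qed
  show "cyclic_point lam n z" "C = orbit_set lam z" using pt[OF assms(3)] by auto
  show card: "card C = n" using card_orbit_set[OF z0(1)] z0(2) by simp
  define w where "w = (SOME z. z \<in> C)"
  have w: "w \<in> C" unfolding w_def using assms(3) by (rule someI)
  have "((tan_map lam ^^ n) has_field_derivative orbit_multiplier lam n w) (at w)"
    by (rule DERIV_iterate) (use cyclic_point_cos pt[OF w] in blast)
  then show "cycle_multiplier lam C = orbit_multiplier lam n z"
    unfolding cycle_multiplier_def card w_def[symmetric]
    using pt[OF w] pt[OF assms(3)] by (simp add: DERIV_imp_deriv)
qed

lemma attracting_cycle_orbit:
  assumes "lam \<noteq> 0" "cyclic_point lam n z" "norm (orbit_multiplier lam n z) < 1"
  shows "attracting_cycle lam n (orbit_set lam z)"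
proof -
  have "periodic_cycle lam n (orbit_set lam z)" using assms periodic_cycle_iff by blast
  then show ?thesis
    unfolding attracting_cycle_def using periodic_cycle_point(3)[OF assms(1) _ in_orbit_set] assms(3) by simp
qed

lemma cyclic_point_uminus:
  "cyclic_point lam n (- z) \<longleftrightarrow> cyclic_point lam n z"
  by (simp add: cyclic_point_def funpow_tan_map_uminus)

lemma orbit_set_uminus: "orbit_set lam (- z) = uminus ` orbit_set lam z"
  by (auto simp: orbit_set_def funpow_tan_map_uminus image_image)

lemma orbit_multiplier_uminus: "orbit_multiplier lam n (- z) = orbit_multiplier lam n z"
  by (simp add: orbit_multiplier_def funpow_tan_map_uminus)

lemma isCont_iterate:
  assumes "\<And>j. j < n \<Longrightarrow> cos ((tan_map lam ^^ j) z) \<noteq> 0"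
  shows "isCont (\<lambda>p. (tan_map (fst p) ^^ n) (snd p)) (lam, z)"
  using assms
proof (induction n)
  case 0 then show ?case by (simp add: continuous_snd[unfolded id_def])
next
  case (Suc n)
  define F where "F p = (tan_map (fst p) ^^ n) (snd p)" for p
  have IH: "isCont F (lam, z)" using Suc by (auto simp: F_def[abs_def])
  have "isCont (\<lambda>p. fst p * (sin (F p) / cos (F p))) (lam, z)"
    by (intro continuous_intros IH) (use Suc.prems[of n] in \<open>auto simp: F_def\<close>)
  moreover have "fst p * (sin (F p) / cos (F p)) = (tan_map (fst p) ^^ Suc n) (snd p)" for p
  proof -
    have "(tan_map (fst p) ^^ Suc n) (snd p) = tan_map (fst p) (F p)" by (simp add: F_def)
    also have "\<dots> = fst p * (sin (F p) / cos (F p))" unfolding tan_map_def tan_def ..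
    finally show ?thesis ..
  qed
  ultimately show ?case by simp
qed

section \<open>Continuation of attracting cycles\<close>

lemma isCont_orbit_multiplier:
  assumes "\<And>j. j < n \<Longrightarrow> cos ((tan_map lam ^^ j) z) \<noteq> 0"
  shows "isCont (\<lambda>p. orbit_multiplier (fst p) n (snd p)) (lam, z)"
proof -
  have *: "isCont (\<lambda>p. fst p * (1 + (sin (F p) / cos (F p)) ^ 2)) (lam, z)"
    if "isCont F (lam, z)" "cos (F (lam, z)) \<noteq> 0" for F :: "complex \<times> complex \<Rightarrow> complex"
    using that by (intro continuous_intros) auto
  have "isCont (\<lambda>p. \<Prod>j<n. fst p * (1 + (sin ((tan_map (fst p) ^^ j) (snd p)) / cos ((tan_map (fst p) ^^ j) (snd p))) ^ 2)) (lam, z)"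
    by (intro continuous_prod * isCont_iterate) (use assms in auto)
  then show ?thesis unfolding orbit_multiplier_def tan_def .
qed

lemma isCont_eventually_nhds:
  assumes "isCont f x" "open S" "f x \<in> S"
  shows "eventually (\<lambda>p. f p \<in> S) (nhds x)"
proof -
  have "(f \<longlongrightarrow> f x) (nhds x)" using assms(1) by (simp add: isCont_def tendsto_at_iff_tendsto_nhds)
  then show ?thesis using assms(2,3) by (rule topological_tendstoD)
qed

text \<open>
  Near an attracting periodic point the iterate is a contraction of a small disc, uniformly for nearby
  parameters; its fixed point depends continuously on the parameter. Exact period, absence of poles and the bound on
  the multiplier are open conditions.
\<close>

lemma attracting_point_continuation:
  assumes lam0: "lam0 \<noteq> 0" and z0: "cyclic_point lam0 n z0" and attr: "norm (orbit_multiplier lam0 n z0) < 1"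
    and s0: "s0 > 0"
  obtains \<delta> \<zeta> where "\<delta> > 0" "continuous_on (ball lam0 \<delta>) \<zeta>"
    "\<And>lam. lam \<in> ball lam0 \<delta> \<Longrightarrow> lam \<noteq> 0 \<and> \<zeta> lam \<in> ball z0 s0 \<and> cyclic_point lam n (\<zeta> lam) \<and>
       norm (orbit_multiplier lam n (\<zeta> lam)) < 1"
proof -
  define G where "G lam z = (tan_map lam ^^ n) z" for lam z
  have n: "n \<ge> 1" and G0: "G lam0 z0 = z0" using z0 by (auto simp: cyclic_point_def G_def)
  obtain c where c: "norm (orbit_multiplier lam0 n z0) < c" "c < 1" using attr dense by blast
  have c0: "c > 0" using c(1) norm_ge_zero le_less_trans by blast
  have cosz: "cos ((tan_map lam0 ^^ j) z0) \<noteq> 0" for j by (rule cyclic_point_cos[OF z0])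
  have contI: "isCont (\<lambda>p. (tan_map (fst p) ^^ j) (snd p)) (lam0, z0)" for j
    by (rule isCont_iterate) (rule cosz)
  have "eventually (\<lambda>p. (\<forall>j\<in>{..<n}. cos ((tan_map (fst p) ^^ j) (snd p)) \<in> - {0}) \<and>
      (\<forall>j\<in>{0<..<n}. (tan_map (fst p) ^^ j) (snd p) - snd p \<in> - {0}) \<and>
      orbit_multiplier (fst p) n (snd p) \<in> ball 0 c \<and> fst p \<in> - {0}) (nhds (lam0, z0))"
  proof (intro eventually_conj eventually_ball_finite ballI isCont_eventually_nhds)
    show "isCont (\<lambda>p. cos ((tan_map (fst p) ^^ j) (snd p))) (lam0, z0)" for j
      by (intro continuous_intros contI)
    show "isCont (\<lambda>p. (tan_map (fst p) ^^ j) (snd p) - snd p) (lam0, z0)" for j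
      by (intro continuous_intros contI)
    show "isCont (\<lambda>p. orbit_multiplier (fst p) n (snd p)) (lam0, z0)"
      by (rule isCont_orbit_multiplier) (rule cosz)
    show "(tan_map (fst (lam0, z0)) ^^ j) (snd (lam0, z0)) - snd (lam0, z0) \<in> - {0}" if "j \<in> {0<..<n}" for j
      using z0 that by (auto simp: cyclic_point_def)
  qed (use cosz c lam0 in \<open>auto intro!: continuous_intros\<close>)
  then obtain S where S: "open S" "(lam0, z0) \<in> S"
    and SP: "\<And>lam z. (lam, z) \<in> S \<Longrightarrow> (\<forall>j<n. cos ((tan_map lam ^^ j) z) \<noteq> 0) \<and>
      (\<forall>j. 0 < j \<and> j < n \<longrightarrow> (tan_map lam ^^ j) z \<noteq> z) \<and> norm (orbit_multiplier lam n z) < c \<and> lam \<noteq> 0"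
    unfolding eventually_nhds by fastforce
  obtain A B where AB: "open A" "open B" "lam0 \<in> A" "z0 \<in> B" "A \<times> B \<subseteq> S"
    by (metis S mem_Sigma_iff open_prod_elim)
  obtain a b where ab: "a > 0" "ball lam0 a \<subseteq> A" "b > 0" "ball z0 b \<subseteq> B" using AB openE by metis
  define s where "s = min (s0 / 2) (b / 2)"
  have s: "s > 0" "s < s0" "cball z0 s \<subseteq> B" using s0 ab by (auto simp: s_def)
  have inS: "(lam, z) \<in> S" if "lam \<in> ball lam0 a" "z \<in> cball z0 s" for lam z
    using that ab AB s by blast
  have contG: "isCont (\<lambda>p. G (fst p) (snd p)) (lam, z)" if "(lam, z) \<in> S" for lam z
    unfolding G_def by (rule isCont_iterate) (use SP[OF that] in auto)
  have "eventually (\<lambda>p. G (fst p) (snd p) \<in> ball z0 ((1 - c) * s)) (nhds (lam0, z0))"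
    by (rule isCont_eventually_nhds[OF contG[OF S(2)]]) (use G0 c s in auto)
  then obtain S' where S': "open S'" "(lam0, z0) \<in> S'" "\<And>lam z. (lam, z) \<in> S' \<Longrightarrow> G lam z \<in> ball z0 ((1 - c) * s)"
    unfolding eventually_nhds by fastforce
  obtain A' B' where AB': "open A'" "open B'" "lam0 \<in> A'" "z0 \<in> B'" "A' \<times> B' \<subseteq> S'"
    by (metis S'(1,2) mem_Sigma_iff open_prod_elim)
  obtain a' where a': "a' > 0" "ball lam0 a' \<subseteq> A'" using AB' openE by metis
  define \<delta> where "\<delta> = min a a'"
  have \<delta>: "\<delta> > 0" "ball lam0 \<delta> \<subseteq> ball lam0 a" "ball lam0 \<delta> \<subseteq> A'" using ab a' by (auto simp: \<delta>_def)
  have lip: "norm (G lam z - G lam w) \<le> c * norm (z - w)"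
    if lam: "lam \<in> ball lam0 \<delta>" and "z \<in> cball z0 s" "w \<in> cball z0 s" for lam z w
  proof (rule field_differentiable_bound[where S = "cball z0 s" and f' = "orbit_multiplier lam n"])
    fix v assume "v \<in> cball z0 s"
    then have v: "(lam, v) \<in> S" using inS lam \<delta> by blast
    show "(G lam has_field_derivative orbit_multiplier lam n v) (at v within cball z0 s)"
      unfolding G_def[abs_def] by (rule has_field_derivative_at_within[OF DERIV_iterate]) (use SP[OF v] in auto)
    show "norm (orbit_multiplier lam n v) \<le> c" using SP[OF v] by simp
  qed (use that in auto)
  have base: "norm (G lam z0 - z0) \<le> (1 - c) * s" if "lam \<in> ball lam0 \<delta>" for lam
  proof -
    have "(lam, z0) \<in> S'" using that \<delta>(3) AB' by blast
    from S'(3)[OF this] show ?thesis by (simp add: dist_norm norm_minus_commute)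
  qed
  have maps: "G lam z \<in> cball z0 s" if lam: "lam \<in> ball lam0 \<delta>" and z: "z \<in> cball z0 s" for lam z
  proof -
    have "norm (G lam z - z0) \<le> norm (G lam z - G lam z0) + norm (G lam z0 - z0)"
      using norm_triangle_ineq[of "G lam z - G lam z0" "G lam z0 - z0"] by simp
    also have "\<dots> \<le> c * norm (z - z0) + (1 - c) * s"
      using lip[OF lam z, of z0] base[OF lam] s by simp
    also have "c * norm (z - z0) \<le> c * s" using z c0 by (intro mult_left_mono) (auto simp: dist_norm norm_minus_commute)
    finally show ?thesis by (simp add: dist_norm norm_minus_commute algebra_simps)
  qed
  have "\<exists>!z. z \<in> cball z0 s \<and> G lam z = z" if lam: "lam \<in> ball lam0 \<delta>" for lam
  proof (rule Banach_fix)
    show "complete (cball z0 s)" by (simp add: complete_eq_closed)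
    show "cball z0 s \<noteq> {}" using s by simp
    show "G lam ` cball z0 s \<subseteq> cball z0 s" using maps[OF lam] by blast
    show "dist (G lam z) (G lam w) \<le> c * dist z w" if "z \<in> cball z0 s" "w \<in> cball z0 s" for z w
      using lip[OF lam that] by (simp add: dist_norm)
  qed (use c c0 in auto)
  then obtain \<zeta> where \<zeta>: "\<And>lam. lam \<in> ball lam0 \<delta> \<Longrightarrow> \<zeta> lam \<in> cball z0 s \<and> G lam (\<zeta> lam) = \<zeta> lam" by metis
  have "continuous_on (ball lam0 \<delta>) \<zeta>"
    unfolding continuous_on_def
  proof
    fix l assume l: "l \<in> ball lam0 \<delta>"
    have lS: "(l, \<zeta> l) \<in> S" using inS \<zeta>[OF l] l \<delta> by blast
    have pt: "isCont (\<lambda>l'. G l' (\<zeta> l)) l"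
      using isCont_o2[of l "\<lambda>l'. (l', \<zeta> l)" "\<lambda>p. G (fst p) (snd p)"] contG[OF lS] by (simp add: continuous_intros)
    have "((\<lambda>l'. \<zeta> l' - \<zeta> l) \<longlongrightarrow> 0) (at l within ball lam0 \<delta>)"
    proof (rule Lim_null_comparison)
      have "((\<lambda>l'. G l' (\<zeta> l)) \<longlongrightarrow> G l (\<zeta> l)) (at l within ball lam0 \<delta>)"
        using pt by (meson continuous_at_imp_continuous_at_within continuous_within)
      then have "((\<lambda>l'. G l' (\<zeta> l) - G l (\<zeta> l)) \<longlongrightarrow> 0) (at l within ball lam0 \<delta>)" by (rule LIM_zero)
      from tendsto_divide[OF tendsto_norm_zero[OF this] tendsto_const[of "1 - c"]]
      show "((\<lambda>l'. norm (G l' (\<zeta> l) - G l (\<zeta> l)) / (1 - c)) \<longlongrightarrow> 0) (at l within ball lam0 \<delta>)" using c by simp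
      show "eventually (\<lambda>l'. norm (\<zeta> l' - \<zeta> l) \<le> norm (G l' (\<zeta> l) - G l (\<zeta> l)) / (1 - c)) (at l within ball lam0 \<delta>)"
        unfolding eventually_at_topological
      proof (intro exI[of _ UNIV] conjI ballI impI)
        fix l' assume l': "l' \<in> ball lam0 \<delta>"
        have "\<zeta> l' - \<zeta> l = (G l' (\<zeta> l') - G l' (\<zeta> l)) + (G l' (\<zeta> l) - G l (\<zeta> l))" using \<zeta> l l' by simp
        then have "norm (\<zeta> l' - \<zeta> l) \<le> norm (G l' (\<zeta> l') - G l' (\<zeta> l)) + norm (G l' (\<zeta> l) - G l (\<zeta> l))"
          by (metis norm_triangle_ineq)
        also have "\<dots> \<le> c * norm (\<zeta> l' - \<zeta> l) + norm (G l' (\<zeta> l) - G l (\<zeta> l))"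
          using lip[OF l' conjunct1[OF \<zeta>[OF l']] conjunct1[OF \<zeta>[OF l]]] by (rule add_right_mono)
        finally have "(1 - c) * norm (\<zeta> l' - \<zeta> l) \<le> norm (G l' (\<zeta> l) - G l (\<zeta> l))" by (simp add: algebra_simps)
        then show "norm (\<zeta> l' - \<zeta> l) \<le> norm (G l' (\<zeta> l) - G l (\<zeta> l)) / (1 - c)"
          using c by (simp add: pos_le_divide_eq mult.commute)
      qed auto
    qed
    then show "(\<zeta> \<longlongrightarrow> \<zeta> l) (at l within ball lam0 \<delta>)" by (rule LIM_zero_cancel)
  qed
  moreover have "lam \<noteq> 0 \<and> \<zeta> lam \<in> ball z0 s0 \<and> cyclic_point lam n (\<zeta> lam) \<and> norm (orbit_multiplier lam n (\<zeta> lam)) < 1"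
    if lam: "lam \<in> ball lam0 \<delta>" for lam
  proof -
    have "(lam, \<zeta> lam) \<in> S" using inS \<zeta>[OF lam] lam \<delta> by blast
    from SP[OF this] show ?thesis using \<zeta>[OF lam] n c s by (auto simp: cyclic_point_def G_def)
  qed
  ultimately show ?thesis using that \<delta>(1) by blast
qed

definition attracting_points :: "complex \<Rightarrow> complex set" where
  "attracting_points lam = \<Union> (attracting_cycles lam)"

lemma attracting_pointsI:
  assumes "lam \<noteq> 0" "cyclic_point lam n z" "norm (orbit_multiplier lam n z) < 1"
  shows "z \<in> attracting_points lam"
  using attracting_cycle_orbit[OF assms] in_orbit_set unfolding attracting_points_def attracting_cycles_def by blast

lemma attracting_pointsE:
  assumes "lam \<noteq> 0" "z \<in> attracting_points lam"
  obtains n where "cyclic_point lam n z" "norm (orbit_multiplier lam n z) < 1"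
    "orbit_set lam z \<in> attracting_cycles lam" "cycle_multiplier lam (orbit_set lam z) = orbit_multiplier lam n z"
proof -
  obtain C n where C: "z \<in> C" "attracting_cycle lam n C"
    using assms(2) unfolding attracting_points_def attracting_cycles_def by blast
  then have per: "periodic_cycle lam n C" "norm (cycle_multiplier lam C) < 1" by (auto simp: attracting_cycle_def)
  note pt = periodic_cycle_point[OF assms(1) per(1) C(1)]
  show ?thesis using that[of n] pt C(2) per unfolding attracting_cycles_def by auto
qed

lemma open_hyperbolic_set: "open hyperbolic_set"
  unfolding open_contains_ball
proof
  fix lam0 assume l: "lam0 \<in> hyperbolic_set"
  then have lam0: "lam0 \<noteq> 0" and "attracting_cycles lam0 \<noteq> {}" by (auto simp: hyperbolic_set_def)
  then obtain C n where "attracting_cycle lam0 n C" unfolding attracting_cycles_def by blast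
  then obtain z0 where z0: "cyclic_point lam0 n z0" "norm (orbit_multiplier lam0 n z0) < 1"
    using periodic_cycle_iff[OF lam0] periodic_cycle_point(3)[OF lam0 _ in_orbit_set] unfolding attracting_cycle_def by metis
  obtain \<delta> \<zeta> where \<delta>: "\<delta> > 0" "\<And>lam. lam \<in> ball lam0 \<delta> \<Longrightarrow> lam \<noteq> 0 \<and> \<zeta> lam \<in> ball z0 1 \<and> cyclic_point lam n (\<zeta> lam) \<and>
       norm (orbit_multiplier lam n (\<zeta> lam)) < 1"
    by (rule attracting_point_continuation[OF lam0 z0 zero_less_one]) blast
  have "ball lam0 \<delta> \<subseteq> hyperbolic_set"
  proof
    fix lam assume "lam \<in> ball lam0 \<delta>"
    from \<delta>(2)[OF this] show "lam \<in> hyperbolic_set"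
      using attracting_cycle_orbit unfolding hyperbolic_set_def attracting_cycles_def by blast
  qed
  then show "\<exists>e>0. ball lam0 e \<subseteq> hyperbolic_set" using \<delta>(1) by blast
qed

definition attracting_bundle :: "complex set \<Rightarrow> (complex \<times> complex) set" where
  "attracting_bundle \<Omega> = {(lam, z). lam \<in> \<Omega> \<and> z \<in> attracting_points lam}"

text \<open>
  The continuations of the attracting points of \<open>lam0\<close> stay in disjoint discs. Since the number of
  attracting points is the same for all parameters, there are no others.
\<close>

lemma local_sections:
  assumes \<Omega>: "open \<Omega>" "0 \<notin> \<Omega>" and N: "N \<ge> 1" and card: "\<And>lam. lam \<in> \<Omega> \<Longrightarrow> card (attracting_points lam) = N"
    and lam0: "lam0 \<in> \<Omega>"
  obtains \<delta> s \<zeta> where "\<delta> > 0" "ball lam0 \<delta> \<subseteq> \<Omega>"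
    "\<And>a. a \<in> attracting_points lam0 \<Longrightarrow> continuous_on (ball lam0 \<delta>) (\<zeta> a)"
    "\<And>a lam. \<lbrakk>a \<in> attracting_points lam0; lam \<in> ball lam0 \<delta>\<rbrakk> \<Longrightarrow> \<zeta> a lam \<in> ball a s"
    "\<And>a b. \<lbrakk>a \<in> attracting_points lam0; b \<in> attracting_points lam0; a \<noteq> b\<rbrakk> \<Longrightarrow> ball a s \<inter> ball b s = {}"
    "\<And>lam. lam \<in> ball lam0 \<delta> \<Longrightarrow> attracting_points lam = (\<lambda>a. \<zeta> a lam) ` attracting_points lam0"
proof -
  define Z where "Z = attracting_points lam0"
  have Z: "card Z = N" using card lam0 by (simp add: Z_def)
  have fin: "finite Z" using Z N card.infinite[of Z] by fastforce
  have ne: "Z \<noteq> {}" using Z N by auto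
  have l0: "lam0 \<noteq> 0" using \<Omega> lam0 by auto
  obtain d where d: "d > 0" "\<And>a b. \<lbrakk>a \<in> Z; b \<in> Z; a \<noteq> b\<rbrakk> \<Longrightarrow> d \<le> dist a b"
  proof -
    have "finite {dist a b |a b. a \<in> Z \<and> b \<in> Z \<and> a \<noteq> b}"
      by (rule finite_subset[of _ "(\<lambda>(a, b). dist a b) ` (Z \<times> Z)"]) (use fin in auto)
    then have *: "finite (insert 1 {dist a b |a b. a \<in> Z \<and> b \<in> Z \<and> a \<noteq> b})" by simp
    show ?thesis
      by (rule that[of "Min (insert 1 {dist a b |a b. a \<in> Z \<and> b \<in> Z \<and> a \<noteq> b})"])
        (use * in \<open>auto simp: Min_gr_iff intro!: Min_le\<close>)
  qed
  define s where "s = d / 2"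
  have s: "s > 0" using d by (simp add: s_def)
  have disj: "ball a s \<inter> ball b s = {}" if "a \<in> Z" "b \<in> Z" "a \<noteq> b" for a b
    by (rule disjoint_ballI) (use d(2)[OF that] in \<open>simp add: s_def\<close>)
  define Q where "Q a \<delta> \<zeta> \<longleftrightarrow> \<delta> > 0 \<and> continuous_on (ball lam0 \<delta>) \<zeta> \<and>
      (\<forall>lam\<in>ball lam0 \<delta>. \<zeta> lam \<in> ball a s \<and> \<zeta> lam \<in> attracting_points lam)" for a \<delta> \<zeta>
  have "\<exists>\<delta> \<zeta>. Q a \<delta> \<zeta>" if aZ: "a \<in> Z" for a
  proof -
    obtain n where n: "cyclic_point lam0 n a" "norm (orbit_multiplier lam0 n a) < 1"
      using attracting_pointsE[OF l0 aZ[unfolded Z_def]] by blast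
    obtain \<delta> \<zeta> where *: "\<delta> > 0" "continuous_on (ball lam0 \<delta>) \<zeta>"
      "\<And>lam. lam \<in> ball lam0 \<delta> \<Longrightarrow> lam \<noteq> 0 \<and> \<zeta> lam \<in> ball a s \<and> cyclic_point lam n (\<zeta> lam) \<and>
        norm (orbit_multiplier lam n (\<zeta> lam)) < 1"
      by (rule attracting_point_continuation[OF l0 n s]) blast
    have "Q a \<delta> \<zeta>"
      unfolding Q_def using * attracting_pointsI by blast
    then show ?thesis by blast
  qed
  then have "\<forall>a\<in>Z. \<exists>\<delta>. \<exists>\<zeta>. Q a \<delta> \<zeta>" by blast
  then obtain \<delta>f where "\<forall>a\<in>Z. \<exists>\<zeta>. Q a (\<delta>f a) \<zeta>" using bchoice[of Z "\<lambda>a \<delta>. \<exists>\<zeta>. Q a \<delta> \<zeta>"] by blast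
  then obtain \<zeta> where "\<forall>a\<in>Z. Q a (\<delta>f a) (\<zeta> a)" using bchoice[of Z "\<lambda>a. Q a (\<delta>f a)"] by blast
  then have f: "\<And>a. a \<in> Z \<Longrightarrow> \<delta>f a > 0" "\<And>a. a \<in> Z \<Longrightarrow> continuous_on (ball lam0 (\<delta>f a)) (\<zeta> a)"
    "\<And>a lam. \<lbrakk>a \<in> Z; lam \<in> ball lam0 (\<delta>f a)\<rbrakk> \<Longrightarrow> \<zeta> a lam \<in> ball a s \<and> \<zeta> a lam \<in> attracting_points lam"
    unfolding Q_def by blast+
  obtain \<delta>0 where \<delta>0: "\<delta>0 > 0" "ball lam0 \<delta>0 \<subseteq> \<Omega>" using openE[OF \<Omega>(1) lam0] by blast
  define \<delta> where "\<delta> = Min (insert \<delta>0 (\<delta>f ` Z))"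
  have \<delta>: "\<delta> > 0" "\<delta> \<le> \<delta>0" "\<And>a. a \<in> Z \<Longrightarrow> \<delta> \<le> \<delta>f a"
    unfolding \<delta>_def using fin \<delta>0 f(1) by (simp_all add: Min_gr_iff)
  have sec: "\<zeta> a lam \<in> ball a s" "\<zeta> a lam \<in> attracting_points lam" if "a \<in> Z" "lam \<in> ball lam0 \<delta>" for a lam
    using f(3)[OF that(1), of lam] that \<delta>(3)[OF that(1)] by auto
  have sub: "ball lam0 \<delta> \<subseteq> \<Omega>" by (rule order_trans[OF subset_ball[OF \<delta>(2)] \<delta>0(2)])
  have all: "attracting_points lam = (\<lambda>a. \<zeta> a lam) ` Z" if lam: "lam \<in> ball lam0 \<delta>" for lam
  proof -
    have inj: "inj_on (\<lambda>a. \<zeta> a lam) Z"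
    proof (rule inj_onI, rule ccontr)
      fix a b assume ab: "a \<in> Z" "b \<in> Z" "\<zeta> a lam = \<zeta> b lam" "a \<noteq> b"
      then show False using sec(1)[OF ab(1) lam] sec(1)[OF ab(2) lam] disj[OF ab(1,2,4)] by auto
    qed
    have cardN: "card (attracting_points lam) = N" using card sub lam by blast
    then have "finite (attracting_points lam)" using N card.infinite[of "attracting_points lam"] by fastforce
    moreover have "(\<lambda>a. \<zeta> a lam) ` Z \<subseteq> attracting_points lam" using sec(2) lam by blast
    moreover have "card ((\<lambda>a. \<zeta> a lam) ` Z) = card (attracting_points lam)"
      using card_image[OF inj] Z cardN by simp
    ultimately show ?thesis by (intro card_subset_eq[symmetric])
  qed
  show ?thesis
  proof (rule that[of \<delta> \<zeta> s, OF \<delta>(1) sub])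
    show "continuous_on (ball lam0 \<delta>) (\<zeta> a)" if "a \<in> attracting_points lam0" for a
    proof -
      have "a \<in> Z" using that by (simp add: Z_def)
      then show ?thesis using continuous_on_subset[OF f(2) subset_ball[OF \<delta>(3)]] by blast
    qed
  qed (use sec disj all in \<open>simp_all add: Z_def\<close>)
qed

lemma covering_attracting_bundle:
  assumes \<Omega>: "open \<Omega>" "0 \<notin> \<Omega>" and N: "N \<ge> 1" and card: "\<And>lam. lam \<in> \<Omega> \<Longrightarrow> card (attracting_points lam) = N"
  shows "covering_space (attracting_bundle \<Omega>) fst \<Omega>"
proof
  let ?E = "attracting_bundle \<Omega>"
  show "continuous_on ?E fst" by (intro continuous_intros)
  show "fst ` ?E = \<Omega>"
  proof
    show "\<Omega> \<subseteq> fst ` ?E"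
    proof
      fix lam assume lam: "lam \<in> \<Omega>"
      then have "attracting_points lam \<noteq> {}" using card[OF lam] N by auto
      then show "lam \<in> fst ` ?E" using lam by (force simp: attracting_bundle_def)
    qed
  qed (auto simp: attracting_bundle_def)
  fix lam0 assume lam0: "lam0 \<in> \<Omega>"
  define Z where "Z = attracting_points lam0"
  obtain \<delta> s \<zeta> where \<delta>: "\<delta> > 0" "ball lam0 \<delta> \<subseteq> \<Omega>"
    and cont: "\<And>a. a \<in> Z \<Longrightarrow> continuous_on (ball lam0 \<delta>) (\<zeta> a)"
    and near: "\<And>a lam. \<lbrakk>a \<in> Z; lam \<in> ball lam0 \<delta>\<rbrakk> \<Longrightarrow> \<zeta> a lam \<in> ball a s"
    and disj: "\<And>a b. \<lbrakk>a \<in> Z; b \<in> Z; a \<noteq> b\<rbrakk> \<Longrightarrow> ball a s \<inter> ball b s = {}"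
    and all: "\<And>lam. lam \<in> ball lam0 \<delta> \<Longrightarrow> attracting_points lam = (\<lambda>a. \<zeta> a lam) ` Z"
    unfolding Z_def by (rule local_sections[OF \<Omega> N card lam0]) blast+
  define B where "B = ball lam0 \<delta>"
  define u where "u a = (\<lambda>lam. (lam, \<zeta> a lam)) ` B" for a
  have u_eq: "u a = ?E \<inter> (B \<times> ball a s)" if a: "a \<in> Z" for a
  proof
    show "u a \<subseteq> ?E \<inter> (B \<times> ball a s)"
      using near[OF a] all \<delta> a by (auto simp: u_def attracting_bundle_def B_def)
    show "?E \<inter> (B \<times> ball a s) \<subseteq> u a"
    proof clarify
      fix lam z assume E: "(lam, z) \<in> ?E" and lam: "lam \<in> B" and z: "z \<in> ball a s"
      have "z \<in> (\<lambda>a. \<zeta> a lam) ` Z" using E all lam by (auto simp: attracting_bundle_def B_def)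
      then obtain b where b: "b \<in> Z" "z = \<zeta> b lam" by blast
      have "z \<in> ball b s" using near[OF b(1)] lam b by (simp add: B_def)
      then have "b = a" using disj[OF b(1) a] z by blast
      then show "(lam, z) \<in> u a" using b lam by (auto simp: u_def)
    qed
  qed
  show "\<exists>T. lam0 \<in> T \<and> openin (top_of_set \<Omega>) T \<and>
      (\<exists>v. \<Union> v = ?E \<inter> fst -` T \<and> (\<forall>u\<in>v. openin (top_of_set ?E) u) \<and> pairwise disjnt v \<and>
        (\<forall>u\<in>v. \<exists>q. homeomorphism u T fst q))"
  proof (intro exI[of _ B] conjI exI[of _ "u ` Z"])
    show "lam0 \<in> B" using \<delta> by (simp add: B_def)
    show "openin (top_of_set \<Omega>) B"
      using \<delta> by (metis B_def open_ball openin_open_eq[OF \<Omega>(1)])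
    show "\<Union> (u ` Z) = ?E \<inter> fst -` B"
    proof
      show "\<Union> (u ` Z) \<subseteq> ?E \<inter> fst -` B" using u_eq by auto
      show "?E \<inter> fst -` B \<subseteq> \<Union> (u ` Z)"
      proof
        fix x assume x: "x \<in> ?E \<inter> fst -` B"
        obtain lam z where xz: "x = (lam, z)" by (cases x)
        have E: "(lam, z) \<in> ?E" and lam: "lam \<in> B" using x xz by auto
        have "z \<in> (\<lambda>a. \<zeta> a lam) ` Z" using E all[of lam] lam by (simp add: attracting_bundle_def B_def)
        then obtain a where "a \<in> Z" "z = \<zeta> a lam" by blast
        then have "a \<in> Z" "(lam, z) \<in> u a" using lam by (auto simp: u_def)
        then show "x \<in> \<Union> (u ` Z)" unfolding xz by blast
      qed
    qed
    show "\<forall>u\<in>u ` Z. openin (top_of_set ?E) u"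
    proof
      fix w assume "w \<in> u ` Z"
      then obtain a where a: "a \<in> Z" "w = u a" by blast
      have "open (B \<times> ball a s)" by (simp add: B_def open_Times)
      then show "openin (top_of_set ?E) w" unfolding a(2) u_eq[OF a(1)] by (rule openin_open_Int)
    qed
    show "pairwise disjnt (u ` Z)"
    proof (rule pairwiseI)
      fix v w assume "v \<in> u ` Z" "w \<in> u ` Z" "v \<noteq> w"
      then obtain a b where ab: "a \<in> Z" "b \<in> Z" "v = u a" "w = u b" "a \<noteq> b" by blast
      show "disjnt v w" using disj[OF ab(1,2,5)] u_eq ab by (auto simp: disjnt_def)
    qed
    show "\<forall>u\<in>u ` Z. \<exists>q. homeomorphism u B fst q"
    proof
      fix w assume "w \<in> u ` Z"
      then obtain a where a: "a \<in> Z" "w = u a" by blast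
      have "homeomorphism (u a) B fst (\<lambda>lam. (lam, \<zeta> a lam))"
        unfolding homeomorphism_def u_def
        using cont[OF a(1)] by (auto simp: B_def image_image intro!: continuous_intros)
      then show "\<exists>q. homeomorphism w B fst q" using a by blast
    qed
  qed
qed

lemma attracting_point_path:
  fixes lam :: "real \<Rightarrow> complex"
  assumes \<Omega>: "open \<Omega>" "0 \<notin> \<Omega>" and N: "N \<ge> 1" and card: "\<And>lam. lam \<in> \<Omega> \<Longrightarrow> card (attracting_points lam) = N"
    and cont: "continuous_on {0<..} lam" and lam: "\<And>t. t > 0 \<Longrightarrow> lam t \<in> \<Omega>"
  obtains \<zeta> where "continuous_on {0<..} \<zeta>" "\<And>t. t > 0 \<Longrightarrow> \<zeta> t \<in> attracting_points (lam t)"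
proof -
  have conv: "convex {0::real<..}" by simp
  obtain g where g: "continuous_on {0<..} g" "g \<in> {0<..} \<rightarrow> attracting_bundle \<Omega>" "\<And>t. t \<in> {0<..} \<Longrightarrow> fst (g t) = lam t"
    by (rule covering_space_lift[OF covering_attracting_bundle[OF \<Omega> N card] convex_imp_simply_connected[OF conv]
        convex_imp_locally_path_connected[OF conv] cont]) (use lam in auto)
  show ?thesis
  proof (rule that[of "\<lambda>t. snd (g t)"])
    show "continuous_on {0<..} (\<lambda>t. snd (g t))" by (intro continuous_intros g(1))
    show "snd (g t) \<in> attracting_points (lam t)" if "t > 0" for t
    proof -
      have "g t \<in> attracting_bundle \<Omega>" using g(2) that by auto
      then show ?thesis using g(3)[of t] that by (auto simp: attracting_bundle_def case_prod_beta)
    qed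
  qed
qed

section \<open>The virtual center\<close>

lemma bounded_limit_in_riemann_sphere:
  fixes r :: "real \<Rightarrow> complex"
  assumes bdd: "bounded \<Omega>" and r: "\<And>t. t > 0 \<Longrightarrow> r t \<in> \<Omega>"
    and lim: "limitin riemann_sphere (\<lambda>t. Some (r t)) v at_top"
  obtains l where "v = Some l" "(r \<longlongrightarrow> l) at_top"
proof (cases v)
  case None
  obtain B where "\<forall>x\<in>\<Omega>. norm x \<le> B" using bdd unfolding bounded_iff by blast
  then have B: "\<Omega> \<subseteq> cball 0 B" by auto
  have "openin riemann_sphere (insert None (Some ` (UNIV - cball 0 B)))"
    unfolding riemann_sphere_def openin_Alexandroff_compactification
    by (intro disjI2 exI[of _ "cball 0 B"]) auto
  then have "eventually (\<lambda>t. Some (r t) \<in> insert None (Some ` (UNIV - cball 0 B))) at_top"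
    using lim None unfolding limitin_def by blast
  then have "eventually (\<lambda>t. r t \<notin> cball 0 B \<and> t > 0) at_top"
    using eventually_gt_at_top[of 0] by eventually_elim auto
  then obtain t where "r t \<notin> cball 0 B" "t > 0"
    using eventually_happens'[OF trivial_limit_at_top_linorder] by blast
  then show ?thesis using r B by blast
next
  case (Some l)
  have "(r \<longlongrightarrow> l) at_top"
  proof (rule topological_tendstoI)
    fix S assume S: "open S" "l \<in> S"
    then have "openin riemann_sphere (Some ` S)" by (simp add: riemann_sphere_def)
    then have "eventually (\<lambda>t. Some (r t) \<in> Some ` S) at_top"
      using lim Some S(2) unfolding limitin_def by blast
    then show "eventually (\<lambda>t. r t \<in> S) at_top" by (rule eventually_mono) auto
  qed
  then show ?thesis using that Some by blast
qed

lemma hyperbolic_component_nonzero: "\<Omega> \<in> components hyperbolic_set \<Longrightarrow> 0 \<notin> \<Omega>"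
proof -
  have "0 \<notin> hyperbolic_set" by (simp add: hyperbolic_set_def)
  then show "\<Omega> \<in> components hyperbolic_set \<Longrightarrow> 0 \<notin> \<Omega>" using in_components_subset by blast
qed

lemma eigenvalue_map_eq:
  assumes "C \<in> attracting_cycles lam" and "\<And>D. D \<in> attracting_cycles lam \<Longrightarrow> cycle_multiplier lam D = cycle_multiplier lam C"
  shows "eigenvalue_map lam = cycle_multiplier lam C"
  unfolding eigenvalue_map_def
proof (rule the_equality)
  show "\<exists>D\<in>attracting_cycles lam. cycle_multiplier lam C = cycle_multiplier lam D" using assms(1) by blast
  show "m = cycle_multiplier lam C" if "\<exists>D\<in>attracting_cycles lam. m = cycle_multiplier lam D" for m
    using that assms(2) by blast
qed

lemma attracting_points_iterate:
  assumes "lam \<noteq> 0" "z \<in> attracting_points lam"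
  shows "(tan_map lam ^^ j) z \<in> attracting_points lam"
proof -
  obtain n where n: "cyclic_point lam n z" "norm (orbit_multiplier lam n z) < 1"
    using attracting_pointsE[OF assms] by blast
  then show ?thesis
    using attracting_pointsI[OF assms(1) cyclic_point_iterate[OF n(1)]] orbit_multiplier_iterate[OF n(1)] by simp
qed

lemma no_fixed_cyclic_point:
  assumes "cyclic_point lam n z" "n > 1"
  shows "z \<noteq> 0"
proof
  assume "z = 0"
  then have "(tan_map lam ^^ 1) z = z" by (simp add: tan_map_def)
  then show False using assms unfolding cyclic_point_def by (metis zero_less_one)
qed

text \<open>
  A point reaching its own negative would have a symmetric orbit, but the two cycles are exchanged by the
  symmetry and are distinct.
\<close>

lemma Omega_attracting_points:
  assumes Om: "Omega_component p \<Omega>" and lam: "lam \<in> \<Omega>" and p: "p > 1"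
  shows "card (attracting_points lam) = 2 * p"
    and "z \<in> attracting_points lam \<Longrightarrow> cyclic_point lam p z \<and> orbit_multiplier lam p z = eigenvalue_map lam \<and>
      (tan_map lam ^^ m) z \<noteq> - z"
proof -
  have "\<Omega> \<in> components hyperbolic_set" using Om unfolding Omega_component_def by (rule conjunct1)
  then have l0: "lam \<noteq> 0" using lam hyperbolic_component_nonzero by blast
  obtain C where C: "attracting_cycles lam = {C, uminus ` C}" "C \<noteq> uminus ` C"
      "attracting_cycle lam p C" "attracting_cycle lam p (uminus ` C)"
      "cycle_multiplier lam C = cycle_multiplier lam (uminus ` C)"
    using bspec[OF conjunct2[OF conjunct2[OF Om[unfolded Omega_component_def]]] lam] by blast
  have per: "periodic_cycle lam p C" "periodic_cycle lam p (uminus ` C)" using C by (auto simp: attracting_cycle_def)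
  have disj: "C \<inter> uminus ` C = {}"
    using periodic_cycle_point(2)[OF l0 per(1)] periodic_cycle_point(2)[OF l0 per(2)] C(2) by blast
  have neC: "C \<noteq> {}" using C(2) by blast
  have cardC: "card C = p" "card (uminus ` C) = p"
    using periodic_cycle_point(4)[OF l0 per(1)] periodic_cycle_point(4)[OF l0 per(2)] neC by blast+
  have fin: "finite C" "finite (uminus ` C)" using cardC p by (metis card.infinite not_less_zero)+
  have AP: "attracting_points lam = C \<union> uminus ` C" unfolding attracting_points_def C(1) by auto
  show "card (attracting_points lam) = 2 * p" unfolding AP card_Un_disjoint[OF fin disj] cardC by simp
  have ev: "eigenvalue_map lam = cycle_multiplier lam C"
    by (rule eigenvalue_map_eq) (use C in auto)
  assume z: "z \<in> attracting_points lam"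
  then consider "z \<in> C" | "z \<in> uminus ` C" using AP by blast
  then have cyc: "cyclic_point lam p z \<and> orbit_multiplier lam p z = eigenvalue_map lam"
    using periodic_cycle_point[OF l0 per(1)] periodic_cycle_point[OF l0 per(2)] ev C(5) by cases metis+
  moreover have "(tan_map lam ^^ m) z \<noteq> - z"
  proof
    assume eq: "(tan_map lam ^^ m) z = - z"
    have "orbit_set lam (- z) = orbit_set lam z" using orbit_set_iterate[of lam p z m] cyc eq by metis
    then have sym: "uminus ` orbit_set lam z = orbit_set lam z" by (simp add: orbit_set_uminus)
    have "orbit_set lam z = C \<or> orbit_set lam z = uminus ` C"
      using z AP periodic_cycle_point(2)[OF l0 per(1)] periodic_cycle_point(2)[OF l0 per(2)] by blast
    moreover have "uminus ` uminus ` C = C" by (simp add: image_image)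
    ultimately show False using sym C(2) by metis
  qed
  ultimately show "cyclic_point lam p z \<and> orbit_multiplier lam p z = eigenvalue_map lam \<and> (tan_map lam ^^ m) z \<noteq> - z"
    by blast
qed

text \<open>
  The only cycle is symmetric, so \<open>- z\<close> is an iterate of \<open>z\<close>; doubling the number of steps returns to \<open>z\<close>, which
  leaves half the period as the only possibility.
\<close>

lemma Omega'_attracting_points:
  assumes Om: "Omega'_component p \<Omega>" and lam: "lam \<in> \<Omega>" and p: "p > 1"
  shows "card (attracting_points lam) = 2 * p"
    and "z \<in> attracting_points lam \<Longrightarrow> cyclic_point lam (2 * p) z \<and> orbit_multiplier lam (2 * p) z = eigenvalue_map lam \<and>
      (tan_map lam ^^ p) z = - z"
proof -
  have "\<Omega> \<in> components hyperbolic_set" using Om unfolding Omega'_component_def by (rule conjunct1)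
  then have l0: "lam \<noteq> 0" using lam hyperbolic_component_nonzero by blast
  obtain C where C: "attracting_cycles lam = {C}" "attracting_cycle lam (2 * p) C"
    using bspec[OF conjunct2[OF conjunct2[OF Om[unfolded Omega'_component_def]]] lam] by blast
  have per: "periodic_cycle lam (2 * p) C" using C by (auto simp: attracting_cycle_def)
  have AP: "attracting_points lam = C" unfolding attracting_points_def C(1) by simp
  obtain z0 where "cyclic_point lam (2 * p) z0" "C = orbit_set lam z0" using per periodic_cycle_iff[OF l0] by blast
  then show "card (attracting_points lam) = 2 * p" using card_orbit_set AP by simp
  have ev: "eigenvalue_map lam = cycle_multiplier lam C"
    by (rule eigenvalue_map_eq) (use C in auto)
  assume "z \<in> attracting_points lam"
  then have z: "z \<in> C" by (simp add: AP)
  note pt = periodic_cycle_point[OF l0 per z]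
  have small: "norm (orbit_multiplier lam (2 * p) z) < 1" using C(2) pt(3) by (simp add: attracting_cycle_def)
  have "attracting_cycle lam (2 * p) (orbit_set lam (- z))"
    by (rule attracting_cycle_orbit[OF l0]) (use pt small in \<open>simp_all add: cyclic_point_uminus orbit_multiplier_uminus\<close>)
  then have "orbit_set lam (- z) = C" using C(1) unfolding attracting_cycles_def by blast
  then have "- z \<in> orbit_set lam z" using pt(2) in_orbit_set[of "- z" lam] by simp
  then obtain k where k: "k < 2 * p" "- z = (tan_map lam ^^ k) z"
    unfolding orbit_set_eq[OF pt(1)] by auto
  have "(tan_map lam ^^ (k + k)) z = (tan_map lam ^^ k) (- z)" by (simp only: funpow_add comp_apply k(2))
  also have "\<dots> = - (tan_map lam ^^ k) z" by (rule funpow_tan_map_uminus)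
  also have "\<dots> = z" unfolding k(2)[symmetric] by simp
  finally have "2 * p dvd k + k" using cyclic_point_dvd[OF pt(1)] by blast
  then have "p dvd k" by (simp add: mult_2[symmetric])
  moreover have "k \<noteq> 0"
  proof
    assume "k = 0"
    then have "- z = z" using k(2) by simp
    then have "z = 0" by (simp add: complex_eq_iff)
    then show False using no_fixed_cyclic_point[OF pt(1)] p by simp
  qed
  moreover obtain c where c: "k = p * c" using \<open>p dvd k\<close> by (rule dvdE)
  moreover have "c < 2" using k(1) unfolding c by (simp add: mult.commute)
  ultimately have "c = 1" by (cases c) auto
  then have "k = p" using c by simp
  then show "cyclic_point lam (2 * p) z \<and> orbit_multiplier lam (2 * p) z = eigenvalue_map lam \<and> (tan_map lam ^^ p) z = - z"
    using pt ev k by simp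
qed

lemma attracting_fixed_point_zero:
  assumes "lam \<noteq> 0" "norm lam < 1"
  shows "0 \<in> attracting_points lam"
proof (rule attracting_pointsI[OF assms(1)])
  show "cyclic_point lam 1 0" by (auto simp: cyclic_point_def tan_map_def)
  show "norm (orbit_multiplier lam 1 0) < 1" using assms(2) by (simp add: orbit_multiplier_def)
qed

text \<open>
  The common part of the two kinds of components. The hypothesis \<open>closing\<close> collects what is known about the number
  \<open>q + 1\<close> of steps between visits to infinity: it divides the period; it divides every \<open>m\<close> for which all attracting points
  reach their negatives after \<open>m\<close> steps, because such a pair of points escapes together; and the cycle
  closes up to sign after \<open>q + 1\<close> steps.
\<close>

lemma virtual_center_prepole:
  fixes p n :: nat and \<Omega> :: "complex set"
  assumes p: "p > 1"
    and comp: "\<Omega> \<in> components hyperbolic_set"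
    and card: "\<And>lam. lam \<in> \<Omega> \<Longrightarrow> card (attracting_points lam) = 2 * p"
    and pts: "\<And>lam z. \<lbrakk>lam \<in> \<Omega>; z \<in> attracting_points lam\<rbrakk> \<Longrightarrow>
      cyclic_point lam n z \<and> orbit_multiplier lam n z = eigenvalue_map lam"
    and n2: "n > 1"
    and bdd: "bounded \<Omega>" and vc: "is_virtual_center \<Omega> v"
    and closing: "\<And>q. \<lbrakk>Suc q dvd n; \<And>m. (\<And>lam z. \<lbrakk>lam \<in> \<Omega>; z \<in> attracting_points lam\<rbrakk> \<Longrightarrow> (tan_map lam ^^ m) z = - z) \<Longrightarrow> Suc q dvd m;
      \<exists>lam\<in>\<Omega>. \<exists>z\<in>attracting_points lam. (tan_map lam ^^ Suc q) z = z \<or> (tan_map lam ^^ Suc q) z = - z\<rbrakk> \<Longrightarrow> q = p - 1"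
  shows "\<exists>lam. v = Some lam \<and> prepole lam (p - 1) (lam * \<i>)"
proof -
  have n: "n \<ge> 1" using n2 by simp
  have op: "open \<Omega>" using open_components[OF open_hyperbolic_set comp] .
  have z0: "0 \<notin> \<Omega>" by (rule hyperbolic_component_nonzero[OF comp])
  obtain M where M: "eigenvalue_lift \<Omega> M"
      "\<And>\<alpha>. limitin riemann_sphere (\<lambda>t. Some (internal_ray \<Omega> M \<alpha> t)) v at_top"
    using vc unfolding is_virtual_center_def by blast
  have Mhol: "M holomorphic_on \<Omega>" and Mbij: "bij_betw M \<Omega> {w. Im w > 0}"
    and Mexp: "\<And>lam. lam \<in> \<Omega> \<Longrightarrow> exp (2 * of_real pi * \<i> * M lam) = eigenvalue_map lam"
    using M(1) unfolding eigenvalue_lift_def by blast+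
  have Minj: "inj_on M \<Omega>" and Mim: "M ` \<Omega> = {w. Im w > 0}" using Mbij by (auto simp: bij_betw_def)
  have "\<exists>g. g holomorphic_on (M ` \<Omega>) \<and> (\<forall>l\<in>\<Omega>. g (M l) = l)"
  proof (rule holomorphic_has_inverse[OF Mhol op Minj])
    fix g assume "g holomorphic_on M ` \<Omega>" "\<And>l. l \<in> \<Omega> \<Longrightarrow> g (M l) = l"
    then show ?thesis by blast
  qed
  then obtain g where g: "g holomorphic_on (M ` \<Omega>)" "\<And>l. l \<in> \<Omega> \<Longrightarrow> g (M l) = l" by blast
  have gH: "g w \<in> \<Omega>" "M (g w) = w" if "Im w > 0" for w
  proof -
    have "w \<in> M ` \<Omega>" using that Mim by simp
    then obtain l where "l \<in> \<Omega>" "w = M l" by blast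
    then show "g w \<in> \<Omega>" "M (g w) = w" using g(2) by auto
  qed
  define lam where "lam t = g (\<i> * of_real t)" for t :: real
  have lam\<Omega>: "lam t \<in> \<Omega>" and Mlam: "M (lam t) = \<i> * of_real t" if "t > 0" for t
    unfolding lam_def using gH[of "\<i> * of_real t"] that by auto
  have ray: "internal_ray \<Omega> M 0 t = lam t" if "t > 0" for t
  proof -
    have "Complex 0 t = M (lam t)" unfolding Mlam[OF that] by (simp add: complex_eq_iff)
    then show ?thesis unfolding internal_ray_def using inv_into_f_f[OF Minj lam\<Omega>[OF that]] by simp
  qed
  have ray\<Omega>: "internal_ray \<Omega> M 0 t \<in> \<Omega>" if "t > 0" for t using ray lam\<Omega> that by simp
  obtain ls where v: "v = Some ls" and lim0: "((\<lambda>t. internal_ray \<Omega> M 0 t) \<longlongrightarrow> ls) at_top"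
    by (rule bounded_limit_in_riemann_sphere[OF bdd ray\<Omega> M(2)])
  have lam_lim: "(lam \<longlongrightarrow> ls) at_top"
    using lim0
  proof (rule Lim_transform_eventually)
    show "eventually (\<lambda>t. internal_ray \<Omega> M 0 t = lam t) at_top"
      using eventually_gt_at_top[of 0] by (rule eventually_mono) (rule ray)
  qed
  have lam_ge: "norm (lam t) \<ge> 1" if "t > 0" for t
  proof (rule ccontr)
    assume "\<not> ?thesis"
    then have "0 \<in> attracting_points (lam t)"
      using attracting_fixed_point_zero[of "lam t"] lam\<Omega>[OF that] z0 by fastforce
    then have "cyclic_point (lam t) n 0" using pts lam\<Omega>[OF that] by blast
    then show False using no_fixed_cyclic_point n2 by blast
  qed
  have ls0: "ls \<noteq> 0"
  proof
    assume "ls = 0"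
    then have "eventually (\<lambda>t. dist (lam t) 0 < 1 \<and> t > 0) at_top"
      using tendstoD[OF lam_lim, of 1] eventually_gt_at_top[of 0] by (intro eventually_conj) auto
    then obtain t where "dist (lam t) 0 < 1" "t > 0"
      using eventually_happens'[OF trivial_limit_at_top_linorder] by blast
    then show False using lam_ge by fastforce
  qed
  have ls_notin: "ls \<notin> \<Omega>"
  proof
    assume ls: "ls \<in> \<Omega>"
    have "isCont M ls"
      using continuous_on_interior[OF holomorphic_on_imp_continuous_on[OF Mhol]] ls interior_open[OF op] by simp
    then have "((\<lambda>t. M (lam t)) \<longlongrightarrow> M ls) at_top" by (rule isCont_tendsto_compose[OF _ lam_lim])
    then have "((\<lambda>t. norm (M (lam t))) \<longlongrightarrow> norm (M ls)) at_top" by (rule tendsto_norm)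
    then have "eventually (\<lambda>t. norm (M (lam t)) < norm (M ls) + 1) at_top" by (rule order_tendstoD) simp
    then have "eventually (\<lambda>t. norm (M (lam t)) < norm (M ls) + 1 \<and> t \<ge> max 1 (norm (M ls) + 1)) at_top"
      by (intro eventually_conj eventually_ge_at_top)
    then obtain t where "norm (M (lam t)) < norm (M ls) + 1" "t \<ge> max 1 (norm (M ls) + 1)"
      using eventually_happens'[OF trivial_limit_at_top_linorder] by blast
    then show False using Mlam[of t] by (simp add: norm_mult)
  qed
  have cont_lam: "continuous_on {0<..} lam"
    unfolding lam_def
    by (rule continuous_on_compose2[OF holomorphic_on_imp_continuous_on[OF g(1)]])
      (auto intro!: continuous_intros simp: Mim)
  obtain \<zeta> where \<zeta>: "continuous_on {0<..} \<zeta>" "\<And>t. t > 0 \<Longrightarrow> \<zeta> t \<in> attracting_points (lam t)"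
    by (rule attracting_point_path[OF op z0 _ card cont_lam lam\<Omega>]) (use p in auto)
  have lam_nz: "lam t \<noteq> 0" if "t > 0" for t using lam\<Omega>[OF that] z0 by auto
  define z where "z j t = (tan_map (lam t) ^^ j) (\<zeta> t)" for j t
  have cyc: "cyclic_point (lam t) n (\<zeta> t)" "orbit_multiplier (lam t) n (\<zeta> t) = eigenvalue_map (lam t)" if "t > 0" for t
    using pts[OF lam\<Omega>[OF that] \<zeta>(2)[OF that]] by auto
  have no_pole: "cos (z j t) \<noteq> 0" if "t > 0" for j t
    unfolding z_def by (rule cyclic_point_cos[OF cyc(1)[OF that]])
  have cont_z: "continuous_on {0<..} (z j)" for j
  proof (induction j)
    case 0 then show ?case using \<zeta>(1) by (simp add: z_def)
  next
    case (Suc j)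
    have "continuous_on {0<..} (\<lambda>t. lam t * (sin (z j t) / cos (z j t)))"
      by (intro continuous_intros Suc cont_lam) (use no_pole in auto)
    moreover have "lam t * (sin (z j t) / cos (z j t)) = z (Suc j) t" for t
    proof -
      have "z (Suc j) t = tan_map (lam t) (z j t)" by (simp add: z_def)
      then show ?thesis unfolding tan_map_def tan_def by simp
    qed
    ultimately show ?case by simp
  qed
  have mult: "norm (\<Prod>j<n. lam t * (1 + tan (z j t) ^ 2)) = exp (- 2 * pi * t)" if "t > 0" for t
  proof -
    have "(\<Prod>j<n. lam t * (1 + tan (z j t) ^ 2)) = eigenvalue_map (lam t)"
      using cyc(2)[OF that] by (simp add: orbit_multiplier_def z_def)
    also have "\<dots> = exp (2 * of_real pi * \<i> * (\<i> * of_real t))" using Mexp[OF lam\<Omega>[OF that]] Mlam[OF that] by simp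
    finally show ?thesis by simp
  qed
  have flat: "eventually (\<lambda>t. norm (\<Prod>j<n. lam t * (1 + tan (z j t) ^ 2)) \<le> norm (lam t - ls) ^ N) at_top" for N
  proof -
    have inj: "inj_on g {w. Im w > 0}" using gH(2) by (intro inj_onI) (metis mem_Collect_eq)
    have omit: "ls \<notin> g ` {w. Im w > 0}" using gH(1) ls_notin by auto
    obtain \<kappa> where \<kappa>: "\<kappa> > 0" "\<And>t. t \<ge> 1 \<Longrightarrow> \<kappa> \<le> norm (g (\<i> * of_real t) - ls) * t ^ 38"
      by (rule univalent_omitted_value_growth[OF g(1)[unfolded Mim] inj omit]) blast
    have "eventually (\<lambda>t. exp (- 2 * pi * t) \<le> norm (lam t - ls) ^ N) at_top"
      by (rule exponential_flatness[OF \<kappa>(1)]) (use \<kappa>(2) in \<open>auto simp: lam_def\<close>)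
    then show ?thesis using eventually_gt_at_top[of 0] by eventually_elim (simp add: mult)
  qed
  interpret P: tangent_cycle_path lam z n ls
  proof
    show "((\<lambda>t. \<Prod>j<n. lam t * (1 + tan (z j t) ^ 2)) \<longlongrightarrow> 0) at_top"
    proof (rule Lim_null_comparison)
      show "eventually (\<lambda>t. norm (\<Prod>j<n. lam t * (1 + tan (z j t) ^ 2)) \<le> norm (lam t - ls)) at_top"
        using flat[of 1] by simp
      show "((\<lambda>t. norm (lam t - ls)) \<longlongrightarrow> 0) at_top" by (rule tendsto_norm_zero[OF LIM_zero[OF lam_lim]])
    qed
    show "z (j + n) t = z j t" if "t > 0" for j t
      unfolding z_def using cyclic_point_add_period[OF cyc(1)[OF that], of j 1] by simp
    show "z (Suc j) t = tan_map (lam t) (z j t)" for j t by (simp add: z_def)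
  qed (fact cont_lam cont_z n no_pole lam_nz lam_lim ls0)+
  obtain j0 where j0: "filterlim (z j0) at_infinity at_top" using P.escaping_index by blast
  interpret S: tangent_cycle_path lam "\<lambda>i. z (j0 + i)" n ls by (rule P.shift)
  interpret E: escaping_cycle_path lam "\<lambda>i. z (j0 + i)" n ls
  proof
    show "filterlim (z (j0 + 0)) at_infinity at_top" using j0 by simp
    show "eventually (\<lambda>t. norm (\<Prod>j<n. lam t * (1 + tan (z (j0 + j) t) ^ 2)) \<le> norm (lam t - ls) ^ N) at_top" for N
      using flat[of N] eventually_gt_at_top[of 0]
    proof eventually_elim
      case (elim t)
      have "(\<Prod>j<n. lam t * (1 + tan (z (j0 + j) t) ^ 2)) = (\<Prod>j<n. lam t * (1 + tan (z j t) ^ 2))"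
        by (rule prod_lessThan_shift_periodic[where a = "\<lambda>i. lam t * (1 + tan (z i t) ^ 2)"])
          (simp add: P.periodic[OF elim(2)])
      then show ?case using elim(1) by simp
    qed
  qed
  define q where "q = S.q"
  have zAP: "z j t \<in> attracting_points (lam t)" if "t > 0" for j t
    unfolding z_def by (rule attracting_points_iterate[OF lam_nz[OF that] \<zeta>(2)[OF that]])
  have zadd: "z (j0 + m) t = (tan_map (lam t) ^^ m) (z j0 t)" for m t
    unfolding z_def by (metis add.commute comp_apply funpow_add)
  have "q = p - 1"
  proof (rule closing)
    show "Suc q dvd n" using E.period_dvd by (simp add: q_def)
    show "Suc q dvd m" if "\<And>l w. \<lbrakk>l \<in> \<Omega>; w \<in> attracting_points l\<rbrakk> \<Longrightarrow> (tan_map l ^^ m) w = - w" for m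
    proof -
      have "z (j0 + m) t = - z j0 t" if "t > 0" for t
        unfolding zadd using \<open>\<And>l w. \<lbrakk>l \<in> \<Omega>; w \<in> attracting_points l\<rbrakk> \<Longrightarrow> (tan_map l ^^ m) w = - w\<close>[OF lam\<Omega>[OF that] zAP[OF that]] .
      then have ev: "eventually (\<lambda>t. - z j0 t = z (j0 + m) t) at_top"
        by (intro eventually_mono[OF eventually_gt_at_top[of 0]]) simp
      have "filterlim (\<lambda>t. - z j0 t) at_infinity at_top"
        using j0 by (simp add: filterlim_at_infinity[of 0])
      from filterlim_mono_eventually[OF this order_refl order_refl ev]
      have "filterlim (z (j0 + m)) at_infinity at_top" .
      then show ?thesis using E.infinite_iff[of m] by (simp add: q_def)
    qed
    obtain t where t: "t > 0" "z (j0 + Suc q) t = z (j0 + 0) t \<or> z (j0 + Suc q) t = - z (j0 + 0) t"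
      using E.half_cycle_closes unfolding q_def by blast
    then show "\<exists>lam\<in>\<Omega>. \<exists>z\<in>attracting_points lam. (tan_map lam ^^ Suc q) z = z \<or> (tan_map lam ^^ Suc q) z = - z"
      using lam\<Omega>[OF t(1)] zAP[OF t(1), of j0] zadd[of "Suc q" t] zadd[of 0 t]
      by (intro bexI[of _ "lam t"] bexI[of _ "z j0 t"]) auto
  qed
  then show ?thesis using v S.prepole_q by (simp add: q_def)
qed

theorem proposition8p6:
  fixes p :: nat and \<Omega> :: "complex set" and v :: "complex option"
  assumes "p > 1"
    and "Omega_component p \<Omega> \<or> Omega'_component p \<Omega>"
    and "bounded \<Omega>"
    and "is_virtual_center \<Omega> v"
  shows "\<exists>lam. v = Some lam \<and> prepole lam (p - 1) (lam * \<i>)"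
  using assms(2)
proof
  assume Om: "Omega_component p \<Omega>"
  note pts = Omega_attracting_points[OF Om _ assms(1)]
  show ?thesis
  proof (rule virtual_center_prepole[where n = p, OF assms(1) _ pts(1) _ assms(1) assms(3,4)])
    show "\<Omega> \<in> components hyperbolic_set" using Om unfolding Omega_component_def by (rule conjunct1)
    show "cyclic_point lam p z \<and> orbit_multiplier lam p z = eigenvalue_map lam"
      if "lam \<in> \<Omega>" "z \<in> attracting_points lam" for lam z using pts(2)[OF that] by blast
    fix q assume q: "Suc q dvd p"
      and "\<exists>lam\<in>\<Omega>. \<exists>z\<in>attracting_points lam. (tan_map lam ^^ Suc q) z = z \<or> (tan_map lam ^^ Suc q) z = - z"
    then obtain lam z where lz: "lam \<in> \<Omega>" "z \<in> attracting_points lam"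
      "(tan_map lam ^^ Suc q) z = z \<or> (tan_map lam ^^ Suc q) z = - z" by blast
    then have "(tan_map lam ^^ Suc q) z = z" using pts(2)[OF lz(1,2)] by blast
    then have "p dvd Suc q" using cyclic_point_dvd pts(2)[OF lz(1,2)] by blast
    then have "p = Suc q" using q by (simp add: dvd_antisym)
    then show "q = p - 1" by simp
  qed (use assms(1) in auto)
next
  assume Om: "Omega'_component p \<Omega>"
  note pts = Omega'_attracting_points[OF Om _ assms(1)]
  show ?thesis
  proof (rule virtual_center_prepole[where n = "2 * p", OF assms(1) _ pts(1) _ _ assms(3,4)])
    show "\<Omega> \<in> components hyperbolic_set" using Om unfolding Omega'_component_def by (rule conjunct1)
    show "cyclic_point lam (2 * p) z \<and> orbit_multiplier lam (2 * p) z = eigenvalue_map lam"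
      if "lam \<in> \<Omega>" "z \<in> attracting_points lam" for lam z using pts(2)[OF that] by blast
    fix q assume anti: "\<And>m. (\<And>lam z. \<lbrakk>lam \<in> \<Omega>; z \<in> attracting_points lam\<rbrakk> \<Longrightarrow> (tan_map lam ^^ m) z = - z) \<Longrightarrow> Suc q dvd m"
      and "\<exists>lam\<in>\<Omega>. \<exists>z\<in>attracting_points lam. (tan_map lam ^^ Suc q) z = z \<or> (tan_map lam ^^ Suc q) z = - z"
    then obtain lam z where lz: "lam \<in> \<Omega>" "z \<in> attracting_points lam"
      "(tan_map lam ^^ Suc q) z = z \<or> (tan_map lam ^^ Suc q) z = - z" by blast
    have qp: "Suc q dvd p" using anti pts(2) by blast
    have "(tan_map lam ^^ (Suc q + Suc q)) z = z"
    proof -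
      have "(tan_map lam ^^ (Suc q + Suc q)) z = (tan_map lam ^^ Suc q) ((tan_map lam ^^ Suc q) z)"
        by (simp only: funpow_add comp_apply)
      then show ?thesis using lz(3) funpow_tan_map_uminus[of "Suc q" lam z] by (metis minus_minus)
    qed
    then have "2 * p dvd Suc q + Suc q" using cyclic_point_dvd pts(2)[OF lz(1,2)] by blast
    then have "2 * p dvd 2 * Suc q" by (simp only: mult_2)
    then have "p dvd Suc q" by (simp only: nat_mult_dvd_cancel_disj) simp
    then have "p = Suc q" using qp by (simp add: dvd_antisym)
    then show "q = p - 1" by simp
  qed (use assms(1) in auto)
qed

end
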